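(* Let $G=(G^{+},G^{-})$ be a signed graph on a finite vertex set $V_{G}$ and assume that $G^{+}\supseteq G^{-}$, i.e. every negative edge $\{u,v\}\in E_G^-$ is also a positive edge, $\{u,v\}\in E_G^+$. Then the following are equivalent: (1) $G$ is balanced chordal; (2) the signed-graphic arrangement $\mathcal{A}(G^{+},G^{-},V_{G})$ (every vertex carries a loop) is free; (3) $\mathcal{A}(G^{+},G^{-},L)$ is free for some loop set $L\subseteq V_{G}$.
   Context: A signed graph is a triple $G=(G^{+},G^{-},L_{G})$ where $G^{+}=(V_G,E_G^{+})$ and $G^{-}=(V_G,E_G^{-})$ are simple graphs on the same finite vertex set $V_G$ and $L_G\subseteq V_G$ is the set of loops; elements of $E_G^+$ (resp. $E_G^-$) are positive (resp. negative) edges. Writing $(G^+,G^-)$ means loops are not considered. For $V_G=\{1,\dots,\ell\}$, the signed-graphic arrangement $\mathcal{A}(G)$ in $\mathbb{K}^{\ell}$ ($\mathbb{K}$ a field of characteristic zero, e.g. $\mathbb{R}$) consists of the hyperplanes $\{x_i-x_j=0\}$ for $\{i,j\}\in E_G^+$, $\{x_i+x_j=0\}$ for $\{i,j\}\in E_G^-$, and $\{x_i=0\}$ for $i\in L_G$. An arrangement $\mathcal{A}$ is free if its module of logarithmic derivations $D(\mathcal{A})=\{\theta\in\mathrm{Der}(S):\theta(\alpha_H)\in\alpha_H S\ \forall H\in\mathcal{A}\}$ is a free module over the polynomial ring $S=\mathbb{K}[x_1,\dots,x_\ell]$, where $\ker\alpha_H=H$. A cycle of length $k\ge 3$ is a sequence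 of distinct vertices $v_1,\dots,v_k$ together with edges $\{v_1,v_2\},\dots,\{v_{k-1},v_k\},\{v_k,v_1\}$, each of which may be positive or negative. A cycle is balanced if it contains an even number of negative edges. A balanced chord of a balanced cycle is an edge of $G$ that is not part of the cycle, connects two vertices of the cycle, and separates the cycle into two balanced cycles. $G$ is balanced chordal if every balanced cycle of length at least four has a balanced chord (this ignores loops). *)

theory Defs
  imports
    "HOL-Analysis.Finite_Cartesian_Product"
    "HOL-Library.Poly_Mapping"
    "HOL-Library.Function_Algebras"
begin

section \<open>Signed graphs and balanced chordality\<close>

text \<open>
  The vertex set is the universe of a finite type \<open>'v\<close>. A signed graph is given by its set
  \<open>Gp\<close> of positive edges, its set \<open>Gn\<close> of negative edges and, where loops are considered, a set
  \<open>L\<close> of vertices; an edge is an unordered pair of distinct vertices.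
\<close>

definition simple_edges :: "'v set set \<Rightarrow> bool" where
  "simple_edges E \<longleftrightarrow> (\<forall>e\<in>E. card e = 2)"

datatype sign = Pos | Neg

definition signed_edges :: "'v set set \<Rightarrow> 'v set set \<Rightarrow> ('v set \<times> sign) set" where
  "signed_edges Gp Gn = (\<lambda>e. (e, Pos)) ` Gp \<union> (\<lambda>e. (e, Neg)) ` Gn"

text \<open>
  A cycle is a list of vertices \<open>vs\<close> with a list of signs \<open>ss\<close> of the same length: its \<open>i\<close>-th edge
  joins \<open>vs ! i\<close> to the cyclically next vertex and has sign \<open>ss ! i\<close>.
\<close>

definition cycle_edge :: "'v list \<Rightarrow> sign list \<Rightarrow> nat \<Rightarrow> 'v set \<times> sign" where
  "cycle_edge vs ss i = ({vs ! i, vs ! (Suc i mod length vs)}, ss ! i)"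

definition is_cycle :: "'v set set \<Rightarrow> 'v set set \<Rightarrow> 'v list \<Rightarrow> sign list \<Rightarrow> bool" where
  "is_cycle Gp Gn vs ss \<longleftrightarrow>
     3 \<le> length vs \<and> length ss = length vs \<and> distinct vs \<and>
     (\<forall>i<length vs. cycle_edge vs ss i \<in> signed_edges Gp Gn)"

definition balanced_cycle :: "'v set set \<Rightarrow> 'v set set \<Rightarrow> 'v list \<Rightarrow> sign list \<Rightarrow> bool" where
  "balanced_cycle Gp Gn vs ss \<longleftrightarrow>
     is_cycle Gp Gn vs ss \<and> even (length (filter (\<lambda>s. s = Neg) ss))"

text \<open>
  For \<open>i < j\<close>, an edge of sign \<open>s\<close> between the \<open>i\<close>-th and the \<open>j\<close>-th vertex separates the cycle
  \<open>v\<^sub>0, \<dots>, v\<^sub>k\<^sub>-\<^sub>1\<close> into \<open>v\<^sub>i, \<dots>, v\<^sub>j\<close> and \<open>v\<^sub>0, \<dots>, v\<^sub>i, v\<^sub>j, \<dots>, v\<^sub>k\<^sub>-\<^sub>1\<close>. Both parts have to be cycles, hence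
  of length at least three, so an edge parallel to an edge of the cycle is not a chord.
\<close>

definition balanced_chord ::
  "'v set set \<Rightarrow> 'v set set \<Rightarrow> 'v list \<Rightarrow> sign list \<Rightarrow> nat \<Rightarrow> nat \<Rightarrow> sign \<Rightarrow> bool" where
  "balanced_chord Gp Gn vs ss i j s \<longleftrightarrow>
     i < j \<and> j < length vs \<and>
     ({vs ! i, vs ! j}, s) \<in> signed_edges Gp Gn \<and>
     ({vs ! i, vs ! j}, s) \<notin> cycle_edge vs ss ` {..<length vs} \<and>
     balanced_cycle Gp Gn (take (j - i + 1) (drop i vs)) (take (j - i) (drop i ss) @ [s]) \<and>
     balanced_cycle Gp Gn (take (i + 1) vs @ drop j vs) (take i ss @ [s] @ drop j ss)"

definition balanced_chordal :: "'v set set \<Rightarrow> 'v set set \<Rightarrow> bool" where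
  "balanced_chordal Gp Gn \<longleftrightarrow>
     (\<forall>vs ss. balanced_cycle Gp Gn vs ss \<and> 4 \<le> length vs \<longrightarrow>
        (\<exists>i j s. balanced_chord Gp Gn vs ss i j s))"


section \<open>Signed-graphic arrangements\<close>

definition signed_arrangement ::
  "'v::finite set set \<Rightarrow> 'v set set \<Rightarrow> 'v set \<Rightarrow> ('k::field ^ 'v) set set" where
  "signed_arrangement Gp Gn L =
     {{x. x $ i - x $ j = 0} | i j. {i, j} \<in> Gp} \<union>
     {{x. x $ i + x $ j = 0} | i j. {i, j} \<in> Gn} \<union>
     {{x. x $ i = 0} | i. i \<in> L}"


section \<open>Logarithmic derivations and freeness\<close>

text \<open>The polynomial ring over \<open>'k\<close> in indeterminates indexed by \<open>'v\<close>, as finitely supported maps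
  from monomials to coefficients with the convolution product.\<close>

type_synonym ('v, 'k) polynomials = "('v \<Rightarrow>\<^sub>0 nat) \<Rightarrow>\<^sub>0 'k"

definition pconst :: "'k::field \<Rightarrow> ('v, 'k) polynomials" where
  "pconst c = Poly_Mapping.single 0 c"

definition pvar :: "'v \<Rightarrow> ('v, 'k::field) polynomials" where
  "pvar i = Poly_Mapping.single (Poly_Mapping.single i 1) 1"

definition linear_form :: "'k::field ^ 'v::finite \<Rightarrow> ('v, 'k) polynomials" where
  "linear_form a = (\<Sum>i\<in>UNIV. pconst (a $ i) * pvar i)"

definition linear_form_kernel :: "'k::field ^ 'v::finite \<Rightarrow> ('k ^ 'v) set" where
  "linear_form_kernel a = {x. (\<Sum>i\<in>UNIV. a $ i * x $ i) = 0}"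

definition is_derivation :: "(('v, 'k::field) polynomials \<Rightarrow> ('v, 'k) polynomials) \<Rightarrow> bool" where
  "is_derivation \<theta> \<longleftrightarrow>
     (\<forall>p q. \<theta> (p + q) = \<theta> p + \<theta> q) \<and>
     (\<forall>c p. \<theta> (pconst c * p) = pconst c * \<theta> p) \<and>
     (\<forall>p q. \<theta> (p * q) = p * \<theta> q + q * \<theta> p)"

text \<open>A hyperplane determines its defining linear form only up to a nonzero scalar, which does
  not affect the divisibility condition; the condition is required of every such form.\<close>

definition log_derivations ::
  "('k::field ^ 'v::finite) set set \<Rightarrow> (('v, 'k) polynomials \<Rightarrow> ('v, 'k) polynomials) set" where
  "log_derivations A =
     {\<theta>. is_derivation \<theta> \<and>
        (\<forall>H\<in>A. \<forall>a. linear_form_kernel a = H \<longrightarrow> linear_form a dvd \<theta> (linear_form a))}"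

definition der_scale ::
  "('v, 'k::field) polynomials \<Rightarrow> (('v, 'k) polynomials \<Rightarrow> ('v, 'k) polynomials)
     \<Rightarrow> (('v, 'k) polynomials \<Rightarrow> ('v, 'k) polynomials)" where
  "der_scale f \<theta> = (\<lambda>p. f * \<theta> p)"

global_interpretation der: module der_scale
  by standard (simp_all add: der_scale_def fun_eq_iff algebra_simps)

lemma subspace_log_derivations: "der.subspace (log_derivations A)"
  by (rule der.subspaceI)
     (auto simp: log_derivations_def is_derivation_def der_scale_def algebra_simps)

definition free_arrangement :: "('k::field ^ 'v::finite) set set \<Rightarrow> bool" where
  "free_arrangement A \<longleftrightarrow> (\<exists>B. der.independent B \<and> der.span B = log_derivations A)"

end

theory Submission
  imports Defs "HOL-Computational_Algebra.Polynomial"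
begin

text \<open>
  Dividing by the loops identifies the logarithmic derivations of \<open>\<A>(G\<^sup>+, G\<^sup>-, V)\<close> with splines, that is,
  families \<open>g\<close> with \<open>x\<^sub>u - x\<^sub>w\<close> dividing \<open>g\<^sub>u - g\<^sub>w\<close> on positive edges and \<open>x\<^sub>u + x\<^sub>w\<close> dividing it on
  negative edges. Call \<open>v\<close> flawless if it is simplicial in \<open>G\<^sup>+\<close> and every end of a negative edge at
  \<open>v\<close> is joined by negative edges to the other neighbours of \<open>v\<close>. Newton interpolation at the nodes
  \<open>x\<^sub>w\<close> and \<open>-x\<^sub>d\<close> extends splines to a flawless vertex, and splines on the two sides of a separating
  clique of negative edges are glued by functions of \<open>x\<^sub>v\<^sup>2\<close>. So it suffices that a balanced chordal
  graph has a flawless vertex or such a separating clique. In the absence of the latter, choose a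
  largest side \<open>A\<close> of a minimal separator through which an odd path joins two vertices that are not
  joined by a negative edge; beyond the separator, among the simplicial vertices adjacent to all of it,
  one with the fewest negative edges is flawless.

  Conversely, let a balanced cycle of length at least four have no balanced chord and choose a point on
  exactly the hyperplanes of its edges. The first- and second-order parts of the
  derivations that are logarithmic near this point give \<open>card V + 1\<close> independent functionals which are
  semilinear with respect to evaluation, whereas a free module of derivations has rank at most
  \<open>card V\<close>.
\<close>

section \<open>Polynomials and substitutions\<close>

text \<open>Obstacles on the free side. Restricting splines to one side of a separator has as kernel
  the splines vanishing on the separator, so freeness must be proved for splines vanishing on a
  clique of negative edges. As negative edges are also positive, such an edge enforces divisibility
  by both \<open>x_u - x_w\<close> and \<open>x_u + x_w\<close>, which functions of
  \<open>x_v^2\<close> always satisfy. Dirac's search for a simplicial vertex does not suffice: a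
  flaw \<open>N b d\<close>, \<open>P b w\<close>, \<open>\<not> N d w\<close> at \<open>b\<close>
  is itself an odd path \<open>d, b, w\<close>. What controls flaws is that two paths in the double
  cover with the same ends, on different sides of a separator, force their ends to be adjacent; so
  an odd path between vertices not negatively joined can exist on one side only. Counting negative
  edges gives the descent, since a flaw at a simplicial \<open>b\<close> makes a simplicial
  \<open>w\<close> have fewer of them. On the other side, the hyperplanes through the chosen point
  are generic: \<open>n\<close> forms whose only linear relation is that their sum vanishes. The
  Koszul syzygies of \<open>n - 1\<close> of them number \<open>(n - 1)(n - 2)/2\<close>, which
  reaches \<open>n - 1\<close> exactly from \<open>n = 4\<close> on.\<close>

lemma pconst_simps:
  "pconst (0::'k::field) = 0" "pconst (1::'k) = 1"
  "pconst (a + b :: 'k) = pconst a + pconst b" "pconst (a * b :: 'k) = pconst a * pconst b"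
  by (simp_all add: pconst_def single_add mult_single)

lemma pconst_minus: "pconst (- a :: 'k::field) = - pconst a"
  by (simp add: pconst_def single_uminus)

lemma pvar_power: "pvar v ^ n = Poly_Mapping.single (Poly_Mapping.single v n) 1"
proof (induction n)
  case (Suc n)
  then show ?case
    by (simp add: pvar_def mult_single flip: single_add)
qed simp

lemma prod_pvar:
  "finite A \<Longrightarrow> (\<Prod>v\<in>A. pvar v ^ n v) = Poly_Mapping.single (\<Sum>v\<in>A. Poly_Mapping.single v (n v)) 1"
  by (induction rule: finite_induct) (simp_all add: pvar_power mult_single)

lemma monomial_expand:
  fixes m :: "'v::finite \<Rightarrow>\<^sub>0 nat"
  shows "(\<Sum>v\<in>UNIV. Poly_Mapping.single v (Poly_Mapping.lookup m v)) = m"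
  by (rule poly_mapping_eqI) (simp add: lookup_sum lookup_single when_def)

lemma single_eq_prod:
  fixes m :: "'v::finite \<Rightarrow>\<^sub>0 nat"
  shows "Poly_Mapping.single m c = pconst c * (\<Prod>v\<in>UNIV. pvar v ^ Poly_Mapping.lookup m v)"
  by (simp add: prod_pvar monomial_expand pconst_def mult_single)

lemma poly_mapping_sum_single:
  "(\<Sum>m\<in>Poly_Mapping.keys p. Poly_Mapping.single m (Poly_Mapping.lookup p m)) = p"
  by (rule poly_mapping_eqI) (auto simp: lookup_sum lookup_single when_def in_keys_iff)

lemma polynomials_induct [case_names const var add mult]:
  fixes p :: "('v::finite, 'k::field) polynomials"
  assumes c: "\<And>c. P (pconst c)" and v: "\<And>v. P (pvar v)"
    and a: "\<And>p q. P p \<Longrightarrow> P q \<Longrightarrow> P (p + q)" and m: "\<And>p q. P p \<Longrightarrow> P q \<Longrightarrow> P (p * q)"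
  shows "P p"
proof -
  have P0: "P 0" and P1: "P 1" using c[of 0] c[of 1] by (simp_all add: pconst_simps)
  have pw: "P (pvar v ^ n)" for v n by (induction n) (use P1 v m in auto)
  have pr: "finite A \<Longrightarrow> P (\<Prod>v\<in>A. pvar v ^ n v)" for n and A :: "'v set"
    by (induction rule: finite_induct) (use P1 pw m in auto)
  have "P (\<Sum>m\<in>A. Poly_Mapping.single m (Poly_Mapping.lookup p m))" if "finite A" for A
    using that by (induction rule: finite_induct) (use P0 c pr m a in \<open>auto simp: single_eq_prod\<close>)
  from this[of "Poly_Mapping.keys p"] show ?thesis by (simp add: poly_mapping_sum_single)
qed

section \<open>Ring homomorphisms and substitution of variables\<close>

locale comm_ring_1_hom =
  fixes h :: "'a::comm_ring_1 \<Rightarrow> 'r::comm_ring_1"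
  assumes hom_1: "h 1 = 1" and hom_add: "h (a + b) = h a + h b" and hom_mult: "h (a * b) = h a * h b"
begin

lemma hom_0: "h 0 = 0"
  using hom_add[of 0 0] by simp

lemma hom_uminus: "h (- a) = - h a"
  using hom_add[of a "- a"] by (simp add: hom_0 eq_neg_iff_add_eq_0 add.commute)

lemma hom_diff: "h (a - b) = h a - h b"
  using hom_add[of a "- b"] by (simp add: hom_uminus)

lemma hom_sum: "h (sum f A) = (\<Sum>x\<in>A. h (f x))"
  by (induction A rule: infinite_finite_induct) (simp_all add: hom_0 hom_add)

lemma hom_prod: "h (prod f A) = (\<Prod>x\<in>A. h (f x))"
  by (induction A rule: infinite_finite_induct) (simp_all add: hom_1 hom_mult)

lemma hom_dvd: "a dvd b \<Longrightarrow> h a dvd h b"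
  by (auto simp: hom_mult)

lemmas homs = hom_0 hom_1 hom_add hom_mult hom_uminus hom_diff hom_sum hom_prod

end

definition psubst ::
  "('k::field \<Rightarrow> 'r::comm_ring_1) \<Rightarrow> ('v::finite \<Rightarrow> 'r) \<Rightarrow> ('v, 'k) polynomials \<Rightarrow> 'r" where
  "psubst \<phi> \<rho> p =
     (\<Sum>m\<in>Poly_Mapping.keys p. \<phi> (Poly_Mapping.lookup p m) * (\<Prod>v\<in>UNIV. \<rho> v ^ Poly_Mapping.lookup m v))"

context
  fixes \<phi> :: "'k::field \<Rightarrow> 'r::comm_ring_1"
  assumes \<phi>: "comm_ring_1_hom \<phi>"
begin

interpretation \<phi>: comm_ring_1_hom \<phi> by (rule \<phi>)

lemma psubst_superset:
  assumes "finite A" "Poly_Mapping.keys p \<subseteq> A"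
  shows "psubst \<phi> \<rho> p =
    (\<Sum>m\<in>A. \<phi> (Poly_Mapping.lookup p m) * (\<Prod>v\<in>UNIV. \<rho> v ^ Poly_Mapping.lookup m v))"
  unfolding psubst_def
  by (rule sum.mono_neutral_left) (use assms in \<open>auto simp: in_keys_iff \<phi>.hom_0\<close>)

lemma psubst_add: "psubst \<phi> \<rho> (p + q) = psubst \<phi> \<rho> p + psubst \<phi> \<rho> q"
proof -
  let ?A = "Poly_Mapping.keys p \<union> Poly_Mapping.keys q"
  have *: "Poly_Mapping.keys (p + q) \<subseteq> ?A" by (rule keys_add)
  show ?thesis
    by (simp add: psubst_superset[of ?A] * lookup_add \<phi>.hom_add algebra_simps sum.distrib)
qed

lemma psubst_0: "psubst \<phi> \<rho> 0 = 0"
  by (simp add: psubst_def)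

lemma psubst_sum: "psubst \<phi> \<rho> (sum f A) = (\<Sum>x\<in>A. psubst \<phi> \<rho> (f x))"
  by (induction A rule: infinite_finite_induct) (simp_all add: psubst_0 psubst_add)

lemma psubst_single:
  "psubst \<phi> \<rho> (Poly_Mapping.single m c) = \<phi> c * (\<Prod>v\<in>UNIV. \<rho> v ^ Poly_Mapping.lookup m v)"
  by (subst psubst_superset[of "{m}"]) auto

lemma psubst_single_mult:
  "psubst \<phi> \<rho> (Poly_Mapping.single m c * Poly_Mapping.single m' c') =
   psubst \<phi> \<rho> (Poly_Mapping.single m c) * psubst \<phi> \<rho> (Poly_Mapping.single m' c')"
  by (simp add: mult_single psubst_single \<phi>.hom_mult lookup_add power_add prod.distrib)

lemma psubst_mult: "psubst \<phi> \<rho> (p * q) = psubst \<phi> \<rho> p * psubst \<phi> \<rho> q"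
proof -
  let ?s = "\<lambda>p m. Poly_Mapping.single m (Poly_Mapping.lookup p m)"
  have "psubst \<phi> \<rho> (p * q) = psubst \<phi> \<rho> ((\<Sum>m\<in>Poly_Mapping.keys p. ?s p m) * (\<Sum>m\<in>Poly_Mapping.keys q. ?s q m))"
    by (simp add: poly_mapping_sum_single)
  also have "\<dots> = psubst \<phi> \<rho> (\<Sum>m\<in>Poly_Mapping.keys p. ?s p m) * psubst \<phi> \<rho> (\<Sum>m\<in>Poly_Mapping.keys q. ?s q m)"
    by (simp add: sum_product psubst_sum psubst_single_mult)
  finally show ?thesis by (simp add: poly_mapping_sum_single)
qed

lemma psubst_pconst: "psubst \<phi> \<rho> (pconst c) = \<phi> c"
  by (simp add: pconst_def psubst_single)

lemma psubst_pvar: "psubst \<phi> \<rho> (pvar v) = \<rho> v"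
proof -
  have "psubst \<phi> \<rho> (pvar v) = (\<Prod>w\<in>UNIV. \<rho> w ^ (if w = v then Suc 0 else 0))"
    unfolding pvar_def psubst_single by (simp add: \<phi>.hom_1 lookup_single when_def eq_commute[of v])
  also have "\<dots> = (\<Prod>w\<in>UNIV. if w = v then \<rho> w else 1)"
    by (rule prod.cong) auto
  finally show ?thesis by simp
qed

lemma psubst_hom: "comm_ring_1_hom (psubst \<phi> \<rho>)"
  using psubst_pconst[of \<rho> 1]
  by unfold_locales (simp_all add: psubst_add psubst_mult pconst_simps \<phi>.hom_1)

end

lemma comm_ring_1_hom_pconst: "comm_ring_1_hom pconst"
  by unfold_locales (simp_all add: pconst_simps)

lemma comm_ring_1_hom_id: "comm_ring_1_hom (\<lambda>x. x)"
  by unfold_locales simp_all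

text \<open>The library has the integral domain instance only for linearly ordered monomials;
  an enumeration of the indeterminates embeds the ring into such an instance.\<close>

lemma polynomials_no_zero_divisors:
  fixes p q :: "('v::finite, 'k::field) polynomials"
  assumes "p * q = 0"
  shows "p = 0 \<or> q = 0"
proof -
  obtain e :: "'v \<Rightarrow> nat" where e: "inj e"
    using finite_imp_inj_to_nat_seg[of "UNIV :: 'v set"] by auto
  let ?c = "\<lambda>c::'k. Poly_Mapping.single (0 :: nat \<Rightarrow>\<^sub>0 nat) c"
  have c: "comm_ring_1_hom ?c"
    by unfold_locales (simp_all add: single_add mult_single)
  define E where "E p = (\<Sum>m\<in>Poly_Mapping.keys p. Poly_Mapping.single
    (\<Sum>v\<in>UNIV. Poly_Mapping.single (e v) (Poly_Mapping.lookup m v)) (Poly_Mapping.lookup p m))"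
    for p :: "('v, 'k) polynomials"
  let ?r = "\<lambda>v. Poly_Mapping.single (Poly_Mapping.single (e v) (1::nat)) (1::'k)"
  have pw: "?r v ^ n = Poly_Mapping.single (Poly_Mapping.single (e v) n) 1" for v n
    by (induction n) (simp_all add: mult_single flip: single_add)
  have pr: "finite A \<Longrightarrow> (\<Prod>v\<in>A. ?r v ^ n v) = Poly_Mapping.single (\<Sum>v\<in>A. Poly_Mapping.single (e v) (n v)) 1" for A n
    by (induction rule: finite_induct) (simp_all add: pw[unfolded One_nat_def] mult_single del: power_Suc)
  have E: "E p = psubst ?c ?r p" for p
    unfolding E_def psubst_def by (simp add: pr[unfolded One_nat_def] mult_single)
  have inj: "p = 0" if "E p = 0" for p
  proof (rule ccontr)
    assume "p \<noteq> 0"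
    then obtain m where m: "m \<in> Poly_Mapping.keys p" by fastforce
    \<comment> \<open>The exponent map \<open>?g\<close> is injective, so no two terms of
      \<open>E p\<close> can cancel.\<close>
    let ?g = "\<lambda>m. \<Sum>v\<in>UNIV. Poly_Mapping.single (e v) (Poly_Mapping.lookup m v)"
    have lg: "Poly_Mapping.lookup (?g m) (e v) = Poly_Mapping.lookup m v" for m v
      by (simp add: lookup_sum lookup_single when_def inj_eq[OF e])
    have "?g m' = ?g m \<Longrightarrow> m' = m" for m'
      by (rule poly_mapping_eqI) (metis lg)
    then have "Poly_Mapping.lookup (E p) (?g m) = (\<Sum>m'\<in>Poly_Mapping.keys p. if m' = m then Poly_Mapping.lookup p m' else 0)"
      unfolding E_def lookup_sum by (intro sum.cong) (auto simp: lookup_single when_def)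
    with m that show False by (simp add: in_keys_iff)
  qed
  interpret E: comm_ring_1_hom E
    using psubst_hom[OF c, of ?r] E by presburger
  have "E p * E q = 0" using assms by (metis E.hom_mult E.hom_0)
  then show ?thesis using inj by auto
qed

lemma polynomials_mult_cancel:
  fixes p q r :: "('v::finite, 'k::field) polynomials"
  assumes "p * q = p * r" "p \<noteq> 0"
  shows "q = r"
  using polynomials_no_zero_divisors[of p "q - r"] assms by (simp add: algebra_simps)

section \<open>Signed variables and divisibility by linear forms\<close>

lemma pvar_inject [simp]: "pvar v = (pvar w :: (_, 'k::field) polynomials) \<longleftrightarrow> v = w"
proof
  assume "pvar v = (pvar w :: (_, 'k) polynomials)"
  then have "Poly_Mapping.lookup (pvar v :: (_, 'k) polynomials) (Poly_Mapping.single v 1) = Poly_Mapping.lookup (pvar w :: (_, 'k) polynomials) (Poly_Mapping.single v 1)"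
    by simp
  then have "Poly_Mapping.single w (1::nat) = Poly_Mapping.single v 1"
    by (simp add: pvar_def lookup_single when_def split: if_splits)
  then have "Poly_Mapping.lookup (Poly_Mapping.single w (1::nat)) v = 1" by simp
  then show "v = w" by (simp add: lookup_single when_def split: if_splits)
qed simp

text \<open>Substituting \<open>r\<close> for the variable \<open>a\<close> realizes reduction
  modulo \<open>pvar a - r\<close> inside the ring itself: divisibility by this form becomes an
  equation, to which the absence of zero divisors applies.\<close>

definition repl :: "'v \<Rightarrow> ('v, 'k) polynomials \<Rightarrow> ('v::finite, 'k::field) polynomials \<Rightarrow> ('v, 'k) polynomials" where
  "repl a r = psubst pconst (pvar(a := r))"

lemma repl_hom: "comm_ring_1_hom (repl a r)"
  unfolding repl_def by (rule psubst_hom) (rule comm_ring_1_hom_pconst)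

lemma repl_simps:
  "repl a r (pconst c) = pconst c" "repl a r (pvar v) = (if v = a then r else pvar v)"
  by (simp_all add: repl_def psubst_pconst psubst_pvar comm_ring_1_hom_pconst)

lemma dvd_diff_repl: "pvar a - r dvd f - repl a r f"
proof -
  interpret comm_ring_1_hom "repl a r" by (rule repl_hom)
  show ?thesis
  proof (induction f rule: polynomials_induct)
    case (add p q)
    have *: "p + q - repl a r (p + q) = (p - repl a r p) + (q - repl a r q)"
      by (simp only: hom_add) (simp add: algebra_simps)
    then show ?case using dvd_add[OF add] by (simp only: *)
  next
    case (mult p q)
    have "p * q - repl a r (p * q) = p * (q - repl a r q) + (p - repl a r p) * repl a r q"
      by (simp add: homs algebra_simps)
    then show ?case using mult by (simp add: dvd_add)
  qed (simp_all add: repl_simps)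
qed

lemma dvd_iff_repl:
  assumes "repl a r r = r"
  shows "pvar a - r dvd f \<longleftrightarrow> repl a r f = 0"
proof
  interpret comm_ring_1_hom "repl a r" by (rule repl_hom)
  assume "pvar a - r dvd f"
  then have "repl a r (pvar a - r) dvd repl a r f" by (rule hom_dvd)
  then show "repl a r f = 0" by (simp add: homs repl_simps assms)
next
  show "repl a r f = 0 \<Longrightarrow> pvar a - r dvd f" using dvd_diff_repl[of a r f] by simp
qed

text \<open>The variable attached to a vertex of the double cover. The sheet is the sign, so the
  forms of positive and of negative edges are both differences \<open>sv x - sv y\<close> up to
  sign.\<close>

definition sv :: "'v \<times> bool \<Rightarrow> ('v, 'k::field) polynomials" where
  "sv = (\<lambda>(v, s). if s then - pvar v else pvar v)"

lemma sv_simps [simp]: "sv (v, False) = pvar v" "sv (v, True) = - pvar v"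
  by (simp_all add: sv_def)

lemma repl_sv: "fst x \<noteq> a \<Longrightarrow> repl a r (sv x) = sv x"
  by (cases x) (auto simp: sv_def repl_simps comm_ring_1_hom.homs[OF repl_hom])

lemma pvar_nonzero [simp]: "pvar v \<noteq> (0 :: ('v, 'k::field) polynomials)"
  by (simp add: pvar_def) (metis lookup_single_eq lookup_zero one_neq_zero)

lemma pvar_neq_minus:
  "pvar v \<noteq> - (pvar w :: ('v::finite, 'k::field_char_0) polynomials)"
proof
  assume *: "pvar v = - (pvar w :: ('v, 'k) polynomials)"
  let ?h = "psubst (\<lambda>x. x) (\<lambda>_. 1) :: ('v, 'k) polynomials \<Rightarrow> 'k"
  interpret comm_ring_1_hom ?h by (rule psubst_hom) (rule comm_ring_1_hom_id)
  have "?h (pvar v) = ?h (- pvar w)" using * by simp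
  then have "(1::'k) = - 1" by (simp add: homs psubst_pvar comm_ring_1_hom_id)
  then show False by simp
qed

lemma sv_eq_iff [simp]:
  "sv x = (sv y :: ('v::finite, 'k::field_char_0) polynomials) \<longleftrightarrow> x = y"
  using pvar_neq_minus pvar_neq_minus[symmetric]
  by (cases x; cases y) (auto simp: sv_def)

lemma sv_nonzero [simp]: "sv x \<noteq> (0 :: ('v, 'k::field) polynomials)"
  by (cases x) (auto simp: sv_def)

lemma sv_flip: "sv (v, \<not> s) = - sv (v, s)"
  by (cases s) simp_all

text \<open>Serves the case of two lifts of one vertex, where \<open>sv x - sv y = 2 * sv x\<close>;
  in characteristic zero the 2 is a unit.\<close>

lemma dvd_two_mult_iff:
  "2 * d dvd f \<longleftrightarrow> d dvd (f :: ('v::finite, 'k::field_char_0) polynomials)"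
proof
  assume "d dvd f"
  then obtain k where k: "f = d * k" by (elim dvdE)
  have *: "2 * pconst (1/2 :: 'k) = (1 :: ('v, 'k) polynomials)"
  proof -
    have "2 * pconst (1/2 :: 'k) = (pconst (1/2 + 1/2) :: ('v, 'k) polynomials)"
      unfolding mult_2 by (rule pconst_simps(3)[symmetric])
    then show ?thesis by (simp add: pconst_simps(2))
  qed
  have "2 * d * (pconst (1/2) * k) = (2 * pconst (1/2)) * (d * k)" by (simp only: ac_simps)
  also have "\<dots> = f" by (simp add: * k)
  finally have "f = 2 * d * (pconst (1/2) * k)" ..
  then show "2 * d dvd f" by (rule dvdI)
qed (metis dvd_mult_right)

text \<open>Reduction modulo \<open>sv x - sv y\<close> lands in a domain, and
  \<open>sv x - sv z\<close> does not reduce to 0 because \<open>y\<close> and \<open>z\<close>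
  differ; hence it can be cancelled.\<close>

lemma sv_diff_coprime:
  fixes h :: "('v::finite, 'k::field_char_0) polynomials"
  assumes "sv x - sv y dvd (sv x - sv z) * h" "x \<noteq> y" "x \<noteq> z" "y \<noteq> z"
  shows "sv x - sv y dvd h"
proof -
  obtain a s where x: "x = (a, s)" by (cases x)
  \<comment> \<open>The value of the variable \<open>a\<close> that solves
    \<open>sv x = sv y\<close>; if \<open>y\<close> is the other lift of \<open>a\<close>, the
    equation says that the variable is 0.\<close>
  define r :: "('v, 'k) polynomials" where "r = (if fst y = a then 0 else if s then - sv y else sv y)"
  interpret comm_ring_1_hom "repl a r" by (rule repl_hom)
  have r: "repl a r r = r"
    by (simp add: r_def comm_ring_1_hom.homs[OF repl_hom] repl_sv)
  have dv: "sv x - sv y dvd f \<longleftrightarrow> pvar a - r dvd f" for f :: "('v, 'k) polynomials"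
  proof (cases "fst y = a")
    case True
    then have y: "y = (a, \<not> s)" using assms(2) x by (cases y) auto
    have "sv x - sv y = 2 * (sv x :: ('v, 'k) polynomials)" by (simp add: x y sv_flip)
    then have "sv x - sv y dvd f \<longleftrightarrow> sv x dvd f" by (simp only: dvd_two_mult_iff)
    then show ?thesis by (simp add: x sv_def r_def True)
  next
    case False
    then have "sv x - sv y = (if s then - (pvar a - r) else pvar a - r)"
      by (simp add: x r_def)
    then show ?thesis by (metis minus_dvd_iff)
  qed
  have rx: "repl a r (sv x) = (if s then - r else r)" by (simp add: x sv_def homs repl_simps)
  have "repl a r ((sv x - sv z) * h) = 0" using assms(1) dv dvd_iff_repl[OF r] by blast
  then have *: "(repl a r (sv x) - repl a r (sv z)) * repl a r h = 0" by (simp add: homs)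
  have "repl a r (sv x) - repl a r (sv z) \<noteq> 0"
  proof (cases "fst z = a")
    case True
    then have z: "z = (a, \<not> s)" using assms(3) x by (cases z) auto
    then have ya: "fst y \<noteq> a" using assms(2,4) x by (cases y) auto
    have "repl a r (sv z) = - repl a r (sv x)" by (simp add: z x sv_flip homs)
    moreover have "repl a r (sv x) = sv y" unfolding rx using ya by (simp add: r_def)
    moreover have "2 * sv y \<noteq> (0 :: ('v, 'k) polynomials)"
      using polynomials_no_zero_divisors[of 2 "sv y :: ('v, 'k) polynomials"] by auto
    ultimately show ?thesis by simp
  next
    case False
    then have "repl a r (sv z) = sv z" by (simp add: repl_sv)
    moreover have "repl a r (sv x) = sv y \<or> repl a r (sv x) = 0" unfolding rx by (simp add: r_def)
    ultimately show ?thesis using assms(4) by (elim disjE) simp_all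
  qed
  with * have "repl a r h = 0" using polynomials_no_zero_divisors by blast
  then show ?thesis using dv dvd_iff_repl[OF r] by blast
qed

section \<open>Signed graphs and their double cover\<close>

locale signed_graph =
  fixes P N :: "'v::finite \<Rightarrow> 'v \<Rightarrow> bool"
  assumes P_sym: "P u v \<Longrightarrow> P v u" and P_irrefl: "\<not> P v v"
    and N_sym: "N u v \<Longrightarrow> N v u" and N_P: "N u v \<Longrightarrow> P u v"
begin

text \<open>The double cover of the signed graph: balanced cycles lift to the cycles of \<open>G\<close> whose vertices
  have pairwise distinct first components.\<close>

definition G :: "'v \<times> bool \<Rightarrow> 'v \<times> bool \<Rightarrow> bool" where
  "G x y \<longleftrightarrow> (if snd x = snd y then P (fst x) (fst y) else N (fst x) (fst y))"

definition Nclique :: "'v set \<Rightarrow> bool" where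
  "Nclique X \<longleftrightarrow> (\<forall>x\<in>X. \<forall>y\<in>X. x \<noteq> y \<longrightarrow> N x y)"

definition simplicial :: "'v set \<Rightarrow> 'v \<Rightarrow> bool" where
  "simplicial W v \<longleftrightarrow> (\<forall>x\<in>W. \<forall>y\<in>W. x \<noteq> y \<longrightarrow> P v x \<longrightarrow> P v y \<longrightarrow> P x y)"

text \<open>Equivalently, neighbours of \<open>(v, False)\<close> over different vertices of
  \<open>W\<close> are pairwise adjacent in the double cover, which is the compatibility needed for
  interpolation at \<open>v\<close>.\<close>

definition flawless :: "'v set \<Rightarrow> 'v \<Rightarrow> bool" where
  "flawless W v \<longleftrightarrow> v \<in> W \<and> simplicial W v \<and>
     (\<forall>x\<in>W. \<forall>y\<in>W. x \<noteq> y \<longrightarrow> N v x \<longrightarrow> P v y \<longrightarrow> N x y)"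

definition nbr :: "'v set \<Rightarrow> 'v set \<Rightarrow> 'v set" where
  "nbr W C = {s \<in> W - C. \<exists>c\<in>C. P c s}"

lemma G_sym: "G x y \<Longrightarrow> G y x"
  by (auto simp: G_def P_sym N_sym split: if_splits)

lemma G_P: "G x y \<Longrightarrow> P (fst x) (fst y)"
  by (auto simp: G_def N_P split: if_splits)

lemma G_simps [simp]:
  "G (u, a) (v, a) \<longleftrightarrow> P u v" "G (u, True) (v, False) \<longleftrightarrow> N u v" "G (u, False) (v, True) \<longleftrightarrow> N u v"
  by (simp_all add: G_def)

lemma P_neq: "P u v \<Longrightarrow> u \<noteq> v"
  using P_irrefl by auto

end

section \<open>Freeness of spline modules\<close>

definition (in module) is_free :: "'b set \<Rightarrow> bool" where
  "is_free M \<longleftrightarrow> (\<exists>B. independent B \<and> span B = M)"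

lemma (in module) is_free_0: "is_free {0}"
  unfolding is_free_def by (intro exI[of _ "{}"] conjI independent_empty span_empty)

lemma (in module_hom) is_free_image:
  assumes "m1.is_free M" "inj_on f M"
  shows "m2.is_free (f ` M)"
proof -
  obtain B where B: "m1.independent B" "m1.span B = M" using assms(1) by (auto simp: m1.is_free_def)
  with assms(2) have "m2.independent (f ` B)" "m2.span (f ` B) = f ` M"
    by (simp_all add: independent_injective_image span_image)
  then show ?thesis unfolding m2.is_free_def by blast
qed

text \<open>Preimages of a basis of the image split the map, so together with a basis of the kernel
  they form a basis of \<open>M\<close>.\<close>

lemma (in module_hom) is_free_extension:
  assumes M: "m1.subspace M"
    and im: "m2.is_free (f ` M)" and ker: "m1.is_free {x \<in> M. f x = 0}"
  shows "m1.is_free M"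
proof -
  obtain B2 where B2: "m2.independent B2" "m2.span B2 = f ` M"
    using im by (auto simp: m2.is_free_def)
  obtain B1 where B1: "m1.independent B1" "m1.span B1 = {x \<in> M. f x = 0}"
    using ker by (auto simp: m1.is_free_def)
  have "\<forall>b\<in>B2. \<exists>x\<in>M. f x = b"
  proof
    fix b assume "b \<in> B2"
    then have "b \<in> f ` M" using m2.span_base[of b B2] B2(2) by simp
    then show "\<exists>x\<in>M. f x = b" by auto
  qed
  then obtain l where l: "\<And>b. b \<in> B2 \<Longrightarrow> l b \<in> M" "\<And>b. b \<in> B2 \<Longrightarrow> f (l b) = b" by metis
  let ?B = "l ` B2 \<union> B1"
  have fB1: "f b = 0" if "b \<in> B1" for b using m1.span_base[OF that] B1(2) by simp
  have B0: "0 \<notin> B2" using B2(1) m2.dependent_zero by blast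
  have disj: "l ` B2 \<inter> B1 = {}" using fB1 l(2) B0 by force
  have "m1.independent ?B"
    unfolding m1.independent_explicit_module
  proof (intro allI impI)
    fix t u v assume t: "finite t" "t \<subseteq> ?B" and sum0: "(\<Sum>v\<in>t. s1 (u v) v) = 0" and v: "v \<in> t"
    define t2 where "t2 = {b \<in> B2. l b \<in> t}"
    define t1 where "t1 = t \<inter> B1"
    have inj: "inj_on l B2" by (metis inj_onI l(2))
    have t_eq: "t = l ` t2 \<union> t1" "l ` t2 \<inter> t1 = {}" "t2 \<subseteq> B2"
      using t(2) disj by (auto simp: t2_def t1_def)
    have fin: "finite t2" "finite t1"
      using t(1) t_eq(1,3) inj by (metis finite_Un finite_imageD inj_on_subset)+
    have "f (\<Sum>v\<in>t. s1 (u v) v) = (\<Sum>v\<in>t. s2 (u v) (f v))" by (simp add: sum scale)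
    also have "\<dots> = (\<Sum>v\<in>l ` t2. s2 (u v) (f v)) + (\<Sum>v\<in>t1. s2 (u v) (f v))"
      unfolding t_eq(1) using fin t_eq(2) by (intro sum.union_disjoint) auto
    also have "(\<Sum>v\<in>t1. s2 (u v) (f v)) = 0"
      by (intro sum.neutral) (auto simp: t1_def fB1)
    also have "(\<Sum>v\<in>l ` t2. s2 (u v) (f v)) = (\<Sum>b\<in>t2. s2 (u (l b)) b)"
      using inj t_eq(3) by (subst sum.reindex) (auto simp: inj_on_subset l(2) intro!: sum.cong)
    finally have "(\<Sum>b\<in>t2. s2 (u (l b)) b) = 0" using sum0 by simp
    then have u2: "u (l b) = 0" if "b \<in> t2" for b
      using m2.independentD[OF B2(1) fin(1) t_eq(3), of "\<lambda>b. u (l b)"] that by blast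
    have "(\<Sum>v\<in>t1. s1 (u v) v) = (\<Sum>v\<in>t. s1 (u v) v)"
      using t(1) t_eq(1) u2 by (intro sum.mono_neutral_left) auto
    then have "u b = 0" if "b \<in> t1" for b
      using m1.independentD[OF B1(1) fin(2), of u b] that sum0 by (simp add: t1_def)
    with u2 v t_eq(1) show "u v = 0" by blast
  qed
  moreover have "m1.span ?B = M"
  proof
    have "?B \<subseteq> M" using l(1) B1(2) m1.span_superset[of B1] by auto
    then show "m1.span ?B \<subseteq> M" using M by (rule m1.span_minimal)
    show "M \<subseteq> m1.span ?B"
    proof
      fix x assume x: "x \<in> M"
      have "f ` l ` B2 = B2" using l(2) by force
      then have "f x \<in> f ` m1.span (l ` B2)"
        using x B2(2) span_image[of "l ` B2"] by auto
      then obtain y where y: "y \<in> m1.span (l ` B2)" "f y = f x" by auto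
      have "y \<in> M" using y(1) M l(1) m1.span_minimal[of "l ` B2" M] by auto
      then have "x - y \<in> m1.span B1" using B1(2) x y(2) M by (simp add: diff m1.subspace_diff)
      then have "y + (x - y) \<in> m1.span ?B"
        using y(1) m1.span_mono[of "l ` B2" ?B] m1.span_mono[of B1 ?B] by (intro m1.span_add) auto
      then show "x \<in> m1.span ?B" by simp
    qed
  qed
  ultimately show ?thesis unfolding m1.is_free_def by blast
qed

section \<open>Interpolation at signed variables\<close>

definition vscale :: "'a::comm_ring_1 \<Rightarrow> ('v \<Rightarrow> 'a) \<Rightarrow> 'v \<Rightarrow> 'a" where
  "vscale f g = (\<lambda>v. f * g v)"

global_interpretation vm: module vscale
  by standard (simp_all add: vscale_def fun_eq_iff algebra_simps)

text \<open>Newton's scheme: after removing a node \<open>c\<close>, the divided differences satisfy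
  the same pairwise congruences, because \<open>sv a - sv b\<close> is coprime to
  \<open>sv a - sv c\<close>. The coefficients of \<open>F\<close> lie in the polynomial ring
  itself.\<close>

lemma newton_interpolation:
  fixes y :: "'v \<times> bool \<Rightarrow> ('v::finite, 'k::field_char_0) polynomials"
  assumes "finite I" and "\<And>a b. a \<in> I \<Longrightarrow> b \<in> I \<Longrightarrow> a \<noteq> b \<Longrightarrow> sv a - sv b dvd y a - y b"
  shows "\<exists>F. \<forall>a\<in>I. poly F (sv a) = y a"
  using assms
proof (induction I arbitrary: y rule: finite_induct)
  case (insert c I)
  have "\<forall>a\<in>I. \<exists>g. y a - y c = (sv a - sv c) * g"
    using insert.prems insert.hyps by (metis dvdE insert_iff)
  then obtain g where g: "\<And>a. a \<in> I \<Longrightarrow> y a - y c = (sv a - sv c) * g a" by metis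
  have "sv a - sv b dvd g a - g b" if ab: "a \<in> I" "b \<in> I" "a \<noteq> b" for a b
  proof -
    have "(sv a - sv c) * (g a - g b) = (y a - y b) - (sv a - sv b) * g b"
    proof -
      have "(sv a - sv c) * (g a - g b) = (sv a - sv c) * g a - (sv b - sv c) * g b - (sv a - sv b) * g b"
        by (simp add: algebra_simps)
      then show ?thesis by (simp flip: g[OF ab(1)] g[OF ab(2)])
    qed
    moreover have "sv a - sv b dvd y a - y b" using insert.prems ab by auto
    ultimately have "sv a - sv b dvd (sv a - sv c) * (g a - g b)" by simp
    then show ?thesis by (rule sv_diff_coprime) (use ab insert.hyps in auto)
  qed
  from insert.IH[of g, OF this] obtain F where F: "\<And>a. a \<in> I \<Longrightarrow> poly F (sv a) = g a" by auto
  have "poly ([:y c:] + [:- sv c, 1:] * F) (sv a) = y a" if "a \<in> insert c I" for a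
    using that g[of a] F[of a] by (auto simp: algebra_simps)
  then show ?case by blast
qed simp

lemma poly_diff_dvd: "(a :: 'a::comm_ring_1) - b dvd poly F a - poly F b"
proof (induction F)
  case (pCons c F)
  have "poly (pCons c F) a - poly (pCons c F) b = a * (poly F a - poly F b) + (a - b) * poly F b"
    by (simp add: algebra_simps)
  then show ?case using pCons.IH by simp
qed simp

lemma prod_diff_dvd:
  fixes d :: "'a::comm_ring_1"
  assumes "\<And>i. i \<in> I \<Longrightarrow> d dvd f i - g i"
  shows "d dvd prod f I - prod g I"
  using assms
proof (induction I rule: infinite_finite_induct)
  case (insert i I)
  have "prod f (insert i I) - prod g (insert i I) =
      f i * (prod f I - prod g I) + (f i - g i) * prod g I"
    using insert.hyps by (simp add: algebra_simps)
  then show ?case using insert by simp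
qed simp_all

lemma sv_dvd_cancel_prod:
  fixes h :: "('v::finite, 'k::field_char_0) polynomials"
  assumes "finite I" "sv x - sv y dvd (\<Prod>z\<in>I. sv x - sv z) * h" "x \<noteq> y" "x \<notin> I" "y \<notin> I"
  shows "sv x - sv y dvd h"
  using assms
proof (induction I rule: finite_induct)
  case (insert z I)
  then have "sv x - sv y dvd (sv x - sv z) * ((\<Prod>z\<in>I. sv x - sv z) * h)"
    by (simp add: mult.assoc)
  then show ?case using insert sv_diff_coprime[of x y z] by auto
qed simp

lemma sv_prod_dvd:
  fixes f :: "('v::finite, 'k::field_char_0) polynomials"
  assumes "finite I" "x \<notin> I" "\<And>y. y \<in> I \<Longrightarrow> sv x - sv y dvd f"
  shows "(\<Prod>y\<in>I. sv x - sv y) dvd f"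
  using assms
proof (induction I rule: finite_induct)
  case (insert y I)
  then obtain h where h: "f = (\<Prod>z\<in>I. sv x - sv z) * h" by (auto elim!: dvdE)
  have "sv x - sv y dvd h"
  proof (rule sv_dvd_cancel_prod[of I])
    show "sv x - sv y dvd (\<Prod>z\<in>I. sv x - sv z) * h" using insert.prems unfolding h by simp
  qed (use insert in auto)
  then have "(sv x - sv y) * (\<Prod>z\<in>I. sv x - sv z) dvd h * (\<Prod>z\<in>I. sv x - sv z)"
    by (rule mult_dvd_mono) simp
  then show ?case using insert.hyps unfolding h by (simp add: mult.commute)
qed simp

lemma prod_sv_nonzero:
  assumes "finite I" "x \<notin> I"
  shows "(\<Prod>y\<in>I. sv x - sv y) \<noteq> (0 :: ('v::finite, 'k::field_char_0) polynomials)"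
  using assms
proof (induction I rule: finite_induct)
  case (insert y I)
  then show ?case
    using polynomials_no_zero_divisors[of "sv x - sv y :: ('v, 'k) polynomials" "\<Prod>y\<in>I. sv x - sv y"] by auto
qed simp

section \<open>Splines on a signed graph\<close>

context signed_graph
begin

text \<open>If every vertex carries a loop, a logarithmic derivation \<open>\<theta>\<close> corresponds to
  \<open>g\<^sub>v = \<theta>(x\<^sub>v) / x\<^sub>v\<close>. Requiring \<open>g\<close> to vanish on \<open>X\<close> makes the inductive proof of freeness work.\<close>

definition splines :: "'v set \<Rightarrow> 'v set \<Rightarrow> ('v \<Rightarrow> ('v, 'k::field_char_0) polynomials) set" where
  "splines W X = {g. (\<forall>v. v \<notin> W \<or> v \<in> X \<longrightarrow> g v = 0) \<and>
     (\<forall>x y. fst x \<in> W \<longrightarrow> fst y \<in> W \<longrightarrow> G x y \<longrightarrow> sv x - sv y dvd g (fst x) - g (fst y))}"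

lemma splinesD:
  assumes "g \<in> splines W X"
  shows "v \<notin> W \<Longrightarrow> g v = 0" "v \<in> X \<Longrightarrow> g v = 0"
    "fst x \<in> W \<Longrightarrow> fst y \<in> W \<Longrightarrow> G x y \<Longrightarrow> sv x - sv y dvd g (fst x) - g (fst y)"
  using assms unfolding splines_def by blast+

lemma subspace_splines:
  "vm.subspace (splines W X :: ('v \<Rightarrow> ('v, 'k::field_char_0) polynomials) set)"
proof (rule vm.subspaceI)
  fix f g :: "'v \<Rightarrow> ('v, 'k::field_char_0) polynomials"
  assume "f \<in> splines W X" "g \<in> splines W X"
  then show "f + g \<in> splines W X"
    by (auto simp: splines_def add_diff_add intro!: dvd_add)
next
  fix c and f :: "'v \<Rightarrow> ('v, 'k::field_char_0) polynomials"
  assume "f \<in> splines W X"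
  then show "vscale c f \<in> splines W X"
    by (auto simp: splines_def vscale_def right_diff_distrib[symmetric] intro!: dvd_mult)
qed (auto simp: splines_def)

text \<open>Changing the sheet of both ends only negates \<open>sv x - sv y\<close>, so edges
  starting on the sheet \<open>False\<close> suffice.\<close>

lemma splinesI:
  assumes "\<And>v. v \<notin> W \<Longrightarrow> g v = 0" "\<And>v. v \<in> X \<Longrightarrow> g v = 0"
    and "\<And>u w b. u \<in> W \<Longrightarrow> w \<in> W \<Longrightarrow> G (u, False) (w, b) \<Longrightarrow> pvar u - sv (w, b) dvd g u - g w"
  shows "g \<in> splines W X"
proof -
  have "sv x - sv y dvd g (fst x) - g (fst y)" if xy: "fst x \<in> W" "fst y \<in> W" "G x y" for x y
  proof -
    obtain u a w b where [simp]: "x = (u, a)" "y = (w, b)" by (cases x; cases y)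
    show ?thesis
    proof (cases a)
      case True
      then have "G (u, False) (w, \<not> b)" using xy(3) by (cases b) auto
      then have "pvar u - sv (w, \<not> b) dvd g u - g w" using xy assms(3) by auto
      moreover have *: "sv x - sv y = - (pvar u - sv (w, \<not> b))" using True by (cases b) simp_all
      ultimately show ?thesis unfolding * minus_dvd_iff by simp
    next
      case False
      then show ?thesis using xy assms(3) by auto
    qed
  qed
  then show ?thesis using assms(1,2) by (auto simp: splines_def)
qed

lemma pvar_sv_commute: "pvar v - sv (u, b) dvd f \<longleftrightarrow> pvar u - sv (v, b) dvd f"
proof (cases b)
  case False
  have "- (pvar u - pvar v) dvd f \<longleftrightarrow> pvar u - pvar v dvd f" by (rule minus_dvd_iff)
  with False show ?thesis unfolding minus_diff_eq by simp
qed (simp add: add.commute)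

lemma splines_mono: "g \<in> splines W X \<Longrightarrow> X' \<subseteq> X \<Longrightarrow> g \<in> splines W X'"
  by (auto simp: splines_def)

lemma splines_restrict:
  assumes "g \<in> splines W X" "W' \<subseteq> W"
  shows "(\<lambda>w. if w \<in> W' then g w else 0) \<in> splines W' (X \<inter> W')"
  using splinesD[OF assms(1)] assms(2) unfolding splines_def by (auto simp: subset_iff)

text \<open>Forgetting the value at \<open>v\<close> is onto the splines on \<open>W - {v}\<close>
  by interpolation, and its kernel is the free module generated by the single spline
  \<open>e\<close>.\<close>

lemma free_splines_flawless:
  assumes v: "flawless W v" "v \<notin> X"
    and free: "vm.is_free (splines (W - {v}) X :: ('v \<Rightarrow> ('v, 'k::field_char_0) polynomials) set)"
  shows "vm.is_free (splines W X :: ('v \<Rightarrow> ('v, 'k) polynomials) set)"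
proof -
  let ?M = "splines W X :: ('v \<Rightarrow> ('v, 'k) polynomials) set"
  define \<phi> where "\<phi> g = g(v := 0)" for g :: "'v \<Rightarrow> ('v, 'k) polynomials"
  interpret module_hom vscale vscale \<phi>
    by standard (auto simp: \<phi>_def vscale_def)
  \<comment> \<open>One entry per signed edge at \<open>v\<close>: a negative edge, with its
    positive companion, contributes both lifts of its other end.\<close>
  define R where "R = {y. fst y \<in> W \<and> G (v, False) y}"
  define e :: "'v \<Rightarrow> ('v, 'k) polynomials" where "e = (\<lambda>w. if w = v then \<Prod>y\<in>R. sv (v, False) - sv y else 0)"
  have vW: "v \<in> W" using v by (simp add: flawless_def)
  have vR: "(v, a) \<notin> R" for a using N_P P_irrefl by (cases a) (auto simp: R_def)
  have e: "e v \<noteq> 0" using vR by (simp add: e_def prod_sv_nonzero del: sv_simps)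
  have "vm.independent {e}"
    unfolding vm.independent_explicit_module
  proof (intro allI impI)
    fix t u x assume "finite t" "t \<subseteq> {e}" "(\<Sum>v\<in>t. vscale (u v) v) = 0" "x \<in> t"
    then have "t = {e}" "x = e" "vscale (u e) e = 0" by (auto simp: subset_singleton_iff)
    then have "u e * e v = 0" by (simp add: vscale_def fun_eq_iff)
    with e show "u x = 0" using polynomials_no_zero_divisors[of "u e" "e v"] \<open>x = e\<close> by simp
  qed
  moreover have "vm.span {e} = {g \<in> ?M. \<phi> g = 0}"
    unfolding vm.span_singleton
  proof safe
    fix k
    have "pvar u - sv (w, b) dvd vscale k e u - vscale k e w"
      if uw: "u \<in> W" "w \<in> W" "G (u, False) (w, b)" for u w b
    proof -
      have *: "sv (v, False) - sv y dvd e v" if "y \<in> R" for y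
        unfolding e_def if_P[OF refl] by (rule dvd_prodI) (use that in auto)
      consider "u = v" "w \<noteq> v" | "w = v" "u \<noteq> v" | "u \<noteq> v" "w \<noteq> v"
        using G_P[OF uw(3)] P_irrefl by auto
      then show ?thesis
      proof cases
        case 1
        then have "(w, b) \<in> R" using uw by (simp add: R_def)
        from *[OF this] show ?thesis using 1 by (simp add: vscale_def e_def)
      next
        case 2
        have "(u, b) \<in> R" using uw 2 G_sym[OF uw(3)] by (cases b) (auto simp: R_def)
        from *[OF this] have "sv (v, False) - sv (u, b) dvd e v" .
        then have "pvar u - sv (w, b) dvd e v" using 2 pvar_sv_commute[of v u b "e v"] by simp
        then show ?thesis using 2 by (simp add: vscale_def e_def)
      next
        case 3
        then show ?thesis by (simp add: vscale_def e_def)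
      qed
    qed
    then show "vscale k e \<in> ?M"
      using vW v(2) by (intro splinesI) (auto simp: vscale_def e_def)
    show "\<phi> (vscale k e) = 0" by (auto simp: \<phi>_def vscale_def e_def)
  next
    fix g assume g: "g \<in> ?M" "\<phi> g = 0"
    have g0: "g w = 0" if "w \<noteq> v" for w
      using fun_cong[OF g(2), of w] that by (simp add: \<phi>_def)
    have "(\<Prod>y\<in>R. sv (v, False) - sv y) dvd g v"
    proof (rule sv_prod_dvd)
      fix y assume y: "y \<in> R"
      then have "fst y \<noteq> v" using vR by (metis prod.collapse)
      then show "sv (v, False) - sv y dvd g v"
        using splinesD(3)[OF g(1), of "(v, False)" y] y vW g0[of "fst y"] by (simp add: R_def)
    qed (use vR in auto)
    then obtain k where "g v = k * e v" by (auto simp: e_def elim!: dvdE simp: mult.commute)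
    then have "g = vscale k e" using g0 by (auto simp: vscale_def e_def)
    then show "g \<in> range (\<lambda>k. vscale k e)" by auto
  qed
  ultimately have "vm.is_free {g \<in> ?M. \<phi> g = 0}" unfolding vm.is_free_def by blast
  moreover have "\<phi> ` ?M = splines (W - {v}) X"
  proof
    have "\<phi> g = (\<lambda>w. if w \<in> W - {v} then g w else 0)" if "g \<in> ?M" for g
      using that by (auto simp: \<phi>_def splinesD(1))
    moreover have "X - {v} = X" using v(2) by auto
    ultimately show "\<phi> ` ?M \<subseteq> splines (W - {v}) X"
      using splines_restrict[of _ W X "W - {v}"] splinesD(1,2)
      by (auto simp: splines_def \<phi>_def)
  next
    show "splines (W - {v}) X \<subseteq> \<phi> ` ?M"
    proof
      fix g assume g: "g \<in> (splines (W - {v}) X :: ('v \<Rightarrow> ('v, 'k) polynomials) set)"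
      \<comment> \<open>Nodes over distinct vertices are adjacent in the double cover because
        \<open>v\<close> is flawless; nodes over one vertex carry the same prescribed value.\<close>
      have "\<exists>F. \<forall>y\<in>R. poly F (sv y) = g (fst y)"
      proof (rule newton_interpolation)
        fix a b assume ab: "a \<in> R" "b \<in> R" "a \<noteq> b"
        then have nv: "fst a \<noteq> v" "fst b \<noteq> v" using vR by (metis prod.collapse)+
        show "sv a - sv b dvd g (fst a) - g (fst b)"
        proof (cases "fst a = fst b")
          case False
          have in_W: "fst a \<in> W" "fst b \<in> W" using ab by (auto simp: R_def)
          have Pv: "P v (fst a)" "P v (fst b)" using ab G_P[of "(v, False)" a] G_P[of "(v, False)" b] by (auto simp: R_def)
          have "P (fst a) (fst b)"
            using v(1) in_W False Pv unfolding flawless_def simplicial_def by metis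
          moreover have "N (fst a) (fst b)" if "snd a \<noteq> snd b"
          proof (cases "snd a")
            case True
            then have "N v (fst a)" using ab by (auto simp: R_def G_def)
            then show ?thesis using v(1) in_W False Pv unfolding flawless_def by metis
          next
            case F: False
            then have "N v (fst b)" using ab that by (auto simp: R_def G_def)
            then have "N (fst b) (fst a)" using v(1) in_W False Pv unfolding flawless_def by metis
            then show ?thesis by (rule N_sym)
          qed
          ultimately have "G a b" by (simp add: G_def)
          then show ?thesis using ab nv by (intro splinesD(3)[OF g]) (auto simp: R_def)
        qed simp
      qed simp
      then obtain F where F: "\<And>y. y \<in> R \<Longrightarrow> poly F (sv y) = g (fst y)" by blast
      let ?h = "g(v := poly F (pvar v))"
      have hR: "pvar v - sv y dvd ?h v - ?h (fst y)" if "y \<in> R" for y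
        using that vR poly_diff_dvd[of "pvar v" "sv y" F] F[of y] by (cases y) auto
      have "?h \<in> ?M"
      proof (rule splinesI)
        fix u w b assume uw: "u \<in> W" "w \<in> W" "G (u, False) (w, b)"
        consider "u = v" "w \<noteq> v" | "w = v" "u \<noteq> v" | "u \<noteq> v" "w \<noteq> v"
          using G_P[OF uw(3)] P_irrefl by auto
        then show "pvar u - sv (w, b) dvd ?h u - ?h w"
        proof cases
          case 1
          then show ?thesis using hR[of "(w, b)"] uw by (simp add: R_def)
        next
          case 2
          have "(u, b) \<in> R" using uw 2 G_sym[OF uw(3)] by (cases b) (auto simp: R_def)
          from hR[OF this] have "pvar v - sv (u, b) dvd ?h v - ?h u" by simp
          then have "pvar u - sv (w, b) dvd ?h v - ?h u"
            using 2 pvar_sv_commute[of v u b "?h v - ?h u"] by simp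
          then show ?thesis using 2 by (metis dvd_minus_iff minus_diff_eq)
        next
          case 3
          then show ?thesis using splinesD(3)[OF g, of "(u, False)" "(w, b)"] uw by auto
        qed
      qed (use g vW v(2) splinesD(1,2) in auto)
      moreover have "\<phi> ?h = g" using splinesD(1)[OF g, of v] by (auto simp: \<phi>_def)
      ultimately show "g \<in> \<phi> ` ?M" by (metis imageI)
    qed
  qed
  ultimately show ?thesis using is_free_extension[OF subspace_splines[of W X]] free by simp
qed

text \<open>On \<open>W\<close> this is the product of \<open>pvar w ^ 2 - pvar y ^ 2\<close> over
  \<open>y\<close> in \<open>X\<close>. Taking both signs makes it a function of
  \<open>pvar w ^ 2\<close>, hence compatible with edges of either sign.\<close>

definition qprod :: "'v set \<Rightarrow> 'v set \<Rightarrow> 'v \<Rightarrow> ('v, 'k::field_char_0) polynomials" where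
  "qprod W X w = (if w \<in> W then \<Prod>y\<in>X \<times> UNIV. pvar w - sv y else 0)"

lemma qprod_in_splines:
  assumes "X \<subseteq> W"
  shows "qprod W X \<in> (splines W X :: ('v \<Rightarrow> ('v, 'k::field_char_0) polynomials) set)"
proof (rule splinesI)
  fix v assume "v \<in> X"
  then have "(v, False) \<in> X \<times> UNIV" by simp
  moreover have "pvar v - sv (v, False) = (0 :: ('v, 'k) polynomials)" by simp
  ultimately have "\<exists>y\<in>X \<times> UNIV. pvar v - sv y = (0 :: ('v, 'k) polynomials)" by blast
  then have "(\<Prod>y\<in>X \<times> UNIV. pvar v - sv y) = (0 :: ('v, 'k) polynomials)"
    by (intro prod_zero) auto
  then show "qprod W X v = (0 :: ('v, 'k) polynomials)" by (simp add: qprod_def)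
next
  fix u w b assume uw: "u \<in> W" "w \<in> W" "G (u, False) (w, b)"
  have *: "(\<Prod>y\<in>X \<times> UNIV. pvar w - sv y) = (\<Prod>y\<in>X. (pvar w ^ 2 - pvar y ^ 2 :: ('v, 'k) polynomials))" for w
  proof -
    have "(\<Prod>y\<in>X \<times> UNIV. pvar w - sv y) = (\<Prod>y\<in>X. \<Prod>b\<in>UNIV. (pvar w - sv (y, b) :: ('v, 'k) polynomials))"
      by (simp add: prod.cartesian_product case_prod_unfold)
    also have "\<dots> = (\<Prod>y\<in>X. (pvar w ^ 2 - pvar y ^ 2))"
      by (simp add: UNIV_bool power2_eq_square algebra_simps)
    finally show ?thesis .
  qed
  have "pvar u - sv (w, b) dvd (pvar u ^ 2 - pvar y ^ 2) - (pvar w ^ 2 - pvar y ^ 2 :: ('v, 'k) polynomials)" for y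
  proof -
    have "(pvar u ^ 2 - pvar y ^ 2) - (pvar w ^ 2 - pvar y ^ 2) =
        (pvar u - sv (w, b)) * (pvar u + sv (w, b) :: ('v, 'k) polynomials)"
      by (cases b) (simp_all add: power2_eq_square algebra_simps)
    then show ?thesis by simp
  qed
  then show "pvar u - sv (w, b) dvd qprod W X u - (qprod W X w :: ('v, 'k) polynomials)"
    using uw unfolding qprod_def * by (simp add: prod_diff_dvd del: sv_simps)
qed (simp add: qprod_def)

lemma qprod_nonzero:
  assumes "t \<in> W" "t \<notin> X"
  shows "qprod W X t \<noteq> (0 :: ('v, 'k::field_char_0) polynomials)"
  using prod_sv_nonzero[of "X \<times> UNIV" "(t, False)"] assms by (simp add: qprod_def)

text \<open>A vertex joined to all of \<open>X\<close> by negative edges is joined to it by positive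
  ones as well, so each factor divides \<open>g t\<close> separately; the factors are
  coprime.\<close>

lemma qprod_dvd:
  fixes g :: "'v \<Rightarrow> ('v, 'k::field_char_0) polynomials"
  assumes "g \<in> splines W X" "X \<subseteq> W" "t \<in> W" "t \<notin> X" "\<And>s. s \<in> X \<Longrightarrow> N t s"
  shows "qprod W X t dvd g t"
proof -
  have "(\<Prod>y\<in>X \<times> UNIV. sv (t, False) - sv y) dvd g t"
  proof (rule sv_prod_dvd)
    fix y assume y: "y \<in> X \<times> (UNIV :: bool set)"
    then have "G (t, False) y" using assms(5) N_P by (cases y; cases "snd y") auto
    moreover have "g (fst y) = 0" "fst y \<in> W" using y splinesD(2)[OF assms(1)] assms(2) by auto
    ultimately show "sv (t, False) - sv y dvd g t"
      using splinesD(3)[OF assms(1), of "(t, False)" y] assms(3) by simp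
  qed (use assms in auto)
  then show ?thesis using assms(3) by (simp add: qprod_def)
qed

text \<open>Both modules are complements of the line spanned by \<open>qprod W X\<close> in \<open>splines W X\<close>.\<close>

lemma free_splines_exchange:
  assumes X: "X \<subseteq> W" and v: "v \<in> W" "v \<notin> X" "\<And>s. s \<in> X \<Longrightarrow> N v s"
    and t: "t \<in> W" "t \<notin> X" "\<And>s. s \<in> X \<Longrightarrow> N t s"
    and free: "vm.is_free (splines W (insert t X) :: ('v \<Rightarrow> ('v, 'k::field_char_0) polynomials) set)"
  shows "vm.is_free (splines W (insert v X) :: ('v \<Rightarrow> ('v, 'k) polynomials) set)"
proof -
  define q where "q = (qprod W X :: 'v \<Rightarrow> ('v, 'k) polynomials)"
  let ?K = "\<lambda>Y. splines W Y :: ('v \<Rightarrow> ('v, 'k) polynomials) set"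
  \<comment> \<open>Up to the factor \<open>q v\<close>, \<open>\<phi>\<close> subtracts the
    multiple of \<open>q\<close> that makes the result vanish at \<open>v\<close>. Multiplying
    through avoids fractions, and \<open>\<psi>\<close> brings the other module to the same
    scale.\<close>
  define \<phi> where "\<phi> g = (\<lambda>w. q v * g w - g v * q w)" for g :: "'v \<Rightarrow> ('v, 'k) polynomials"
  define \<psi> where "\<psi> g = (\<lambda>w. q v * g w)" for g :: "'v \<Rightarrow> ('v, 'k) polynomials"
  interpret \<phi>: module_hom vscale vscale \<phi>
    by standard (auto simp: \<phi>_def vscale_def fun_eq_iff algebra_simps)
  interpret \<psi>: module_hom vscale vscale \<psi>
    by standard (auto simp: \<psi>_def vscale_def fun_eq_iff algebra_simps)
  have q: "q \<in> ?K X" unfolding q_def by (rule qprod_in_splines[OF X])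
  have qv: "q v \<noteq> 0" and qt: "q t \<noteq> 0" using v t by (simp_all add: q_def qprod_nonzero)
  have red: "(\<lambda>w. g w - c * q w) \<in> ?K (insert u X)" if "g \<in> ?K X" "g u = q u * c" for g c u
  proof -
    have "g - vscale c q \<in> ?K X" using that q by (intro vm.subspace_diff vm.subspace_scale subspace_splines)
    then have "(\<lambda>w. g w - c * q w) \<in> ?K X" by (simp add: vscale_def fun_diff_def)
    then show ?thesis using that(2) by (auto simp: splines_def mult.commute)
  qed
  have "inj_on \<phi> (?K (insert t X))"
    unfolding \<phi>.inj_on_iff_eq_0[OF subspace_splines]
  proof (intro ballI impI)
    fix g assume g: "g \<in> ?K (insert t X)" "\<phi> g = 0"
    then have *: "q v * g w = g v * q w" for w by (simp add: \<phi>_def fun_eq_iff)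
    have "g t = 0" using g(1) by (rule splinesD) simp
    then have "g v = 0" using *[of t] qt polynomials_no_zero_divisors[of "g v" "q t"] by simp
    then have "g w = 0" for w using *[of w] qv polynomials_no_zero_divisors[of "q v" "g w"] by simp
    then show "g = 0" by auto
  qed
  then have "vm.is_free (\<phi> ` ?K (insert t X))" using free by (rule \<phi>.is_free_image[rotated])
  moreover have "\<phi> ` ?K (insert t X) = \<psi> ` ?K (insert v X)"
  proof (intro equalityI subsetI)
    fix y assume "y \<in> \<phi> ` ?K (insert t X)"
    then obtain g where g: "g \<in> ?K (insert t X)" "y = \<phi> g" by auto
    have gX: "g \<in> ?K X" using g(1) by (rule splines_mono) auto
    have "q v dvd g v" unfolding q_def by (rule qprod_dvd[OF gX X v])
    then obtain c where c: "g v = q v * c" by (elim dvdE)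
    have "y = \<psi> (\<lambda>w. g w - c * q w)" by (simp add: g(2) \<phi>_def \<psi>_def c algebra_simps)
    then show "y \<in> \<psi> ` ?K (insert v X)" using red[OF gX c] by auto
  next
    fix y assume "y \<in> \<psi> ` ?K (insert v X)"
    then obtain h where h: "h \<in> ?K (insert v X)" "y = \<psi> h" by auto
    have hX: "h \<in> ?K X" using h(1) by (rule splines_mono) auto
    have "q t dvd h t" unfolding q_def by (rule qprod_dvd[OF hX X t])
    then obtain c where c: "h t = q t * c" by (elim dvdE)
    have "h v = 0" using h(1) by (rule splinesD) simp
    then have "y = \<phi> (\<lambda>w. h w - c * q w)" by (simp add: h(2) \<phi>_def \<psi>_def algebra_simps)
    then show "y \<in> \<phi> ` ?K (insert t X)" using red[OF hX c] by auto
  qed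
  ultimately have "vm.is_free (\<psi> ` ?K (insert v X))" by simp
  moreover have "{g \<in> ?K (insert v X). \<psi> g = 0} = {0}"
  proof -
    have "g = 0" if "\<psi> g = 0" for g
    proof
      fix w
      have "q v * g w = 0" using that by (simp add: \<psi>_def fun_eq_iff)
      then show "g w = 0 w" using qv polynomials_no_zero_divisors[of "q v" "g w"] by simp
    qed
    then show ?thesis using vm.subspace_0[OF subspace_splines] by auto
  qed
  ultimately show ?thesis
    using \<psi>.is_free_extension[OF subspace_splines[of W "insert v X"]] vm.is_free_0 by simp
qed

text \<open>The extension is the even part of the interpolation polynomial at the nodes \<open>\<plusminus>x\<^sub>s\<close>.\<close>

lemma even_extension:
  fixes g :: "'v \<Rightarrow> ('v, 'k::field_char_0) polynomials"
  assumes g: "g \<in> splines W X" and S: "S \<subseteq> W" "Nclique S"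
  obtains h where "h \<in> splines UNIV {}" "\<And>s. s \<in> S \<Longrightarrow> h s = g s"
proof -
  have "\<exists>F. \<forall>y\<in>S \<times> UNIV. poly F (sv y) = g (fst y)"
  proof (rule newton_interpolation)
    fix a b assume ab: "a \<in> S \<times> (UNIV :: bool set)" "b \<in> S \<times> (UNIV :: bool set)" "a \<noteq> b"
    show "sv a - sv b dvd g (fst a) - g (fst b)"
    proof (cases "fst a = fst b")
      case False
      then have "N (fst a) (fst b)" using S(2) ab by (auto simp: Nclique_def)
      then have "G a b" using N_P by (auto simp: G_def)
      then show ?thesis using ab S(1) by (intro splinesD(3)[OF g]) auto
    qed simp
  qed simp
  then obtain F where F: "\<And>s b. s \<in> S \<Longrightarrow> poly F (sv (s, b)) = g s" by fastforce
  define h where "h w = pconst (1/2) * (poly F (pvar w) + poly F (- pvar w))" for w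
  have "h s = g s" if "s \<in> S" for s
  proof -
    have "h s = (pconst (1/2) + pconst (1/2)) * g s"
      using F[OF that, of False] F[OF that, of True] by (simp add: h_def algebra_simps)
    also have "pconst (1/2) + pconst (1/2) = (1 :: ('v, 'k) polynomials)"
      by (simp add: pconst_simps(2) flip: pconst_simps(3))
    finally show ?thesis by simp
  qed
  moreover have "h \<in> splines UNIV {}"
  proof (rule splinesI)
    fix u w b
    let ?d = "pvar u - sv (w, b) :: ('v, 'k) polynomials"
    have "?d dvd poly F (pvar u) - poly F (sv (w, b))" by (rule poly_diff_dvd)
    moreover have "?d dvd poly F (- pvar u) - poly F (- sv (w, b))"
    proof -
      have "- pvar u - - sv (w, b) = - ?d" by simp
      then have "- ?d dvd poly F (- pvar u) - poly F (- sv (w, b))" by (metis poly_diff_dvd)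
      then show ?thesis unfolding minus_dvd_iff .
    qed
    ultimately have "?d dvd (poly F (pvar u) - poly F (sv (w, b))) + (poly F (- pvar u) - poly F (- sv (w, b)))"
      by (rule dvd_add)
    moreover have "h u - h w = pconst (1/2) * \<dots>"
      unfolding h_def by (cases b) (simp_all add: algebra_simps)
    ultimately show "?d dvd h u - h w" by simp
  qed auto
  ultimately show thesis using that by blast
qed

text \<open>Restriction to \<open>W1\<close> is onto, since values on the common clique extend over
  \<open>W2\<close> by \<open>even_extension\<close>; its kernel consists of the splines on
  \<open>W2\<close> vanishing on that clique.\<close>

lemma free_splines_glue:
  assumes W: "W = W1 \<union> W2" and S: "Nclique (W1 \<inter> W2)" and X: "X \<subseteq> W1"
    and noP: "\<And>u w. u \<in> W1 - W2 \<Longrightarrow> w \<in> W2 - W1 \<Longrightarrow> \<not> P u w"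
    and free: "vm.is_free (splines W1 X :: ('v \<Rightarrow> ('v, 'k::field_char_0) polynomials) set)"
      "vm.is_free (splines W2 (W1 \<inter> W2) :: ('v \<Rightarrow> ('v, 'k) polynomials) set)"
  shows "vm.is_free (splines W X :: ('v \<Rightarrow> ('v, 'k) polynomials) set)"
proof -
  let ?M = "splines W X :: ('v \<Rightarrow> ('v, 'k) polynomials) set"
  define \<phi> where "\<phi> g = (\<lambda>w. if w \<in> W1 then g w else 0)" for g :: "'v \<Rightarrow> ('v, 'k) polynomials"
  interpret module_hom vscale vscale \<phi>
    by standard (auto simp: \<phi>_def vscale_def)
  have cases: "fst x \<in> W1 \<and> fst y \<in> W1 \<or> fst x \<in> W2 \<and> fst y \<in> W2"
    if "fst x \<in> W" "fst y \<in> W" "G x y" for x y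
    using that noP G_P[OF that(3)] P_sym W by blast
  have ker: "{g \<in> ?M. \<phi> g = 0} = splines W2 (W1 \<inter> W2)"
  proof (intro equalityI subsetI)
    fix g assume g: "g \<in> {g \<in> ?M. \<phi> g = 0}"
    then have g1: "g w = 0" if "w \<in> W1" for w
      using that by (auto simp: \<phi>_def fun_eq_iff split: if_splits)
    show "g \<in> splines W2 (W1 \<inter> W2)"
      unfolding splines_def using g g1 splinesD[of g W X] by (auto simp: W)
  next
    fix g assume g: "g \<in> (splines W2 (W1 \<inter> W2) :: ('v \<Rightarrow> ('v, 'k) polynomials) set)"
    have g1: "g w = 0" if "w \<in> W1" for w
      using that splinesD(1,2)[OF g, of w] by blast
    have "sv x - sv y dvd g (fst x) - g (fst y)"
      if "fst x \<in> W" "fst y \<in> W" "G x y" for x y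
      using cases[OF that] splinesD(3)[OF g, of x y] g1 that(3) by auto
    then have "g \<in> ?M"
      unfolding splines_def using g1 splinesD(1)[OF g] X W by blast
    moreover have "\<phi> g = 0" using g1 by (auto simp: \<phi>_def)
    ultimately show "g \<in> {g \<in> ?M. \<phi> g = 0}" by simp
  qed
  have im: "\<phi> ` ?M = splines W1 X"
  proof (intro equalityI subsetI)
    fix y assume "y \<in> \<phi> ` ?M"
    then show "y \<in> splines W1 X"
      using splines_restrict[of _ W X W1] X W by (auto simp: \<phi>_def Int_absorb2)
  next
    fix g assume g: "g \<in> (splines W1 X :: ('v \<Rightarrow> ('v, 'k) polynomials) set)"
    obtain h where h: "h \<in> splines UNIV {}" "\<And>s. s \<in> W1 \<inter> W2 \<Longrightarrow> h s = g s"
      using even_extension[OF g, of "W1 \<inter> W2"] S by blast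
    define f where "f w = (if w \<in> W1 then g w else if w \<in> W2 then h w else 0)" for w
    have f2: "f w = h w" if "w \<in> W2" for w using that h(2) by (auto simp: f_def)
    have "sv x - sv y dvd f (fst x) - f (fst y)"
      if xy: "fst x \<in> W" "fst y \<in> W" "G x y" for x y
      using cases[OF xy]
    proof
      assume "fst x \<in> W1 \<and> fst y \<in> W1"
      then show ?thesis using splinesD(3)[OF g, of x y] xy(3) by (simp add: f_def)
    next
      assume "fst x \<in> W2 \<and> fst y \<in> W2"
      then show ?thesis using splinesD(3)[OF h(1), of x y] xy(3) f2 by simp
    qed
    moreover have "f v = 0" if "v \<notin> W \<or> v \<in> X" for v
      using that X W splinesD(2)[OF g] by (auto simp: f_def)
    ultimately have "f \<in> ?M" unfolding splines_def by blast
    moreover have "\<phi> f = g" using splinesD(1)[OF g] by (auto simp: \<phi>_def f_def)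
    ultimately show "g \<in> \<phi> ` ?M" by (metis imageI)
  qed
  show ?thesis
    by (rule is_free_extension[OF subspace_splines]) (use ker im free in simp_all)
qed

theorem free_splines:
  assumes red: "\<And>W. W \<noteq> {} \<Longrightarrow> (\<exists>v. flawless W v) \<or>
      (\<exists>C\<subseteq>W. C \<noteq> {} \<and> Nclique (nbr W C) \<and> W - (C \<union> nbr W C) \<noteq> {})"
    and "X \<subseteq> W" "Nclique X"
  shows "vm.is_free (splines W X :: ('v \<Rightarrow> ('v, 'k::field_char_0) polynomials) set)"
  using assms(2,3)
proof (induction "card W" arbitrary: W X rule: less_induct)
  case less
  have IH: "vm.is_free (splines W' X' :: ('v \<Rightarrow> ('v, 'k) polynomials) set)"
    if "W' \<subset> W" "X' \<subseteq> W'" "Nclique X'" for W' X'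
    using that less.hyps[of W' X'] by (simp add: psubset_card_mono)
  consider "W = {}" | v where "flawless W v" |
    C where "C \<subseteq> W" "C \<noteq> {}" "Nclique (nbr W C)" "W - (C \<union> nbr W C) \<noteq> {}"
    using red[of W] by metis
  then show ?case
  proof cases
    case 1
    then have "splines W X = ({0} :: ('v \<Rightarrow> ('v, 'k) polynomials) set)"
      by (auto simp: splines_def)
    then show ?thesis using vm.is_free_0 by simp
  next
    case 2
    have vW: "v \<in> W" using 2 by (simp add: flawless_def)
    have away: "vm.is_free (splines W Y :: ('v \<Rightarrow> ('v, 'k) polynomials) set)"
      if "Y \<subseteq> W" "Nclique Y" "v \<notin> Y" for Y
      using free_splines_flawless[OF 2 that(3)] IH[of "W - {v}" Y] that vW by blast
    show ?thesis
    proof (cases "v \<in> X")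
      case False
      then show ?thesis using away less.prems by blast
    next
      case vX: True
      define Y where "Y = X - {v}"
      have Y: "Y \<subseteq> W" "Nclique Y" "v \<notin> Y" "insert v Y = X"
        using less.prems vX by (auto simp: Y_def Nclique_def)
      have NY: "N v s" if "s \<in> Y" for s using that less.prems(2) vX by (auto simp: Y_def Nclique_def)
      show ?thesis
      \<comment> \<open>The vertex \<open>v\<close> must leave the vanishing set before
        \<open>away\<close> applies. If its neighbours all lie in \<open>X\<close>, its conditions
        are void and it can be deleted; otherwise a neighbour \<open>t\<close> outside
        \<open>X\<close> takes its place.\<close>
      proof (cases "\<forall>w\<in>W. P v w \<longrightarrow> w \<in> X")
        case True
        have "splines W X = (splines (W - {v}) Y :: ('v \<Rightarrow> ('v, 'k) polynomials) set)"
        proof (intro equalityI subsetI)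
          fix g assume "g \<in> (splines W X :: ('v \<Rightarrow> ('v, 'k) polynomials) set)"
          then show "g \<in> splines (W - {v}) Y" using vX by (auto simp: splines_def Y_def)
        next
          fix g assume g: "g \<in> (splines (W - {v}) Y :: ('v \<Rightarrow> ('v, 'k) polynomials) set)"
          have gX: "g w = 0" if "w \<in> X" for w using that splinesD(1,2)[OF g, of w] by (auto simp: Y_def)
          have "sv x - sv y dvd g (fst x) - g (fst y)"
            if xy: "fst x \<in> W" "fst y \<in> W" "G x y" for x y
          proof (cases "fst x = v \<or> fst y = v")
            case v: True
            then have "fst x \<in> X \<and> fst y \<in> X" using True xy G_P[OF xy(3)] vX P_sym by auto
            then show ?thesis using gX by simp
          next
            case False
            then show ?thesis using splinesD(3)[OF g, of x y] xy by simp
          qed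
          then show "g \<in> splines W X" unfolding splines_def using gX splinesD(1)[OF g] by blast
        qed
        then show ?thesis using IH[of "W - {v}" Y] Y vW by auto
      next
        case False
        then obtain t where t: "t \<in> W" "P v t" "t \<notin> X" by auto
        have Nt: "N t s" if "s \<in> Y" for s
        proof -
          have "s \<in> W" "s \<noteq> t" using that t(3) Y(1) by (auto simp: Y_def)
          then have "N s t" using 2 t(1,2) NY[OF that] unfolding flawless_def by metis
          then show ?thesis by (rule N_sym)
        qed
        have tY: "t \<notin> Y" "v \<notin> insert t Y" using t vX Y(3) by (auto simp: Y_def)
        have cl: "Nclique (insert t Y)" using Y(2) Nt N_sym by (auto simp: Nclique_def)
        have "vm.is_free (splines W (insert v Y) :: ('v \<Rightarrow> ('v, 'k) polynomials) set)"
        proof (rule free_splines_exchange[OF Y(1) vW Y(3) NY t(1) tY(1) Nt])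
          show "vm.is_free (splines W (insert t Y) :: ('v \<Rightarrow> ('v, 'k) polynomials) set)"
            by (rule away[OF _ cl tY(2)]) (use t(1) Y(1) in simp)
        qed
        then show ?thesis by (simp add: Y(4))
      qed
    qed
  next
    case 3
    let ?S = "nbr W C"
    define W1 where "W1 = C \<union> ?S"
    define W2 where "W2 = W - C"
    have SW: "?S \<subseteq> W - C" by (auto simp: nbr_def)
    have W12: "W = W1 \<union> W2" "W1 \<inter> W2 = ?S" "W1 \<subset> W" "W2 \<subset> W"
      using SW 3 by (auto simp: W1_def W2_def)
    have noP: "\<not> P u w" if "u \<in> W1 - W2" "w \<in> W2 - W1" for u w
      using that 3 by (auto simp: W1_def W2_def nbr_def)
    \<comment> \<open>A clique cannot meet both open sides; the side containing \<open>X\<close> is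
      the one onto which the gluing lemma restricts.\<close>
    have "X \<subseteq> W1 \<or> X \<subseteq> W2"
    proof (rule ccontr)
      assume "\<not> ?thesis"
      then obtain x y where xy: "x \<in> X" "x \<notin> W2" "y \<in> X" "y \<notin> W1" by auto
      then have "x \<noteq> y" using less.prems(1) W12(1) by auto
      then have "P x y" using less.prems(2) xy N_P by (auto simp: Nclique_def)
      with xy show False using noP[of x y] less.prems(1) W12(1) by blast
    qed
    then show ?thesis
    proof
      assume X1: "X \<subseteq> W1"
      show ?thesis
      proof (rule free_splines_glue[OF W12(1) _ X1 noP])
        show "Nclique (W1 \<inter> W2)" unfolding W12(2) by (rule 3)
        show "vm.is_free (splines W1 X :: ('v \<Rightarrow> ('v, 'k) polynomials) set)"
          by (rule IH[OF W12(3) X1 less.prems(2)])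
        show "vm.is_free (splines W2 (W1 \<inter> W2) :: ('v \<Rightarrow> ('v, 'k) polynomials) set)"
          by (rule IH[OF W12(4)]) (use W12(2) 3(3) in auto)
      qed
    next
      assume X2: "X \<subseteq> W2"
      show ?thesis
      proof (rule free_splines_glue[OF _ _ X2])
        show "W = W2 \<union> W1" using W12(1) by auto
        show "Nclique (W2 \<inter> W1)" unfolding Int_commute[of W2] W12(2) by (rule 3)
        show "\<And>u w. u \<in> W2 - W1 \<Longrightarrow> w \<in> W1 - W2 \<Longrightarrow> \<not> P u w" using noP P_sym by blast
        show "vm.is_free (splines W2 X :: ('v \<Rightarrow> ('v, 'k) polynomials) set)"
          by (rule IH[OF W12(4) X2 less.prems(2)])
        show "vm.is_free (splines W1 (W2 \<inter> W1) :: ('v \<Rightarrow> ('v, 'k) polynomials) set)"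
          by (rule IH[OF W12(3)]) (use W12(2) 3(3) in \<open>auto simp: Int_commute[of W2 W1]\<close>)
      qed
    qed
  qed
qed

end

section \<open>Logarithmic derivations\<close>

lemma derivation_rules:
  assumes "is_derivation \<theta>"
  shows "\<theta> (p + q) = \<theta> p + \<theta> q" "\<theta> (pconst c * p) = pconst c * \<theta> p"
    "\<theta> (p * q) = p * \<theta> q + q * \<theta> p" "\<theta> (pconst c) = 0" "\<theta> (- p) = - \<theta> p" "\<theta> (p - q) = \<theta> p - \<theta> q" "\<theta> 0 = 0"
proof -
  show add: "\<theta> (p + q) = \<theta> p + \<theta> q" and sc: "\<theta> (pconst c * p) = pconst c * \<theta> p"
    and "\<theta> (p * q) = p * \<theta> q + q * \<theta> p" for p q c
    using assms unfolding is_derivation_def by blast+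
  then have "\<theta> (1 * 1) = 1 * \<theta> 1 + 1 * \<theta> 1" by blast
  then have "\<theta> 1 = 0" by simp
  then show "\<theta> (pconst c) = 0" using sc[of c 1] by simp
  show neg: "\<theta> (- p) = - \<theta> p" for p
    using sc[of "- 1" p] by (simp add: pconst_minus pconst_simps)
  show "\<theta> (p - q) = \<theta> p - \<theta> q" using add[of p "- q"] neg[of q] by simp
  show "\<theta> 0 = 0" using add[of 0 0] by simp
qed

lemma derivation_sum:
  assumes "is_derivation \<theta>"
  shows "\<theta> (sum f A) = (\<Sum>x\<in>A. \<theta> (f x))"
  by (induction A rule: infinite_finite_induct) (simp_all add: derivation_rules[OF assms])

lemma derivation_eqI:
  fixes \<theta> \<eta> :: "('v::finite, 'k::field) polynomials \<Rightarrow> ('v, 'k) polynomials"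
  assumes "is_derivation \<theta>" "is_derivation \<eta>" "\<And>v. \<theta> (pvar v) = \<eta> (pvar v)"
  shows "\<theta> = \<eta>"
proof
  show "\<theta> p = \<eta> p" for p
    by (induction p rule: polynomials_induct)
       (simp_all add: assms derivation_rules[OF assms(1)] derivation_rules[OF assms(2)])
qed

lemma is_derivation_add: "is_derivation \<theta> \<Longrightarrow> is_derivation \<eta> \<Longrightarrow> is_derivation (\<theta> + \<eta>)"
  by (auto simp: is_derivation_def algebra_simps)

lemma is_derivation_scale: "is_derivation \<theta> \<Longrightarrow> is_derivation (der_scale f \<theta>)"
  by (auto simp: is_derivation_def der_scale_def algebra_simps)

text \<open>Taylor expansion to first order: \<open>x\<^sub>v \<mapsto> x\<^sub>v + f\<^sub>v t\<close> modulo \<open>t\<^sup>2\<close>.\<close>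

definition mk_der ::
  "('v::finite \<Rightarrow> ('v, 'k::field) polynomials) \<Rightarrow> ('v, 'k) polynomials \<Rightarrow> ('v, 'k) polynomials" where
  "mk_der f p = coeff (psubst (\<lambda>c. [:pconst c:]) (\<lambda>v. [:pvar v, f v:]) p) 1"

lemma mk_der:
  fixes f :: "'v::finite \<Rightarrow> ('v, 'k::field) polynomials"
  shows "is_derivation (mk_der f)" "mk_der f (pvar v) = f v"
proof -
  have c: "comm_ring_1_hom (\<lambda>c::'k. [:pconst c :: ('v, 'k) polynomials:])"
    by unfold_locales (simp_all add: pconst_simps one_pCons)
  define E where "E = psubst (\<lambda>c. [:pconst c:]) (\<lambda>v. [:pvar v, f v:])"
  interpret E: comm_ring_1_hom E unfolding E_def by (rule psubst_hom[OF c])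
  have E_c: "E (pconst c) = [:pconst c:]" and E_v: "E (pvar v) = [:pvar v, f v:]" for c v
    by (simp_all add: E_def psubst_pconst[OF c] psubst_pvar[OF c])
  have E0: "coeff (E p) 0 = p" for p
    by (induction p rule: polynomials_induct) (simp_all add: E_c E_v E.homs coeff_mult)
  have mk: "mk_der f p = coeff (E p) 1" for p by (simp add: mk_der_def E_def)
  show "mk_der f (pvar v) = f v" by (simp add: mk E_v)
  show "is_derivation (mk_der f)"
    unfolding is_derivation_def mk
    by (auto simp: E.homs E_c coeff_mult E0 algebra_simps)
qed

lemma linear_form_kernel_scalar:
  fixes a b :: "'k::field ^ 'v::finite"
  assumes ker: "linear_form_kernel a = linear_form_kernel b" and b: "b $ m \<noteq> 0"
  obtains c where "c \<noteq> 0" "\<And>i. a $ i = c * b $ i"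
proof
  have fin: "(\<Sum>i\<in>UNIV. d $ i * (\<chi> l. (if l = i' then s else 0) - (if l = m then t else 0)) $ i) = d $ i' * s - d $ m * t"
    for d :: "'k ^ 'v" and i' s t
    by (simp add: right_diff_distrib sum_subtractf if_distrib[of "\<lambda>x. _ * x"] cong: if_cong)
  \<comment> \<open>The test vector with entries \<open>b $ m\<close> at \<open>i\<close> and
    \<open>- b $ i\<close> at \<open>m\<close> lies in the kernel of \<open>b\<close>, hence in that
    of \<open>a\<close>.\<close>
  have *: "a $ i * b $ m = a $ m * b $ i" for i
  proof -
    have "(\<chi> l. (if l = i then b $ m else 0) - (if l = m then b $ i else 0)) \<in> linear_form_kernel b"
      by (simp only: linear_form_kernel_def mem_Collect_eq fin) simp
    then show ?thesis unfolding ker[symmetric]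
      by (simp only: linear_form_kernel_def mem_Collect_eq fin) simp
  qed
  show "a $ i = a $ m / b $ m * b $ i" for i using *[of i] b by (simp add: field_simps)
  have "(\<chi> l. (if l = m then 1 else 0) - (if l = m then 0 else 0)) \<notin> linear_form_kernel b"
    using b by (simp only: linear_form_kernel_def mem_Collect_eq fin) simp
  then have "a $ m \<noteq> 0" unfolding ker[symmetric]
    by (simp only: linear_form_kernel_def mem_Collect_eq fin) simp
  then show "a $ m / b $ m \<noteq> 0" using b by simp
qed

lemma linear_form_dvd_iff:
  fixes a b :: "'k::field ^ 'v::finite"
  assumes \<theta>: "is_derivation \<theta>" and H: "H = linear_form_kernel b" and b: "b $ m \<noteq> 0"
  shows "(\<forall>a. linear_form_kernel a = H \<longrightarrow> linear_form a dvd \<theta> (linear_form a)) \<longleftrightarrow>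
    linear_form b dvd \<theta> (linear_form b)"
proof (intro iffI allI impI)
  fix a :: "'k ^ 'v"
  assume *: "linear_form b dvd \<theta> (linear_form b)" and a: "linear_form_kernel a = H"
  obtain c where c: "c \<noteq> 0" "\<And>i. a $ i = c * b $ i"
    using linear_form_kernel_scalar[of a b m] a H b by blast
  have ab: "linear_form a = pconst c * linear_form b"
    by (simp add: linear_form_def c(2) pconst_simps sum_distrib_left mult.assoc)
  then show "linear_form a dvd \<theta> (linear_form a)"
    using * by (simp add: derivation_rules[OF \<theta>] mult_dvd_mono)
qed (use H in auto)

lemma ball_signed_arrangement:
  "(\<forall>H\<in>signed_arrangement Gp Gn L. Q H) \<longleftrightarrow>
    (\<forall>i j. {i, j} \<in> Gp \<longrightarrow> Q {x. x $ i - x $ j = 0}) \<and>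
    (\<forall>i j. {i, j} \<in> Gn \<longrightarrow> Q {x. x $ i + x $ j = 0}) \<and> (\<forall>i\<in>L. Q {x. x $ i = 0})"
  unfolding signed_arrangement_def ball_Un conj_assoc by (intro arg_cong2[of _ _ _ _ "(\<and>)"]) auto

lemma log_derivations_signed_arrangement:
  fixes \<theta> :: "('v::finite, 'k::field) polynomials \<Rightarrow> ('v, 'k) polynomials"
  assumes "simple_edges Gp" "simple_edges Gn"
  shows "\<theta> \<in> log_derivations (signed_arrangement Gp Gn L) \<longleftrightarrow>
    is_derivation \<theta> \<and>
    (\<forall>i j. {i, j} \<in> Gp \<longrightarrow> pvar i - pvar j dvd \<theta> (pvar i) - \<theta> (pvar j)) \<and>
    (\<forall>i j. {i, j} \<in> Gn \<longrightarrow> pvar i + pvar j dvd \<theta> (pvar i) + \<theta> (pvar j)) \<and>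
    (\<forall>i\<in>L. pvar i dvd \<theta> (pvar i))"
proof (cases "is_derivation \<theta>")
  case \<theta>: True
  \<comment> \<open>Coefficient vector of \<open>x_i + c x_j\<close>; a loop at \<open>i\<close> is
    the case \<open>j = i\<close>, \<open>c = 0\<close>.\<close>
  define vec :: "'v \<Rightarrow> 'v \<Rightarrow> 'k \<Rightarrow> 'k ^ 'v" where
    "vec i j c = (\<chi> l. (if l = i then 1 else 0) + (if l = j then c else 0))" for i j c
  have ker: "linear_form_kernel (vec i j c) = {x. x $ i + c * x $ j = 0}" for i j c
    by (simp add: linear_form_kernel_def vec_def distrib_right sum.distrib
        if_distrib[of "\<lambda>x. x * _"] cong: if_cong)
  have lf: "linear_form (vec i j c) = pvar i + pconst c * pvar j" for i j c
    by (simp add: linear_form_def vec_def pconst_simps distrib_right sum.distrib if_distrib[of pconst]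
        if_distrib[of "\<lambda>x. x * _"] cong: if_cong)
  have *: "(\<forall>a. linear_form_kernel a = {x. x $ i + c * x $ j = 0} \<longrightarrow> linear_form a dvd \<theta> (linear_form a)) \<longleftrightarrow>
      pvar i + pconst c * pvar j dvd \<theta> (pvar i) + pconst c * \<theta> (pvar j)" if "i \<noteq> j \<or> c = 0" for i j c
  proof -
    have "vec i j c $ i \<noteq> 0" using that by (auto simp: vec_def)
    from linear_form_dvd_iff[OF \<theta> ker[symmetric] this] show ?thesis
      by (simp only: lf derivation_rules(1,2)[OF \<theta>])
  qed
  have neq: "i \<noteq> j" if "{i, j} \<in> Gp \<union> Gn" for i j
    using that assms by (auto simp: simple_edges_def)
  define Q where "Q H \<longleftrightarrow> (\<forall>a. linear_form_kernel a = H \<longrightarrow> linear_form a dvd \<theta> (linear_form a))" for H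
  have "(Q {x. x $ i - x $ j = 0} \<longleftrightarrow> pvar i - pvar j dvd \<theta> (pvar i) - \<theta> (pvar j))"
    if "{i, j} \<in> Gp" for i j
    using *[of i j "- 1"] neq[of i j] that by (simp add: Q_def pconst_simps pconst_minus)
  moreover have "(Q {x. x $ i + x $ j = 0} \<longleftrightarrow> pvar i + pvar j dvd \<theta> (pvar i) + \<theta> (pvar j))"
    if "{i, j} \<in> Gn" for i j
    using *[of i j 1] neq[of i j] that by (simp add: Q_def pconst_simps)
  moreover have "(Q {x. x $ i = 0} \<longleftrightarrow> pvar i dvd \<theta> (pvar i))" for i
    using *[of i i 0] by (simp add: Q_def pconst_simps)
  ultimately have "(\<forall>H\<in>signed_arrangement Gp Gn L. Q H) \<longleftrightarrow>
    (\<forall>i j. {i, j} \<in> Gp \<longrightarrow> pvar i - pvar j dvd \<theta> (pvar i) - \<theta> (pvar j)) \<and>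
    (\<forall>i j. {i, j} \<in> Gn \<longrightarrow> pvar i + pvar j dvd \<theta> (pvar i) + \<theta> (pvar j)) \<and>
    (\<forall>i\<in>L. pvar i dvd \<theta> (pvar i))"
    unfolding ball_signed_arrangement by simp
  then show ?thesis using \<theta> unfolding log_derivations_def Q_def by blast
qed (simp add: log_derivations_def)

lemma sv_dvd_cancel:
  fixes h :: "('v::finite, 'k::field) polynomials"
  assumes "pvar u - sv (w, b) dvd sv (w, b) * h" "u \<noteq> w"
  shows "pvar u - sv (w, b) dvd h"
proof -
  interpret comm_ring_1_hom "repl u (sv (w, b))" by (rule repl_hom)
  have r: "repl u (sv (w, b)) (sv (w, b)) = sv (w, b)" using assms(2) by (simp add: repl_sv)
  have "sv (w, b) * repl u (sv (w, b)) h = 0"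
    using assms(1) unfolding dvd_iff_repl[OF r] by (simp only: hom_mult r)
  then have "repl u (sv (w, b)) h = 0"
    using polynomials_no_zero_divisors[of "sv (w, b)" "repl u (sv (w, b)) h"] by simp
  then show ?thesis using dvd_iff_repl[OF r] by blast
qed

lemma (in signed_graph) free_arrangement_if_free_splines:
  assumes simple: "simple_edges Gp" "simple_edges Gn"
    and PN: "\<And>u v. P u v \<longleftrightarrow> {u, v} \<in> Gp" "\<And>u v. N u v \<longleftrightarrow> {u, v} \<in> Gn"
    and free: "vm.is_free (splines UNIV {} :: ('v \<Rightarrow> ('v, 'k::field_char_0) polynomials) set)"
  shows "free_arrangement (signed_arrangement Gp Gn UNIV :: ('k ^ 'v) set set)"
proof -
  let ?M = "splines UNIV {} :: ('v \<Rightarrow> ('v, 'k) polynomials) set"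
  define \<Psi> where "\<Psi> g = mk_der (\<lambda>v. pvar v * g v)" for g :: "'v \<Rightarrow> ('v, 'k) polynomials"
  have \<Psi>: "is_derivation (\<Psi> g)" "\<Psi> g (pvar v) = pvar v * g v" for g v
    by (simp_all add: \<Psi>_def mk_der)
  interpret module_hom vscale der_scale \<Psi>
  proof unfold_locales
    show "\<Psi> (f + g) = \<Psi> f + \<Psi> g" for f g
      by (rule derivation_eqI) (simp_all add: \<Psi> is_derivation_add algebra_simps)
    show "\<Psi> (vscale c g) = der_scale c (\<Psi> g)" for c g
      by (rule derivation_eqI) (simp_all add: \<Psi> is_derivation_scale, simp add: der_scale_def vscale_def \<Psi>)
  qed
  have "inj_on \<Psi> ?M"
    unfolding inj_on_iff_eq_0[OF subspace_splines]
  proof (intro ballI impI ext)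
    fix g v assume "\<Psi> g = 0"
    then have "pvar v * g v = 0" using \<Psi>(2)[of g v] by simp
    then show "g v = 0 v" using polynomials_no_zero_divisors[of "pvar v" "g v"] by simp
  qed
  \<comment> \<open>Modulo \<open>pvar u - sv (w, b)\<close> the factor \<open>pvar u\<close> may be
    replaced by \<open>sv (w, b)\<close>, which is coprime to the modulus and cancels.\<close>
  have key: "(pvar u - sv (w, b) dvd pvar u * g u - sv (w, b) * g w) \<longleftrightarrow>
      pvar u - sv (w, b) dvd g u - g w" if "u \<noteq> w" for u w b and g :: "'v \<Rightarrow> ('v, 'k) polynomials"
  proof -
    have "pvar u * g u - sv (w, b) * g w = (pvar u - sv (w, b)) * g u + sv (w, b) * (g u - g w)"
      by (simp add: algebra_simps)
    from this have "(pvar u - sv (w, b) dvd pvar u * g u - sv (w, b) * g w) \<longleftrightarrow>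
        pvar u - sv (w, b) dvd sv (w, b) * (g u - g w)"
      by (simp only: dvd_add_right_iff[OF dvd_triv_left])
    also have "\<dots> \<longleftrightarrow> pvar u - sv (w, b) dvd g u - g w"
      by (rule iffI[OF sv_dvd_cancel[OF _ that] dvd_mult])
    finally show ?thesis .
  qed
  have log: "\<Psi> g \<in> log_derivations (signed_arrangement Gp Gn UNIV) \<longleftrightarrow> g \<in> ?M" for g
  proof -
    have "\<Psi> g \<in> log_derivations (signed_arrangement Gp Gn UNIV) \<longleftrightarrow>
        (\<forall>u w b. G (u, False) (w, b) \<longrightarrow> pvar u - sv (w, b) dvd pvar u * g u - sv (w, b) * g w)"
      unfolding log_derivations_signed_arrangement[OF simple] \<Psi> all_bool_eq
      by (auto simp: \<Psi>(1) PN)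
    also have "\<dots> \<longleftrightarrow> (\<forall>u w b. G (u, False) (w, b) \<longrightarrow> pvar u - sv (w, b) dvd g u - g w)"
    proof -
      have "u \<noteq> w" if "G (u, False) (w, b)" for u w b using G_P[OF that] P_irrefl by auto
      then show ?thesis using key by auto
    qed
    also have "\<dots> \<longleftrightarrow> g \<in> ?M"
    proof
      assume "g \<in> ?M"
      show "\<forall>u w b. G (u, False) (w, b) \<longrightarrow> pvar u - sv (w, b) dvd g u - g w"
      proof (intro allI impI)
        fix u w b assume "G (u, False) (w, b)"
        then show "pvar u - sv (w, b) dvd g u - g w"
          using splinesD(3)[OF \<open>g \<in> ?M\<close>, of "(u, False)" "(w, b)"] by simp
      qed
    qed (auto intro: splinesI)
    finally show ?thesis .
  qed
  have "\<Psi> ` ?M = log_derivations (signed_arrangement Gp Gn UNIV)"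
  proof (intro equalityI subsetI)
    fix \<theta> assume th: "\<theta> \<in> log_derivations (signed_arrangement Gp Gn UNIV :: ('k ^ 'v) set set)"
    then have der: "is_derivation \<theta>" and "\<forall>v. pvar v dvd \<theta> (pvar v)"
      unfolding log_derivations_signed_arrangement[OF simple] by auto
    then obtain g where g: "\<And>v. \<theta> (pvar v) = pvar v * g v" unfolding dvd_def by metis
    have "\<theta> = \<Psi> g" by (rule derivation_eqI) (simp_all add: der \<Psi> g)
    then show "\<theta> \<in> \<Psi> ` ?M" using th log by blast
  qed (use log in blast)
  then show ?thesis
    using is_free_image[OF free \<open>inj_on \<Psi> ?M\<close>]
    unfolding free_arrangement_def der.is_free_def by simp
qed

section \<open>Chordless balanced cycles obstruct freeness\<close>

text \<open>Gaussian elimination without division. The absence of zero divisors is a hypothesis so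
  that the lemma serves both the polynomial ring and the field of values at a point.\<close>

lemma rank_bound:
  fixes f :: "'j \<Rightarrow> 'i \<Rightarrow> 'a::comm_ring_1"
  assumes nzd: "\<And>a b :: 'a. a * b = 0 \<Longrightarrow> a = 0 \<or> b = 0"
    and "finite I" "finite J" "card I < card J"
  shows "\<exists>c. (\<exists>j\<in>J. c j \<noteq> 0) \<and> (\<forall>i\<in>I. (\<Sum>j\<in>J. c j * f j i) = 0)"
  using assms(2-4)
proof (induction I arbitrary: J f rule: finite_induct)
  case empty
  then obtain j where "j \<in> J" by (metis card_gt_0_iff card.empty ex_in_conv)
  then show ?case by (intro exI[of _ "\<lambda>_. 1"]) auto
next
  case (insert i0 I)
  show ?case
  proof (cases "\<forall>j\<in>J. f j i0 = 0")
    case True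
    have "card I < card J" using insert by simp
    from insert.IH[OF insert.prems(1) this, of f]
    obtain c where "\<exists>j\<in>J. c j \<noteq> 0" "\<forall>i\<in>I. (\<Sum>j\<in>J. c j * f j i) = 0" by blast
    then show ?thesis using True by (intro exI[of _ c]) auto
  next
    case False
    then obtain j0 where j0: "j0 \<in> J" "f j0 i0 \<noteq> 0" by blast
    let ?J = "J - {j0}"
    have "finite ?J" "card I < card ?J" using insert j0 by (simp_all add: card_Diff_singleton)
    from insert.IH[OF this, of "\<lambda>j i. f j0 i0 * f j i - f j i0 * f j0 i"]
    obtain c where c: "\<exists>j\<in>?J. c j \<noteq> 0"
      "\<forall>i\<in>I. (\<Sum>j\<in>?J. c j * (f j0 i0 * f j i - f j i0 * f j0 i)) = 0" by blast
    \<comment> \<open>Cross-multiplication with the pivot \<open>f j0 i0\<close>: the coefficient at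
      \<open>j0\<close> is chosen to cancel the column \<open>i0\<close>.\<close>
    define c' where "c' j = (if j = j0 then - (\<Sum>j\<in>?J. c j * f j i0) else c j * f j0 i0)" for j
    have sum: "(\<Sum>j\<in>J. c' j * f j i) = (\<Sum>j\<in>?J. c j * (f j0 i0 * f j i - f j i0 * f j0 i))" for i
    proof -
      have "(\<Sum>j\<in>J. c' j * f j i) = c' j0 * f j0 i + (\<Sum>j\<in>?J. c' j * f j i)"
        using insert.prems(1) j0(1) by (rule sum.remove)
      also have "(\<Sum>j\<in>?J. c' j * f j i) = (\<Sum>j\<in>?J. c j * f j0 i0 * f j i)"
        by (intro sum.cong) (auto simp: c'_def)
      finally show ?thesis
        by (simp add: c'_def sum_distrib_right sum_subtractf right_diff_distrib mult.assoc)
    qed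
    obtain j1 where j1: "j1 \<in> ?J" "c j1 \<noteq> 0" using c(1) by blast
    then have "c' j1 \<noteq> 0" using nzd[of "c j1" "f j0 i0"] j0 by (auto simp: c'_def)
    then show ?thesis
      using c(2) j1 by (intro exI[of _ c']) (auto simp: sum mult.commute)
  qed
qed

text \<open>A derivation is determined by its values on the variables, so more than
  \<open>CARD('v)\<close> derivations satisfy a nontrivial linear relation over the polynomial
  ring.\<close>

lemma independent_derivations_card:
  fixes B :: "(('v::finite, 'k::field) polynomials \<Rightarrow> ('v, 'k) polynomials) set"
  assumes B: "der.independent B" "\<And>\<theta>. \<theta> \<in> B \<Longrightarrow> is_derivation \<theta>"
  shows "finite B \<and> card B \<le> CARD('v)"
proof (rule ccontr)
  assume "\<not> ?thesis"
  then obtain J where J: "J \<subseteq> B" "finite J" "card J = Suc CARD('v)"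
    by (metis infinite_arbitrarily_large not_less_eq_eq obtain_subset_with_card_n)
  have "\<exists>c. (\<exists>\<theta>\<in>J. c \<theta> \<noteq> 0) \<and> (\<forall>v\<in>(UNIV :: 'v set). (\<Sum>\<theta>\<in>J. c \<theta> * \<theta> (pvar v)) = 0)"
    by (rule rank_bound) (use J polynomials_no_zero_divisors in auto)
  then obtain c \<theta>0 where c: "\<theta>0 \<in> J" "c \<theta>0 \<noteq> 0" "\<And>v. (\<Sum>\<theta>\<in>J. c \<theta> * \<theta> (pvar v)) = 0" by blast
  have ev: "(\<Sum>\<theta>\<in>J. der_scale (c \<theta>) \<theta>) p = (\<Sum>\<theta>\<in>J. c \<theta> * \<theta> p)" for p
    by (induction J rule: infinite_finite_induct) (auto simp: der_scale_def)
  have der: "is_derivation (\<Sum>\<theta>\<in>J. der_scale (c \<theta>) \<theta>)"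
    using \<open>finite J\<close> J(1)
  proof (induction J rule: finite_induct)
    case empty
    show ?case by (simp add: is_derivation_def)
  next
    case (insert \<theta> F)
    then show ?case unfolding sum.insert[OF insert.hyps]
      using B(2) by (intro is_derivation_add is_derivation_scale) auto
  qed
  have "(\<Sum>\<theta>\<in>J. der_scale (c \<theta>) \<theta>) = 0"
    by (rule derivation_eqI[OF der]) (simp_all add: ev c(3), simp add: is_derivation_def)
  then have "c \<theta>0 = 0" using der.independentD[OF B(1) J(2,1)] c(1) by blast
  with c(2) show False by simp
qed

section \<open>A point on the hyperplanes of a chordless balanced cycle\<close>

locale chordless_cycle = signed_graph P N for P N :: "'v::finite \<Rightarrow> 'v \<Rightarrow> bool" +
  fixes vs :: "('v \<times> bool) list" and n :: nat
  assumes n_def: "n = length vs" and n4: "4 \<le> n" and dist: "distinct (map fst vs)"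
    and edge: "i < n \<Longrightarrow> G (vs ! i) (vs ! (Suc i mod n))"
    and no_chord: "i + 2 \<le> j \<Longrightarrow> j < n \<Longrightarrow> G (vs ! i) (vs ! j) \<Longrightarrow> i = 0 \<and> Suc j = n"
begin

definition cyc :: "'v set" where "cyc = fst ` set vs"

definition pos :: "'v \<Rightarrow> nat" where "pos v = (THE i. i < n \<and> fst (vs ! i) = v)"

lemma pos_nth:
  assumes "i < n"
  shows "pos (fst (vs ! i)) = i"
  unfolding pos_def
proof (rule the_equality)
  fix l assume "l < n \<and> fst (vs ! l) = fst (vs ! i)"
  then show "l = i"
    using nth_eq_iff_index_eq[OF dist, of l i] assms by (simp flip: n_def)
qed (use assms in simp)

lemma nth_cyc: "i < n \<Longrightarrow> fst (vs ! i) \<in> cyc"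
  by (auto simp: cyc_def n_def)

lemma cyc_pos: "v \<in> cyc \<Longrightarrow> pos v < n \<and> fst (vs ! pos v) = v"
  using pos_nth by (auto simp: cyc_def in_set_conv_nth simp flip: n_def) (metis fst_conv)+

definition y :: "nat \<Rightarrow> ('v, 'k::field_char_0) polynomials" where "y i = sv (vs ! i)"

definition z :: "nat \<Rightarrow> ('v, 'k::field_char_0) polynomials" where "z i = y i - y (Suc i mod n)"

text \<open>A point lying on the hyperplanes of the cycle and on no other hyperplane, and directions
  \<open>d\<^sub>j\<close> dual to the forms \<open>z\<^sub>0, \<dots>, z\<^sub>n\<^sub>-\<^sub>2\<close>.\<close>

definition pt :: "'v \<Rightarrow> 'k::field_char_0" where
  "pt v = (if v \<in> cyc then if snd (vs ! pos v) then - 1 else 1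
     else of_nat (2 + (SOME e :: 'v \<Rightarrow> nat. inj e) v))"

definition dir :: "nat \<Rightarrow> 'v \<Rightarrow> 'k::field_char_0" where
  "dir j v = (if v \<in> cyc \<and> pos v \<le> j then if snd (vs ! pos v) then - 1 else 1 else 0)"

definition ev :: "('v, 'k::field_char_0) polynomials \<Rightarrow> 'k" where
  "ev = psubst (\<lambda>c. c) pt"

text \<open>Restriction to the line through \<open>pt\<close> in direction \<open>dir j\<close>:
  coefficient 0 is the value at the point, coefficient 1 the directional derivative.\<close>

definition jet :: "nat \<Rightarrow> ('v, 'k::field_char_0) polynomials \<Rightarrow> 'k poly" where
  "jet j = psubst (\<lambda>c. [:c:]) (\<lambda>v. [:pt v, dir j v:])"

lemma hom_const_poly: "comm_ring_1_hom (\<lambda>c::'k::field_char_0. [:c:])"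
  by unfold_locales (simp_all add: one_pCons)

sublocale ev: comm_ring_1_hom ev
  unfolding ev_def by (rule psubst_hom) (rule comm_ring_1_hom_id)

sublocale jet: comm_ring_1_hom "jet j"
  unfolding jet_def by (rule psubst_hom) (rule hom_const_poly)

lemma ev_simps: "ev (pconst c) = c" "ev (pvar v) = pt v"
  by (simp_all add: ev_def psubst_pconst psubst_pvar comm_ring_1_hom_id)

lemma jet_simps: "jet j (pconst c) = [:c:]" "jet j (pvar v) = [:pt v, dir j v:]"
  by (simp_all add: jet_def psubst_pconst psubst_pvar hom_const_poly)

lemma jet_0: "coeff (jet j f) 0 = ev f"
  by (induction f rule: polynomials_induct) (simp_all add: jet_simps ev_simps jet.homs ev.homs coeff_mult)

lemma jet_y: "i < n \<Longrightarrow> jet j (y i) = [:1, if i \<le> j then 1 else 0:]"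
  using pos_nth[of i] nth_cyc[of i]
  by (cases "vs ! i") (auto simp: y_def sv_def jet_simps jet.homs pt_def dir_def)

text \<open>Along \<open>dir j\<close> the jet of \<open>y i\<close> is \<open>1 + t\<close> up to
  position \<open>j\<close> and 1 after it, so differences arise only after position
  \<open>j\<close> and, with opposite sign, at the closing edge.\<close>

lemma jet_z:
  assumes "i < n" "j < n - 1"
  shows "jet j (z i) = (if i = j then [:0, 1:] else if i = n - 1 then [:0, - 1:] else 0)"
proof (cases "i = n - 1")
  case True
  then show ?thesis using assms n4 by (simp add: z_def jet.homs jet_y)
next
  case False
  then have "Suc i mod n = Suc i" "Suc i < n" using assms by auto
  then show ?thesis using assms False by (auto simp: z_def jet.homs jet_y)
qed

lemma ev_y: "i < n \<Longrightarrow> ev (y i) = 1"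
  by (simp add: jet_y flip: jet_0[of 0])

lemma ev_z: "i < n \<Longrightarrow> ev (z i) = 0"
  using n4 by (simp add: z_def ev.homs ev_y)

lemma z_nonzero: "i < n \<Longrightarrow> z i \<noteq> (0 :: ('v, 'k::field_char_0) polynomials)"
proof
  assume i: "i < n" "z i = (0 :: ('v, 'k) polynomials)"
  show False
  proof (cases "i = n - 1")
    case True
    then have "jet 0 (z i :: ('v, 'k) polynomials) = [:0, - 1:]" using i n4 by (subst jet_z) auto
    then show False using i by (simp add: jet.homs)
  next
    case False
    then have "jet i (z i :: ('v, 'k) polynomials) = [:0, 1:]" using i n4 by (subst jet_z) auto
    then show False using i by (simp add: jet.homs)
  qed
qed

lemma sum_z: "(\<Sum>i<n. z i) = 0"
proof -
  have n: "n = Suc (n - 1)" using n4 by simp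
  have "(\<Sum>i<n. z i) = (\<Sum>i<n - 1. z i) + z (n - 1)" by (subst n) simp
  also have "(\<Sum>i<n - 1. z i) = (\<Sum>i<n - 1. y i - y (Suc i))"
    by (intro sum.cong) (auto simp: z_def)
  also have "\<dots> = y 0 - y (n - 1)" by (rule sum_lessThan_telescope')
  also have "z (n - 1) = y (n - 1) - y 0" using n4 by (simp add: z_def)
  finally show ?thesis by simp
qed

text \<open>Plays the role of the localization at the point: hyperplanes missing the point impose
  nothing here and are restored by the factor \<open>away\<close>.\<close>

definition local_der :: "(('v, 'k::field_char_0) polynomials \<Rightarrow> ('v, 'k) polynomials) set" where
  "local_der = {\<theta>. is_derivation \<theta> \<and> (\<forall>i<n. z i dvd \<theta> (z i))}"

definition quo :: "nat \<Rightarrow> (('v, 'k::field_char_0) polynomials \<Rightarrow> ('v, 'k) polynomials) \<Rightarrow> ('v, 'k) polynomials" where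
  "quo i \<theta> = (SOME u. \<theta> (z i) = z i * u)"

lemma quo_eqI:
  assumes "i < n" "\<theta> (z i) = z i * u"
  shows "quo i \<theta> = u"
  unfolding quo_def
proof (rule some_equality)
  fix w assume "\<theta> (z i) = z i * w"
  then show "w = u" using polynomials_mult_cancel[of "z i" w u] z_nonzero[OF assms(1)] assms(2) by simp
qed (rule assms)

lemma quo:
  assumes "\<theta> \<in> local_der" "i < n"
  shows "\<theta> (z i) = z i * quo i \<theta>"
proof -
  obtain u where "\<theta> (z i) = z i * u" using assms by (auto simp: local_der_def elim: dvdE)
  moreover from this have "quo i \<theta> = u" by (intro quo_eqI assms)
  ultimately show ?thesis by simp
qed

lemma quo_add:
  assumes "\<theta> \<in> local_der" "\<eta> \<in> local_der" "i < n"
  shows "quo i (\<theta> + \<eta>) = quo i \<theta> + quo i \<eta>"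
  by (rule quo_eqI) (use assms quo[OF assms(1,3)] quo[OF assms(2,3)] in \<open>simp_all add: distrib_left\<close>)

lemma quo_scale:
  assumes "\<theta> \<in> local_der" "i < n"
  shows "quo i (der_scale f \<theta>) = f * quo i \<theta>"
  by (rule quo_eqI) (use assms quo[OF assms] in \<open>simp_all add: der_scale_def mult.left_commute\<close>)

lemma local_der_add: "\<theta> \<in> local_der \<Longrightarrow> \<eta> \<in> local_der \<Longrightarrow> \<theta> + \<eta> \<in> local_der"
  by (auto simp: local_der_def is_derivation_add)

lemma local_der_scale: "\<theta> \<in> local_der \<Longrightarrow> der_scale f \<theta> \<in> local_der"
  by (auto simp: local_der_def is_derivation_scale) (simp add: der_scale_def)

text \<open>Applying \<open>\<theta>\<close> to \<open>z\<^sub>0 + \<dots> + z\<^sub>n\<^sub>-\<^sub>1 = 0\<close> gives a syzygy of the \<open>z\<^sub>i\<close>, whose first-order part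
  says that all quotients agree at the point.\<close>

lemma jet_quo:
  assumes \<theta>: "\<theta> \<in> local_der" and j: "j < n - 1"
  shows "jet j (quo j \<theta>) = jet j (quo (n - 1) \<theta>)"
proof -
  have d: "is_derivation \<theta>" using \<theta> by (simp add: local_der_def)
  have "(\<Sum>i<n. z i * quo i \<theta>) = (\<Sum>i<n. \<theta> (z i))" by (intro sum.cong) (simp_all add: quo \<theta>)
  also have "\<dots> = \<theta> (\<Sum>i<n. z i)" by (simp add: derivation_sum d)
  also have "\<dots> = 0" by (simp add: sum_z derivation_rules d)
  finally have "jet j (\<Sum>i<n. z i * quo i \<theta>) = 0" by (simp add: jet.homs)
  then have "0 = (\<Sum>i<n. jet j (z i) * jet j (quo i \<theta>))" by (simp add: jet.homs)
  also have "\<dots> = (\<Sum>i\<in>{j, n - 1}. jet j (z i) * jet j (quo i \<theta>))"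
    by (intro sum.mono_neutral_right) (use j n4 in \<open>auto simp: jet_z\<close>)
  also have "\<dots> = [:0, 1:] * (jet j (quo j \<theta>) - jet j (quo (n - 1) \<theta>))"
    using j by (simp add: jet_z algebra_simps)
  finally show ?thesis by simp
qed

text \<open>There are \<open>card V + 1\<close> functionals, one more than a free module of derivations has generators:
  values at the point outside the cycle, the common value of the \<open>\<theta>(y\<^sub>i)\<close>, the common value of the
  quotients, and \<open>n - 1\<close> second-order terms. The latter are indexed by distinct pairs
  \<open>a < j < n - 1\<close>; there are enough of them because \<open>n \<ge> 4\<close>.\<close>

definition pair :: "nat \<Rightarrow> nat \<times> nat" where
  "pair m = (if m = n - 1 then (1, 2) else (0, m))"

definition functional ::
  "'v option \<Rightarrow> (('v, 'k::field_char_0) polynomials \<Rightarrow> ('v, 'k) polynomials) \<Rightarrow> 'k" where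
  "functional x \<theta> = (case x of None \<Rightarrow> ev (quo 0 \<theta>)
     | Some v \<Rightarrow> if v \<notin> cyc then ev (\<theta> (pvar v)) else if pos v = 0 then ev (\<theta> (y 0))
         else (case pair (pos v) of (a, j) \<Rightarrow> coeff (jet j (quo a \<theta> - quo (n - 1) \<theta>)) 1))"

text \<open>Here \<open>n \<ge> 4\<close> is decisive: the extra pair \<open>(1, 2)\<close> at
  position \<open>n - 1\<close> needs \<open>2 < n - 1\<close>.\<close>

lemma pair_bounds:
  assumes "0 < m" "m < n" "pair m = (a, j)"
  shows "a < j" "j < n - 1" "a < n" "j < n"
  using assms n4 by (auto simp: pair_def split: if_splits)

lemma index_cases:
  obtains (none) "x = None" | (out) v where "x = Some v" "v \<notin> cyc"
    | (base) v where "x = Some v" "v \<in> cyc" "pos v = 0"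
    | (pair) v a j where "x = Some v" "v \<in> cyc" "0 < pos v" "pair (pos v) = (a, j)"
proof (cases x)
  case (Some v)
  then show thesis
    using out base pair by (cases "v \<in> cyc"; cases "pos v = 0"; cases "pair (pos v)") auto
qed (use none in blast)

lemma functional_simps:
  "functional None \<theta> = ev (quo 0 \<theta>)"
  "v \<notin> cyc \<Longrightarrow> functional (Some v) \<theta> = ev (\<theta> (pvar v))"
  "v \<in> cyc \<Longrightarrow> pos v = 0 \<Longrightarrow> functional (Some v) \<theta> = ev (\<theta> (y 0))"
  "v \<in> cyc \<Longrightarrow> 0 < pos v \<Longrightarrow> pair (pos v) = (a, j) \<Longrightarrow>
    functional (Some v) \<theta> = coeff (jet j (quo a \<theta> - quo (n - 1) \<theta>)) 1"
  by (simp_all add: functional_def)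

lemma functional_add:
  assumes "\<theta> \<in> local_der" "\<eta> \<in> local_der"
  shows "functional x (\<theta> + \<eta>) = functional x \<theta> + functional x \<eta>"
proof -
  have "quo a (\<theta> + \<eta>) = quo a \<theta> + quo a \<eta>" if "a < n" for a using quo_add assms that .
  moreover have "0 < n" "n - 1 < n" using n4 by auto
  moreover have "a < n" if "v \<in> cyc" "0 < pos v" "pair (pos v) = (a, j)" for v a j
    using pair_bounds(3)[OF that(2) _ that(3)] cyc_pos[OF that(1)] by blast
  ultimately show ?thesis
    by (cases x rule: index_cases) (simp_all add: functional_simps ev.hom_add jet.hom_add jet.hom_diff)
qed

text \<open>In the second-order case the product rule would add a cross term with the derivative of
  \<open>f\<close>; it vanishes because the quotients \<open>a\<close> and \<open>n - 1\<close> have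
  the same value at the point.\<close>

lemma functional_scale:
  assumes \<theta>: "\<theta> \<in> local_der"
  shows "functional x (der_scale f \<theta>) = ev f * functional x \<theta>"
proof -
  have q: "quo a (der_scale f \<theta>) = f * quo a \<theta>" if "a < n" for a using quo_scale \<theta> that .
  have n: "0 < n" "n - 1 < n" using n4 by auto
  have key: "coeff (jet j (quo a (der_scale f \<theta>) - quo (n - 1) (der_scale f \<theta>))) 1 =
      ev f * coeff (jet j (quo a \<theta> - quo (n - 1) \<theta>)) 1"
    if "a < j" "j < n - 1" for a j
  proof -
    have a: "a < n - 1" "a < n" using that by auto
    have "ev (quo a \<theta> - quo (n - 1) \<theta>) = 0"
      using jet_quo[OF \<theta> a(1)] jet_0[of a] by (metis ev.hom_diff eq_iff_diff_eq_0)
    then have "coeff (jet j (quo a \<theta> - quo (n - 1) \<theta>)) 0 = 0" by (simp add: jet_0)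
    moreover have "jet j (quo a (der_scale f \<theta>) - quo (n - 1) (der_scale f \<theta>)) =
        jet j f * jet j (quo a \<theta> - quo (n - 1) \<theta>)"
      using q[OF a(2)] q[OF n(2)] by (metis jet.hom_mult right_diff_distrib)
    ultimately show ?thesis by (simp add: coeff_mult jet_0)
  qed
  show ?thesis
  proof (cases x rule: index_cases)
    case none
    then show ?thesis using q[OF n(1)] by (simp add: functional_simps ev.hom_mult)
  next
    case (pair v a j)
    then show ?thesis
      using key[OF pair_bounds(1,2)[OF pair(3) _ pair(4)]] cyc_pos[OF pair(2)]
      by (simp only: functional_simps)
  qed (simp_all add: functional_simps der_scale_def ev.hom_mult)
qed

lemma functional_sum:
  fixes f :: "(('v, 'k::field_char_0) polynomials \<Rightarrow> ('v, 'k) polynomials) \<Rightarrow> ('v, 'k) polynomials"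
  assumes "finite B" "B \<subseteq> local_der"
  shows "(\<Sum>b\<in>B. der_scale (f b) b) \<in> local_der \<and>
    functional x (\<Sum>b\<in>B. der_scale (f b) b) = (\<Sum>b\<in>B. ev (f b) * functional x b)"
  using assms
proof (induction B rule: finite_induct)
  case empty
  have 0: "0 \<in> (local_der :: (('v, 'k) polynomials \<Rightarrow> _) set)" by (simp add: local_der_def is_derivation_def)
  have "der_scale 0 0 = (0 :: ('v, 'k) polynomials \<Rightarrow> _)" by (simp add: der_scale_def fun_eq_iff)
  then have "functional x (0 :: ('v, 'k) polynomials \<Rightarrow> _) = 0"
    using functional_scale[OF 0, of x 0] by (simp only: ev.hom_0 mult_zero_left)
  with 0 show ?case by (simp only: sum.empty)
next
  case (insert b B)
  then have "b \<in> local_der" "(\<Sum>b\<in>B. der_scale (f b) b) \<in> local_der" by auto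
  with insert show ?case
    unfolding sum.insert[OF insert.hyps]
    by (auto simp only: insert_subset local_der_add local_der_scale functional_add functional_scale)
qed

text \<open>The \<open>y i\<close> and the variables outside the cycle are coordinates, as each
  \<open>y i\<close> is a variable up to sign; \<open>F\<close> and \<open>g\<close> prescribe the
  values on them.\<close>

definition cyc_der ::
  "(nat \<Rightarrow> ('v, 'k::field_char_0) polynomials) \<Rightarrow> ('v \<Rightarrow> ('v, 'k) polynomials) \<Rightarrow>
    ('v, 'k) polynomials \<Rightarrow> ('v, 'k) polynomials" where
  "cyc_der F g = mk_der (\<lambda>v. if v \<in> cyc then if snd (vs ! pos v) then - F (pos v) else F (pos v) else g v)"

lemma cyc_der:
  "is_derivation (cyc_der F g)" "i < n \<Longrightarrow> cyc_der F g (y i) = F i" "v \<notin> cyc \<Longrightarrow> cyc_der F g (pvar v) = g v"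
proof -
  show d: "is_derivation (cyc_der F g)" by (simp add: cyc_der_def mk_der)
  show "v \<notin> cyc \<Longrightarrow> cyc_der F g (pvar v) = g v" by (simp add: cyc_der_def mk_der)
  show "cyc_der F g (y i) = F i" if "i < n"
    using pos_nth[OF that] nth_cyc[OF that]
    by (cases "vs ! i") (auto simp: y_def sv_def derivation_rules[OF d], auto simp: cyc_der_def mk_der)
qed

lemma cyc_der_z: "i < n \<Longrightarrow> cyc_der F g (z i) = F i - F (Suc i mod n)"
  using n4 by (simp add: z_def derivation_rules[OF cyc_der(1)] cyc_der(2))

lemma cyc_der_quo:
  assumes "\<And>i. i < n \<Longrightarrow> F i - F (Suc i mod n) = z i * u i"
  shows "cyc_der F g \<in> local_der" "i < n \<Longrightarrow> quo i (cyc_der F g) = u i"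
  using assms by (auto simp: local_der_def cyc_der cyc_der_z intro: quo_eqI)

text \<open>The last case realizes the Koszul syzygy of \<open>z\<^sub>a\<close> and \<open>z\<^sub>j\<close>.\<close>

definition dual :: "'v option \<Rightarrow> ('v, 'k::field_char_0) polynomials \<Rightarrow> ('v, 'k) polynomials" where
  "dual x = (case x of None \<Rightarrow> cyc_der (\<lambda>i. y i - y 0) (\<lambda>_. 0)
     | Some v \<Rightarrow> if v \<notin> cyc then cyc_der (\<lambda>_. 0) (\<lambda>w. if w = v then 1 else 0)
         else if pos v = 0 then cyc_der (\<lambda>_. 1) (\<lambda>_. 0)
         else (case pair (pos v) of (a, j) \<Rightarrow>
           cyc_der (\<lambda>m. if a < m \<and> m \<le> j then - (z a * z j) else 0) (\<lambda>_. 0)))"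

text \<open>The values form a step function, equal to \<open>- (z a * z j)\<close> on the positions
  \<open>a + 1\<close> to \<open>j\<close>; its cyclic differences are nonzero at most at
  \<open>a\<close> and \<open>j\<close>, where they are \<open>z a * z j\<close> and its
  negative.\<close>

lemma pair_quo:
  assumes "0 < m" "m < n" "pair m = (a, j)" and i: "i < n"
  shows "(if a < i \<and> i \<le> j then - (z a * z j) else 0) -
      (if a < Suc i mod n \<and> Suc i mod n \<le> j then - (z a * z j) else 0) =
    z i * (if i = a then z j else if i = j then - z a else 0)"
proof (cases "i = n - 1")
  case True
  then show ?thesis using pair_bounds[OF assms(1-3)] i by simp
next
  case False
  then have "Suc i mod n = Suc i" using i by simp
  then show ?thesis using pair_bounds[OF assms(1-3)] by (auto simp: mult.commute)
qed

lemma dual_local_der: "dual x \<in> (local_der :: (('v, 'k::field_char_0) polynomials \<Rightarrow> _) set)"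
proof -
  show ?thesis
  proof (cases x rule: index_cases)
    case none
    then show ?thesis by (auto simp: dual_def z_def intro!: cyc_der_quo(1)[where u = "\<lambda>_. 1"])
  next
    case out
    then show ?thesis by (auto simp: dual_def intro!: cyc_der_quo(1)[where u = "\<lambda>_. 0"])
  next
    case base
    then show ?thesis by (auto simp: dual_def intro!: cyc_der_quo(1)[where u = "\<lambda>_. 0"])
  next
    case (pair v a j)
    then show ?thesis
      using cyc_der_quo(1)[OF pair_quo[of "pos v" a j]] cyc_pos[of v] by (simp add: dual_def)
  qed
qed

lemma functional_dual: "functional x (dual x') = (if x = x' then 1 else 0 :: 'k::field_char_0)"
proof -
  have n: "0 < n" "n - 1 < n" using n4 by auto
  show ?thesis
  proof (cases x' rule: index_cases)
    case none
    let ?D = "cyc_der (\<lambda>i. y i - y 0) (\<lambda>_. 0) :: ('v, 'k) polynomials \<Rightarrow> _"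
    have q: "quo i ?D = 1" if "i < n" for i
      by (rule cyc_der_quo(2)[where u = "\<lambda>_. 1"]) (use that in \<open>auto simp: z_def\<close>)
    have D: "dual x' = ?D" by (simp add: dual_def none)
    show ?thesis unfolding D
    proof (cases x rule: index_cases)
      case (pair v a j)
      then have "a < n" using pair_bounds(3)[OF pair(3) _ pair(4)] cyc_pos[OF pair(2)] by simp
      then show "functional x ?D = (if x = x' then 1 else 0)"
        using pair none q n by (simp add: functional_simps jet.hom_0)
    qed (use none q n in \<open>simp_all add: functional_simps cyc_der ev.homs\<close>)
  next
    case (out w)
    let ?D = "cyc_der (\<lambda>_. 0) (\<lambda>u. if u = w then 1 else 0) :: ('v, 'k) polynomials \<Rightarrow> _"
    have q: "quo i ?D = 0" if "i < n" for i
      by (rule cyc_der_quo(2)[where u = "\<lambda>_. 0"]) (use that in auto)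
    have D: "dual x' = ?D" by (simp add: dual_def out)
    show ?thesis unfolding D
    proof (cases x rule: index_cases)
      case (pair v a j)
      then have "a < n" using pair_bounds(3)[OF pair(3) _ pair(4)] cyc_pos[OF pair(2)] by simp
      then show "functional x ?D = (if x = x' then 1 else 0)"
        using pair out q n by (auto simp: functional_simps jet.hom_0)
    qed (use out q n in \<open>auto simp: functional_simps cyc_der ev.homs\<close>)
  next
    case (base w)
    let ?D = "cyc_der (\<lambda>_. 1) (\<lambda>_. 0) :: ('v, 'k) polynomials \<Rightarrow> _"
    have q: "quo i ?D = 0" if "i < n" for i
      by (rule cyc_der_quo(2)[where u = "\<lambda>_. 0"]) (use that in auto)
    have D: "dual x' = ?D" by (simp add: dual_def base)
    show ?thesis unfolding D
    proof (cases x rule: index_cases)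
      case (base v)
      then have "v = w" using \<open>pos w = 0\<close> \<open>w \<in> cyc\<close> cyc_pos by metis
      then show "functional x ?D = (if x = x' then 1 else 0)"
        using base \<open>x' = Some w\<close> n by (simp add: functional_simps cyc_der ev.homs)
    next
      case (pair v a j)
      then have "a < n" using pair_bounds(3)[OF pair(3) _ pair(4)] cyc_pos[OF pair(2)] by simp
      then show "functional x ?D = (if x = x' then 1 else 0)"
        using pair base q n by (auto simp: functional_simps jet.hom_0)
    qed (use base q n in \<open>auto simp: functional_simps cyc_der ev.homs\<close>)
  next
    case (pair w a' j')
    let ?F = "\<lambda>m. if a' < m \<and> m \<le> j' then - (z a' * z j') else 0 :: ('v, 'k) polynomials"
    let ?D = "cyc_der ?F (\<lambda>_. 0) :: ('v, 'k) polynomials \<Rightarrow> _"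
    have w: "pos w < n" using cyc_pos[OF pair(2)] by simp
    note b' = pair_bounds[OF pair(3) w pair(4)]
    have q: "quo i ?D = (if i = a' then z j' else if i = j' then - z a' else 0)" if "i < n" for i
      by (rule cyc_der_quo(2)[OF pair_quo[OF pair(3) w pair(4)] that])
    have D: "dual x' = ?D" using pair by (simp add: dual_def)
    show ?thesis unfolding D
    proof (cases x rule: index_cases)
      case none
      then show "functional x ?D = (if x = x' then 1 else 0)"
        using \<open>x' = Some w\<close> q[of 0] n b' by (simp add: functional_simps ev.homs ev_z)
    next
      case (out v)
      then show "functional x ?D = (if x = x' then 1 else 0)"
        using pair by (auto simp: functional_simps cyc_der ev.homs)
    next
      case (base v)
      then show "functional x ?D = (if x = x' then 1 else 0)"
        using pair n by (auto simp: functional_simps cyc_der ev.homs)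
    next
      case p: (pair v a j)
      have v: "pos v < n" using cyc_pos[OF p(2)] by simp
      note b = pair_bounds[OF p(3) v p(4)]
      have "n - 1 \<noteq> a'" "n - 1 \<noteq> j'" using b' by auto
      then have "functional x ?D = coeff (jet j (if a = a' then z j' else if a = j' then - z a' else 0)) 1"
        using p q[OF b(3)] q[OF n(2)] by (simp add: functional_simps)
      \<comment> \<open>The case \<open>a = j'\<close> contributes nothing: then
        \<open>a' < j' = a < j\<close>, so \<open>z a'\<close> has zero jet in direction
        \<open>j\<close>.\<close>
      also have "\<dots> = (if (a, j) = (a', j') then 1 else 0)"
        using b b' by (auto simp: jet.homs jet_z)
      also have "(a, j) = (a', j') \<longleftrightarrow> pair (pos v) = pair (pos w)" using p pair by simp
      also have "\<dots> \<longleftrightarrow> pos v = pos w" using p(3) pair(3) by (auto simp: pair_def split: if_splits)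
      also have "\<dots> \<longleftrightarrow> x = x'" using cyc_pos p(1,2) pair(1,2) by (metis option.inject)
      finally show "functional x ?D = (if x = x' then 1 else 0)" .
    qed
  qed
qed

text \<open>Nonzero at the point, yet divisible by every edge form that does not vanish there. The
  product of all variables covers every loop set \<open>L\<close> at once.\<close>

definition away :: "('v, 'k::field_char_0) polynomials" where
  "away = (\<Prod>(x, x')\<in>{(x, x'). ev (sv x - sv x' :: ('v, 'k) polynomials) \<noteq> 0}. sv x - sv x') * (\<Prod>v\<in>UNIV. pvar v)"

lemma pt_outside:
  assumes "v \<notin> cyc"
  shows "\<exists>m\<ge>2. pt v = (of_nat m :: 'k::field_char_0)"
  using assms by (intro exI[of _ "2 + (SOME e :: 'v \<Rightarrow> nat. inj e) v"]) (auto simp: pt_def)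

lemma pt_inj:
  assumes "v \<notin> cyc" "w \<notin> cyc" "pt v = (pt w :: 'k::field_char_0)"
  shows "v = w"
proof -
  have "\<exists>e :: 'v \<Rightarrow> nat. inj e" using finite_imp_inj_to_nat_seg[of "UNIV :: 'v set"] by auto
  then have "inj (SOME e :: 'v \<Rightarrow> nat. inj e)" by (rule someI_ex)
  then show ?thesis using assms by (simp add: pt_def inj_eq)
qed

lemma pt_nonzero: "pt v \<noteq> (0 :: 'k::field_char_0)"
proof (cases "v \<in> cyc")
  case False
  then obtain m where "2 \<le> m" "pt v = (of_nat m :: 'k)" using pt_outside by blast
  then show ?thesis by simp
qed (simp add: pt_def)

lemma ev_away: "ev away \<noteq> (0 :: 'k::field_char_0)"
  unfolding away_def by (auto simp: ev.hom_mult ev.hom_prod ev_simps pt_nonzero split: prod.splits)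

lemma sv_dvd_away: "ev (sv x - sv x') \<noteq> (0 :: 'k::field_char_0) \<Longrightarrow> sv x - sv x' dvd (away :: ('v, 'k) polynomials)"
  unfolding away_def
  by (intro dvd_mult2) (rule dvd_prodI[of _ "(x, x')" "\<lambda>(x, x'). sv x - sv x'", simplified], auto)

lemma pvar_dvd_away: "pvar v dvd (away :: ('v, 'k::field_char_0) polynomials)"
  unfolding away_def by (intro dvd_mult dvd_prodI) auto

lemma pt_pm_eq:
  assumes "pt v = (pt w :: 'k::field_char_0) \<or> pt v = - (pt w :: 'k)" "v \<noteq> w"
  shows "v \<in> cyc" "w \<in> cyc"
proof -
  have of_nat_neg: "of_nat a \<noteq> - (of_nat b :: 'k)" if "2 \<le> a" for a b
  proof
    assume "of_nat a = - (of_nat b :: 'k)"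
    then have "of_nat (a + b) = (0 :: 'k)" by simp
    then show False using that by (simp only: of_nat_eq_0_iff)
  qed
  have mixed: False if vw: "v \<notin> cyc" "w \<in> cyc" "pt v = (pt w :: 'k) \<or> pt v = - (pt w :: 'k)" for v w
  proof -
    obtain m where m: "2 \<le> m" "pt v = (of_nat m :: 'k)" using pt_outside[OF vw(1)] by blast
    have "pt v = (1 :: 'k) \<or> pt v = (- 1 :: 'k)" using vw(2,3) by (auto simp: pt_def split: if_splits)
    then show False using m of_nat_neg[OF m(1), of 1] of_nat_eq_iff[of m 1, where 'a='k] by auto
  qed
  have both: False if vw: "v \<notin> cyc" "w \<notin> cyc"
  proof -
    obtain m m' where "2 \<le> m" "pt v = (of_nat m :: 'k)" "pt w = (of_nat m' :: 'k)"
      using pt_outside vw by metis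
    then have "pt v \<noteq> - (pt w :: 'k)" using of_nat_neg by simp
    then show False using assms pt_inj[OF vw] by blast
  qed
  show "v \<in> cyc" "w \<in> cyc"
    using mixed[of v w] mixed[of w v] both assms(1) by (metis minus_minus)+
qed

lemma sv_cyc:
  assumes "fst x \<in> cyc"
  obtains i where "i < n" "x = vs ! i" "sv x = (y i :: ('v, 'k::field_char_0) polynomials)" |
    i where "i < n" "x = (fst (vs ! i), \<not> snd (vs ! i))" "sv x = - (y i :: ('v, 'k) polynomials)"
proof -
  obtain i where i: "i < n" "fst (vs ! i) = fst x" using cyc_pos[OF assms] by blast
  show thesis
  proof (cases "snd x = snd (vs ! i)")
    case True
    then have "x = vs ! i" using i by (simp add: prod_eq_iff)
    then show thesis using that(1)[OF i(1)] by (simp add: y_def)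
  next
    case False
    then have "x = (fst (vs ! i), \<not> snd (vs ! i))" using i by (auto simp: prod_eq_iff)
    moreover from this have "sv x = - (y i :: ('v, 'k) polynomials)"
      using sv_flip[of "fst (vs ! i)" "snd (vs ! i)"] by (simp add: y_def)
    ultimately show thesis using that(2)[OF i(1)] by blast
  qed
qed

lemma cycle_edge_z:
  assumes ij: "i < n" "j < n" and G: "G (vs ! i) (vs ! j)"
  shows "\<exists>l<n. y i - y j = (z l :: ('v, 'k::field_char_0) polynomials) \<or> y i - y j = - (z l :: ('v, 'k) polynomials)"
proof -
  have *: "\<exists>l<n. y i - y j = (z l :: ('v, 'k) polynomials) \<or> y i - y j = - (z l :: ('v, 'k) polynomials)"
    if "i < j" "j < n" "G (vs ! i) (vs ! j)" for i j
  proof (cases "j = Suc i")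
    case True
    then have "y i - y j = (z i :: ('v, 'k) polynomials)" using that by (simp add: z_def)
    then show ?thesis using that by (intro exI[of _ i]) simp
  next
    case False
    then have "i = 0 \<and> Suc j = n" using no_chord[of i j] that by auto
    then have "y i - y j = - (z j :: ('v, 'k) polynomials)" by (auto simp: z_def)
    then show ?thesis using that by (intro exI[of _ j]) simp
  qed
  consider "i < j" | "j < i" | "i = j" by linarith
  then show ?thesis
  proof cases
    case 1
    then show ?thesis using * ij G by blast
  next
    case 2
    then obtain l where l: "l < n" "y j - y i = (z l :: ('v, 'k) polynomials) \<or> y j - y i = - (z l :: ('v, 'k) polynomials)"
      using *[of j i] ij G_sym[OF G] by blast
    have "y i - y j = - (y j - y i :: ('v, 'k) polynomials)" by simp
    then show ?thesis using l by (metis minus_minus)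
  next
    case 3
    then show ?thesis using G_P[OF G] P_irrefl by simp
  qed
qed

text \<open>At the point the lifts in \<open>vs\<close> have value 1 and the opposite lifts value
  -1, so an edge through it joins two lifts of the same kind. After changing both sheets if
  necessary, \<open>no_chord\<close> makes it an edge of the cycle.\<close>

lemma edge_through_pt:
  assumes G: "G x x'" and ev0: "ev (sv x - sv x') = (0 :: 'k::field_char_0)"
  shows "\<exists>l<n. sv x - sv x' = (z l :: ('v, 'k) polynomials) \<or> sv x - sv x' = - (z l :: ('v, 'k) polynomials)"
proof -
  have neq: "fst x \<noteq> fst x'" using G_P[OF G] P_neq by blast
  have eq: "ev (sv x) = (ev (sv x') :: 'k)" using ev0 by (simp add: ev.hom_diff)
  have "ev (sv u) = (pt (fst u) :: 'k) \<or> ev (sv u) = - (pt (fst u) :: 'k)" for u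
    by (cases u) (auto simp: sv_def ev_simps ev.homs)
  then have "pt (fst x) = (pt (fst x') :: 'k) \<or> pt (fst x) = - (pt (fst x') :: 'k)"
    using eq by (metis minus_minus)
  from pt_pm_eq[OF this neq] have cyc: "fst x \<in> cyc" "fst x' \<in> cyc" .
  have ev1: "ev (y i) = (1 :: 'k)" "ev (- y i) = (- 1 :: 'k)" if "i < n" for i
    using ev_y that by (simp_all add: ev.hom_uminus)
  show ?thesis
  proof (rule sv_cyc[OF cyc(1), where 'k = 'k]; rule sv_cyc[OF cyc(2), where 'k = 'k])
    fix i j assume i: "i < n" "x = vs ! i" "sv x = (y i :: ('v, 'k) polynomials)"
      and j: "j < n" "x' = vs ! j" "sv x' = (y j :: ('v, 'k) polynomials)"
    show ?thesis unfolding i(3) j(3) by (rule cycle_edge_z) (use i j G in auto)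
  next
    fix i j assume i: "i < n" "x = (fst (vs ! i), \<not> snd (vs ! i))" "sv x = - (y i :: ('v, 'k) polynomials)"
      and j: "j < n" "x' = (fst (vs ! j), \<not> snd (vs ! j))" "sv x' = - (y j :: ('v, 'k) polynomials)"
    have "G (vs ! i) (vs ! j)" using G i(2) j(2) by (auto simp: G_def split: if_splits)
    then have *: "\<exists>l<n. y i - y j = (z l :: ('v, 'k) polynomials) \<or> y i - y j = - (z l :: ('v, 'k) polynomials)"
      using i(1) j(1) by (intro cycle_edge_z)
    have "sv x - sv x' = - (y i - y j :: ('v, 'k) polynomials)" using i j by simp
    then show ?thesis using * by (metis minus_minus)
  qed (use eq ev1 in auto)
qed

lemma not_free:
  assumes simple: "simple_edges Gp" "simple_edges Gn"
    and PN: "\<And>u v. P u v \<longleftrightarrow> {u, v} \<in> Gp" "\<And>u v. N u v \<longleftrightarrow> {u, v} \<in> Gn"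
  shows "\<not> free_arrangement (signed_arrangement Gp Gn L :: ('k::field_char_0 ^ 'v) set set)"
proof
  let ?D = "log_derivations (signed_arrangement Gp Gn L :: ('k ^ 'v) set set)"
  assume "free_arrangement (signed_arrangement Gp Gn L :: ('k ^ 'v) set set)"
  then obtain B where B: "der.independent B" "der.span B = ?D" by (auto simp: free_arrangement_def)
  have log: "\<theta> \<in> ?D \<longleftrightarrow> is_derivation \<theta> \<and>
      (\<forall>x x'. G x x' \<longrightarrow> sv x - sv x' dvd \<theta> (sv x - sv x')) \<and> (\<forall>v\<in>L. pvar v dvd \<theta> (pvar v))" for \<theta>
  proof (cases "is_derivation \<theta>")
    case True
    have "(\<forall>x x'. G x x' \<longrightarrow> sv x - sv x' dvd \<theta> (sv x - sv x')) \<longleftrightarrow>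
      (\<forall>i j. P i j \<longrightarrow> pvar i - pvar j dvd \<theta> (pvar i) - \<theta> (pvar j)) \<and>
      (\<forall>i j. N i j \<longrightarrow> pvar i + pvar j dvd \<theta> (pvar i) + \<theta> (pvar j))" (is "?l \<longleftrightarrow> ?r")
    proof
      assume l: ?l
      show ?r
      proof (intro conjI allI impI)
        fix i j
        show "pvar i - pvar j dvd \<theta> (pvar i) - \<theta> (pvar j)" if "P i j"
          using l[rule_format, of "(i, False)" "(j, False)"] that by (simp add: derivation_rules[OF True])
        show "pvar i + pvar j dvd \<theta> (pvar i) + \<theta> (pvar j)" if "N i j"
          using l[rule_format, of "(i, False)" "(j, True)"] that by (simp add: derivation_rules[OF True])
      qed
    next
      assume r: ?r
      show ?l
      proof (intro allI impI)
        fix x x' assume G: "G x x'"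
        obtain i a j b where x: "x = (i, a)" "x' = (j, b)" by (cases x; cases x')
        have neg: "- d dvd \<theta> (- d)" if "d dvd \<theta> d" for d
          using that by (simp add: derivation_rules[OF True])
        have "pvar i - pvar j dvd \<theta> (pvar i - pvar j)" if "P i j"
          using r that by (simp add: derivation_rules[OF True])
        moreover have "pvar i + pvar j dvd \<theta> (pvar i + pvar j)" if "N i j"
          using r that by (simp add: derivation_rules[OF True])
        ultimately show "sv x - sv x' dvd \<theta> (sv x - sv x')"
          using neg[of "pvar i - pvar j"] neg[of "pvar i + pvar j"] G
          by (cases a; cases b) (auto simp: x)
      qed
    qed
    then show ?thesis unfolding log_derivations_signed_arrangement[OF simple] PN by blast
  qed (simp add: log_derivations_signed_arrangement[OF simple])
  have BD: "b \<in> ?D" if "b \<in> B" for b using der.span_base[OF that] B(2) by simp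
  have finB: "finite B" "card B \<le> CARD('v)"
    using independent_derivations_card[OF B(1)] BD log by blast+
  have Bloc: "B \<subseteq> local_der"
  proof
    fix b assume "b \<in> B"
    then have b: "b \<in> ?D" by (rule BD)
    have "z i dvd b (z i)" if "i < n" for i
      using b edge[OF that] unfolding log z_def y_def by blast
    then show "b \<in> local_der" using b log by (simp add: local_der_def)
  qed
  have "\<forall>x. \<exists>f. der_scale away (dual x) = (\<Sum>b\<in>B. der_scale (f b) b)"
  proof
    fix x
    have dl: "dual x \<in> (local_der :: (('v, 'k) polynomials \<Rightarrow> _) set)" by (rule dual_local_der)
    then have d: "is_derivation (dual x :: ('v, 'k) polynomials \<Rightarrow> _)" by (simp add: local_der_def)
    have "der_scale away (dual x) \<in> ?D"
      unfolding log
    proof (intro conjI allI impI ballI)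
      show "is_derivation (der_scale away (dual x :: ('v, 'k) polynomials \<Rightarrow> _))"
        by (rule is_derivation_scale[OF d])
      show "pvar v dvd der_scale away (dual x) (pvar v :: ('v, 'k) polynomials)" for v
        unfolding der_scale_def by (rule dvd_mult2[OF pvar_dvd_away])
      fix u u' assume G: "G u u'"
      show "sv u - sv u' dvd der_scale away (dual x) (sv u - sv u' :: ('v, 'k) polynomials)"
      proof (cases "ev (sv u - sv u') = (0 :: 'k)")
        case False
        then show ?thesis unfolding der_scale_def by (intro dvd_mult2 sv_dvd_away)
      next
        case True
        then obtain l where l: "l < n" "sv u - sv u' = (z l :: ('v, 'k) polynomials) \<or> sv u - sv u' = - (z l :: ('v, 'k) polynomials)"
          using edge_through_pt[OF G] by blast
        have "z l dvd dual x (z l :: ('v, 'k) polynomials)" using dl l by (simp add: local_der_def)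
        then have "sv u - sv u' dvd dual x (sv u - sv u' :: ('v, 'k) polynomials)"
          using l(2) by (elim disjE) (simp_all only: derivation_rules(5)[OF d] minus_dvd_iff dvd_minus_iff)
        then show ?thesis by (simp add: der_scale_def)
      qed
    qed
    then show "\<exists>f. der_scale away (dual x) = (\<Sum>b\<in>B. der_scale (f b) b)"
      unfolding B(2)[symmetric] der.span_finite[OF finB(1)] by (auto simp only: image_iff)
  qed
  from choice[OF this]
  obtain f where f: "\<And>x. der_scale away (dual x) = (\<Sum>b\<in>B. der_scale (f x b) b)" by blast
  \<comment> \<open>The \<open>CARD('v) + 1\<close> derivations \<open>away * dual x\<close> have
    only \<open>card B\<close> coordinates, so the values of these coordinates at the point are
    linearly dependent; the functionals, seeing only these values, would be unable to separate the
    derivations.\<close>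
  have "\<exists>c. (\<exists>x\<in>UNIV. c x \<noteq> 0) \<and> (\<forall>b\<in>B. (\<Sum>x\<in>(UNIV :: 'v option set). c x * ev (f x b)) = 0)"
    by (rule rank_bound) (use finB in \<open>simp_all add: card_UNIV_option\<close>)
  then obtain c x0 where c: "c x0 \<noteq> 0" "\<And>b. b \<in> B \<Longrightarrow> (\<Sum>x\<in>UNIV. c x * ev (f x b)) = 0" by blast
  have "ev away * (if x0 = x then 1 else 0) = (\<Sum>b\<in>B. ev (f x b) * functional x0 b)" for x
  proof -
    have "functional x0 (der_scale away (dual x)) = ev away * (if x0 = x then 1 else 0 :: 'k)"
      by (subst functional_scale[OF dual_local_der]) (simp only: functional_dual)
    then show ?thesis unfolding f using functional_sum[OF finB(1) Bloc, of "f x" x0] by (simp only:)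
  qed
  then have "(\<Sum>x\<in>UNIV. c x * (ev away * (if x0 = x then 1 else 0))) =
      (\<Sum>x\<in>UNIV. c x * (\<Sum>b\<in>B. ev (f x b) * functional x0 b))" by simp
  also have "\<dots> = (\<Sum>b\<in>B. (\<Sum>x\<in>UNIV. c x * ev (f x b)) * functional x0 b)"
    unfolding sum_distrib_left sum_distrib_right by (subst sum.swap) (simp add: mult.assoc)
  also have "\<dots> = 0" using c(2) by simp
  finally have "c x0 * ev away = 0" by (simp add: if_distrib cong: if_cong)
  then show False using c(1) ev_away[where 'k = 'k] by simp
qed

end

section \<open>Balanced cycles and the double cover\<close>

definition sign_of :: "bool \<Rightarrow> bool \<Rightarrow> sign" where
  "sign_of a b = (if a = b then Pos else Neg)"

abbreviation num_neg :: "sign list \<Rightarrow> nat" where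
  "num_neg ss \<equiv> length (filter (\<lambda>s. s = Neg) ss)"

lemma even_num_neg_switches:
  "i \<le> j \<Longrightarrow> even (num_neg (map (\<lambda>k. sign_of (t k) (t (Suc k))) [i..<j])) \<longleftrightarrow> t i = t j"
proof (induction j)
  case (Suc j)
  then show ?case by (cases "i = Suc j") (auto simp: sign_of_def)
qed simp

lemma odd_num_neg_take_Suc:
  "i < length ss \<Longrightarrow> ss ! i = sign_of (odd (num_neg (take i ss))) (odd (num_neg (take (Suc i) ss)))"
  by (cases "ss ! i") (auto simp: take_Suc_conv_app_nth sign_of_def)

context signed_graph
begin

lemma G_signed_edges:
  assumes PN: "\<And>u v. P u v \<longleftrightarrow> {u, v} \<in> Gp" "\<And>u v. N u v \<longleftrightarrow> {u, v} \<in> Gn"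
  shows "({u, v}, sign_of a b) \<in> signed_edges Gp Gn \<longleftrightarrow> G (u, a) (v, b)"
  by (auto simp: signed_edges_def sign_of_def G_def PN)

lemma chord_of_balanced_chordal:
  assumes PN: "\<And>u v. P u v \<longleftrightarrow> {u, v} \<in> Gp" "\<And>u v. N u v \<longleftrightarrow> {u, v} \<in> Gn"
    and chordal: "balanced_chordal Gp Gn"
    and vs: "4 \<le> length vs" "distinct (map fst vs)" "successively G vs" "G (last vs) (hd vs)"
  shows "\<exists>i j. i + 2 \<le> j \<and> j < length vs \<and> \<not> (i = 0 \<and> Suc j = length vs) \<and> G (vs ! i) (vs ! j)"
proof -
  let ?n = "length vs"
  \<comment> \<open>Indexing modulo the length makes the sheet changes around the cycle telescope to
    zero, which is the balance of the projected cycle.\<close>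
  define t where "t k = snd (vs ! (k mod ?n))" for k
  define ss where "ss = map (\<lambda>k. sign_of (t k) (t (Suc k))) [0..<?n]"
  let ?us = "map fst vs"
  have n: "0 < ?n" using vs(1) by linarith
  have G: "G (vs ! i) (vs ! (Suc i mod ?n))" if "i < ?n" for i
  proof (cases "Suc i = ?n")
    case True
    moreover have "vs \<noteq> []" using n by auto
    ultimately have "vs ! i = last vs" "vs ! (Suc i mod ?n) = hd vs"
      by (simp_all add: last_conv_nth hd_conv_nth True[symmetric])
    then show ?thesis using vs(4) by simp
  next
    case False
    then show ?thesis using that vs(3) by (simp add: successively_conv_nth)
  qed
  have len: "length ss = ?n" by (simp add: ss_def)
  have "cycle_edge ?us ss i \<in> signed_edges Gp Gn" if "i < ?n" for i
    using G[OF that] that n G_signed_edges[OF PN, of "fst (vs ! i)" "fst (vs ! (Suc i mod ?n))"]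
    by (simp add: cycle_edge_def ss_def t_def)
  then have "is_cycle Gp Gn ?us ss" using vs(1,2) by (simp add: is_cycle_def len)
  moreover have "even (num_neg ss)"
    unfolding ss_def even_num_neg_switches[OF le0] by (simp add: t_def)
  ultimately have "balanced_cycle Gp Gn ?us ss" by (simp add: balanced_cycle_def)
  moreover have "4 \<le> length ?us" using vs(1) by simp
  ultimately obtain i j s where c: "balanced_chord Gp Gn ?us ss i j s"
    using chordal unfolding balanced_chordal_def by metis
  then have ij: "i < j" "j < ?n" by (simp_all add: balanced_chord_def)
  have in1: "balanced_cycle Gp Gn (take (j - i + 1) (drop i ?us)) (take (j - i) (drop i ss) @ [s])"
    and in2: "balanced_cycle Gp Gn (take (i + 1) ?us @ drop j ?us) (take i ss @ [s] @ drop j ss)"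
    using c by (simp_all add: balanced_chord_def)
  have "3 \<le> length (take (j - i + 1) (drop i ?us))" using in1 unfolding balanced_cycle_def is_cycle_def by blast
  then have 1: "i + 2 \<le> j" using ij by simp
  have "3 \<le> length (take (i + 1) ?us @ drop j ?us)" using in2 unfolding balanced_cycle_def is_cycle_def by blast
  then have 2: "\<not> (i = 0 \<and> Suc j = ?n)" using ij by auto
  \<comment> \<open>The parity of one of the two parts determines the sign of the chord as the one
    relating the sheets of its ends, so the chord lifts to an edge of \<open>G\<close>.\<close>
  have "take (j - i) (drop i ss) = map (\<lambda>k. sign_of (t k) (t (Suc k))) [i..<j]"
    using ij by (simp add: ss_def drop_map take_map)
  moreover have "even (num_neg (take (j - i) (drop i ss) @ [s]))" using in1 unfolding balanced_cycle_def by blast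
  ultimately have "s = sign_of (t i) (t j)"
    using even_num_neg_switches[of i j t] ij by (cases s) (auto simp: sign_of_def)
  moreover have "({?us ! i, ?us ! j}, s) \<in> signed_edges Gp Gn" using c unfolding balanced_chord_def by blast
  ultimately have "G (vs ! i) (vs ! j)"
    using ij G_signed_edges[OF PN, of "fst (vs ! i)" "fst (vs ! j)" "snd (vs ! i)" "snd (vs ! j)"]
    by (simp add: t_def)
  with 1 2 ij show ?thesis by blast
qed

lemma chordless_cycle_of_not_balanced_chordal:
  assumes PN: "\<And>u v. P u v \<longleftrightarrow> {u, v} \<in> Gp" "\<And>u v. N u v \<longleftrightarrow> {u, v} \<in> Gn"
    and "\<not> balanced_chordal Gp Gn"
  obtains vs where "4 \<le> length vs" "distinct (map fst vs)"
    "\<And>i. i < length vs \<Longrightarrow> G (vs ! i) (vs ! (Suc i mod length vs))"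
    "\<And>i j. i + 2 \<le> j \<Longrightarrow> j < length vs \<Longrightarrow> G (vs ! i) (vs ! j) \<Longrightarrow> i = 0 \<and> Suc j = length vs"
proof -
  obtain us ss where c: "balanced_cycle Gp Gn us ss" and n4: "4 \<le> length us"
    and none: "\<And>i j s. \<not> balanced_chord Gp Gn us ss i j s"
    using assms(3) by (auto simp: balanced_chordal_def)
  let ?n = "length us"
  have len: "length ss = ?n" and dist: "distinct us" and ev: "even (num_neg ss)"
    and edge: "\<And>i. i < ?n \<Longrightarrow> cycle_edge us ss i \<in> signed_edges Gp Gn"
    using c by (auto simp: balanced_cycle_def is_cycle_def)
  \<comment> \<open>The sheet of a position is the parity of the negative edges before it; balance
    makes this close up at the end of the cycle.\<close>
  define t where "t i = odd (num_neg (take i ss))" for i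
  define vs where "vs = map (\<lambda>i. (us ! i, t i)) [0..<?n]"
  have nth: "vs ! i = (us ! i, t i)" if "i < ?n" for i using that by (simp add: vs_def)
  have lvs: "length vs = ?n" by (simp add: vs_def)
  have tn: "t ?n = t 0" using ev len by (simp add: t_def)
  have ss_nth: "ss ! i = sign_of (t i) (t (Suc i mod ?n))" if "i < ?n" for i
    using odd_num_neg_take_Suc[of i ss] that tn len by (cases "Suc i = ?n") (auto simp: t_def)
  have mod_lt: "Suc i mod ?n < ?n" for i using n4 by (intro mod_less_divisor) linarith
  have "G (vs ! i) (vs ! (Suc i mod ?n))" if "i < ?n" for i
    using edge[OF that] mod_lt[of i] that
    by (simp add: cycle_edge_def ss_nth nth G_signed_edges[OF PN])
  moreover have "map fst vs = us" by (simp add: vs_def comp_def map_nth)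
  moreover have False
    if ij: "i + 2 \<le> j" "j < ?n" "\<not> (i = 0 \<and> Suc j = ?n)" and G: "G (vs ! i) (vs ! j)" for i j
  proof -
    let ?s = "sign_of (t i) (t j)"
    let ?w = "take (j - i + 1) (drop i us)" and ?u = "take (j - i) (drop i ss) @ [?s]"
    let ?w' = "take (i + 1) us @ drop j us" and ?u' = "take i ss @ [?s] @ drop j ss"
    have e: "({us ! i, us ! j}, ?s) \<in> signed_edges Gp Gn"
      using G ij by (simp add: nth G_signed_edges[OF PN])
    have notin: "({us ! i, us ! j}, ?s) \<notin> cycle_edge us ss ` {..<?n}"
    proof
      assume "({us ! i, us ! j}, ?s) \<in> cycle_edge us ss ` {..<?n}"
      then obtain k where k: "k < ?n" "{us ! i, us ! j} = {us ! k, us ! (Suc k mod ?n)}"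
        by (auto simp: cycle_edge_def)
      then have "i = k \<and> j = Suc k mod ?n \<or> i = Suc k mod ?n \<and> j = k"
        using ij mod_lt[of k] dist by (auto simp: doubleton_eq_iff nth_eq_iff_index_eq)
      then show False using ij k(1) by (cases "Suc k = ?n") auto
    qed
    have parity: "even (num_neg (take (j - i) (drop i ss))) \<longleftrightarrow> t i = t j"
    proof -
      have "take j ss = take i ss @ take (j - i) (drop i ss)"
        using ij by (metis add_diff_inverse_nat add_leE not_less take_add)
      then show ?thesis by (auto simp: t_def)
    qed
    have 1: "balanced_cycle Gp Gn ?w ?u"
      unfolding balanced_cycle_def is_cycle_def
    proof (intro conjI allI impI)
      show "3 \<le> length ?w" "length ?u = length ?w" using ij len by auto
      show "distinct ?w" using dist by (simp add: distinct_take distinct_drop)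
      show "even (num_neg ?u)" using parity by (simp add: sign_of_def)
      fix k assume k: "k < length ?w"
      then have kl: "k < j - i + 1" "length ?w = j - i + 1" using ij by auto
      show "cycle_edge ?w ?u k \<in> signed_edges Gp Gn"
      proof (cases "k = j - i")
        case True
        then have "cycle_edge ?w ?u k = ({us ! j, us ! i}, ?s)"
          using ij kl len by (auto simp: cycle_edge_def nth_append min_def)
        then show ?thesis using e by (simp add: insert_commute)
      next
        case False
        then have "cycle_edge ?w ?u k = cycle_edge us ss (i + k)"
          using ij kl len by (auto simp: cycle_edge_def nth_append min_def)
        then show ?thesis using edge[of "i + k"] False kl ij by simp
      qed
    qed
    have 2: "balanced_cycle Gp Gn ?w' ?u'"
      unfolding balanced_cycle_def is_cycle_def
    proof (intro conjI allI impI)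
      show "3 \<le> length ?w'" "length ?u' = length ?w'" using ij len by auto
      show "distinct ?w'"
        using dist ij set_take_disj_set_drop_if_distinct[of us "i + 1" j]
        by (simp add: distinct_take distinct_drop)
      have "even (num_neg (take j ss) + num_neg (drop j ss))"
        using ev by (metis append_take_drop_id filter_append length_append)
      then have "even (num_neg (drop j ss)) \<longleftrightarrow> \<not> t j" by (simp add: t_def)
      then show "even (num_neg ?u')" by (auto simp: sign_of_def t_def)
      fix k assume k: "k < length ?w'"
      have lw: "length ?w' = i + 1 + (?n - j)" using ij by simp
      consider "k < i" | "k = i" | "i < k" by linarith
      then show "cycle_edge ?w' ?u' k \<in> signed_edges Gp Gn"
      proof cases
        case 1
        then have "cycle_edge ?w' ?u' k = cycle_edge us ss k"
          using ij len lw by (auto simp: cycle_edge_def nth_append min_def)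
        then show ?thesis using edge[of k] 1 ij by simp
      next
        case 2
        then have "cycle_edge ?w' ?u' k = ({us ! i, us ! j}, ?s)"
          using ij len lw by (auto simp: cycle_edge_def nth_append min_def)
        then show ?thesis using e by simp
      next
        case 3
        let ?k = "k - i - 1 + j"
        have kk: "?k < ?n" using k lw 3 ij by linarith
        have "?w' ! k = us ! ?k" using 3 ij kk by (simp add: nth_append min_def add.commute)
        moreover have "?u' ! k = ss ! ?k" using 3 ij kk len by (simp add: nth_append min_def add.commute)
        moreover have "?w' ! (Suc k mod length ?w') = us ! (Suc ?k mod ?n)"
        proof (cases "Suc k = length ?w'")
          case True
          then have "Suc ?k = ?n" using 3 ij lw by linarith
          then have "Suc ?k mod ?n = 0" by (simp only: mod_self)
          moreover have "Suc k mod length ?w' = 0" unfolding True by (rule mod_self)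
          moreover have "?w' ! 0 = us ! 0" using ij by (simp add: nth_append)
          ultimately show ?thesis by (simp only:)
        next
          case False
          then have "Suc k < length ?w'" "Suc ?k < ?n" using k lw 3 ij by linarith+
          moreover have "?w' ! Suc k = us ! (Suc k - (i + 1) + j)"
            using 3 ij by (simp add: nth_append min_def add.commute)
          moreover have "Suc k - (i + 1) + j = Suc ?k" using 3 by simp
          ultimately show ?thesis by (simp only: mod_less)
        qed
        ultimately have "cycle_edge ?w' ?u' k = cycle_edge us ss ?k" by (simp only: cycle_edge_def)
        then show ?thesis using edge[OF kk] by simp
      qed
    qed
    have "balanced_chord Gp Gn us ss i j ?s"
      unfolding balanced_chord_def using e notin 1 2 ij by simp
    then show False using none by blast
  qed
  ultimately show thesis using that[of vs] n4 dist lvs by metis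
qed

end

section \<open>Paths in the double cover\<close>

locale chordal_signed_graph = signed_graph P N for P N :: "'v::finite \<Rightarrow> 'v \<Rightarrow> bool" +
  assumes chord: "4 \<le> length vs \<Longrightarrow> distinct (map fst vs) \<Longrightarrow> successively G vs \<Longrightarrow> G (last vs) (hd vs) \<Longrightarrow>
    \<exists>i j. i + 2 \<le> j \<and> j < length vs \<and> \<not> (i = 0 \<and> Suc j = length vs) \<and> G (vs ! i) (vs ! j)"
begin

text \<open>An interior vertex is required, so that an edge joining the ends, which is what the
  lemmas below derive, is not itself such a path.\<close>

definition via :: "'v set \<Rightarrow> 'v \<times> bool \<Rightarrow> 'v \<times> bool \<Rightarrow> ('v \<times> bool) list \<Rightarrow> bool" where
  "via A x y L \<longleftrightarrow> 3 \<le> length L \<and> distinct (map fst L) \<and> successively G L \<and>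
     L ! 0 = x \<and> L ! (length L - 1) = y \<and> (\<forall>i. 0 < i \<longrightarrow> Suc i < length L \<longrightarrow> fst (L ! i) \<in> A)"

text \<open>A lifted path changes sheets exactly at its negative edges.\<close>

definition odd_via :: "'v set \<Rightarrow> 'v \<Rightarrow> 'v \<Rightarrow> bool" where
  "odd_via A p q \<longleftrightarrow> (\<exists>L. via A (p, False) (q, True) L)"

lemma viaI:
  assumes "M \<noteq> []" "fst ` set M \<subseteq> A" "distinct (map fst (x # M @ [y]))" "successively G (x # M @ [y])"
  shows "via A x y (x # M @ [y])"
proof -
  have "fst ((x # M @ [y]) ! i) \<in> A" if "0 < i" "Suc i < length (x # M @ [y])" for i
    using that assms(2) by (cases i) (auto simp: nth_append)
  then show ?thesis using assms unfolding via_def by (auto simp: Suc_le_eq nth_append)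
qed

lemma viaE:
  assumes "via A x y L"
  obtains M where "L = x # M @ [y]" "M \<noteq> []" "fst ` set M \<subseteq> A"
proof -
  from assms have len: "3 \<le> length L" by (simp add: via_def)
  then obtain a M b where L: "L = a # M @ [b]"
    by (metis Suc_le_length_iff numeral_3_eq_3 append_butlast_last_id list.distinct(1))
  then have "M \<noteq> []" using len by auto
  moreover have "a = x" "b = y" using assms L by (auto simp: via_def nth_append)
  moreover have "fst ` set M \<subseteq> A"
  proof safe
    fix u c assume "(u, c) \<in> set M"
    then obtain i where "i < length M" "M ! i = (u, c)" by (auto simp: in_set_conv_nth)
    then have "L ! Suc i = (u, c)" "Suc (Suc i) < length L" by (auto simp: L nth_append)
    then show "fst (u, c) \<in> A" using assms unfolding via_def by (metis zero_less_Suc)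
  qed
  ultimately show thesis using L that by blast
qed

lemma via_mono: "via A x y L \<Longrightarrow> A \<subseteq> B \<Longrightarrow> via B x y L"
  by (auto simp: via_def)

lemma via_rev:
  assumes "via A x y L" shows "via A y x (rev L)"
proof -
  have "successively G (rev L)"
    unfolding successively_rev
    by (rule successively_mono[of G]) (use assms G_sym in \<open>auto simp only: via_def\<close>)
  moreover have "fst (rev L ! i) \<in> A" if "0 < i" "Suc i < length L" for i
    using assms that by (auto simp: via_def rev_nth)
  moreover have "0 < length L" using assms by (auto simp: via_def)
  then have "rev L ! 0 = L ! (length L - 1)" "rev L ! (length L - 1) = L ! 0"
    by (simp_all add: rev_nth)
  ultimately show ?thesis using assms unfolding via_def by (auto simp: rev_map[symmetric])
qed

lemma via_flip:
  assumes "via A (u, a) (v, b) L"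
  shows "via A (u, \<not> a) (v, \<not> b) (map (\<lambda>(w, c). (w, \<not> c)) L)"
proof -
  have "G (case x of (w, c) \<Rightarrow> (w, \<not> c)) (case y of (w, c) \<Rightarrow> (w, \<not> c)) \<longleftrightarrow> G x y" for x y
    by (cases x; cases y) (simp add: G_def)
  moreover have "fst \<circ> (\<lambda>(w, c). (w, \<not> c)) = (fst :: 'v \<times> bool \<Rightarrow> 'v)" by auto
  moreover have "fst (case x of (w, c) \<Rightarrow> (w, \<not> c)) = fst x" for x :: "'v \<times> bool" by (cases x) simp
  moreover have "0 < length L" using assms by (auto simp: via_def)
  moreover from this have "length L - 1 < length L" by simp
  ultimately show ?thesis
    using assms unfolding via_def by (auto simp: successively_map)
qed

lemma odd_via_sym: "odd_via A p q \<Longrightarrow> odd_via A q p"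
  unfolding odd_via_def using via_flip[OF via_rev] by fastforce

lemma via_shortcut:
  assumes via: "via A x y L" and ij: "i + 2 \<le> j" "j < length L" "\<not> (i = 0 \<and> Suc j = length L)"
    and G: "G (L ! i) (L ! j)"
  shows "via A x y (take (Suc i) L @ drop j L)" "length (take (Suc i) L @ drop j L) < length L"
proof -
  let ?L = "take (Suc i) L @ drop j L"
  show len: "length ?L < length L" using ij by simp
  have nth: "?L ! k = (if k \<le> i then L ! k else L ! (k - Suc i + j))" if "k < length ?L" for k
    using that ij by (auto simp: nth_append add.commute)
  have "distinct (map fst ?L)"
    using via ij set_take_disj_set_drop_if_distinct[of "map fst L" "Suc i" j]
    by (auto simp: via_def take_map drop_map distinct_take distinct_drop simp flip: take_map drop_map)
  moreover have "successively G ?L"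
  proof -
    have "successively G (take (Suc i) L)" "successively G (drop j L)"
      using via by (auto simp: via_def successively_conv_nth)
    moreover have "last (take (Suc i) L) = L ! i" "hd (drop j L) = L ! j"
      using ij by (auto simp: take_Suc_conv_app_nth hd_drop_conv_nth)
    ultimately show ?thesis using G by (simp add: successively_append_iff)
  qed
  moreover have "?L ! 0 = x" "?L ! (length ?L - 1) = y"
    using via ij by (auto simp: via_def nth nth_append)
  moreover have "fst (?L ! k) \<in> A" if "0 < k" "Suc k < length ?L" for k
    using via ij that nth[of k] by (auto simp: via_def)
  moreover have "3 \<le> length ?L" using ij by auto
  ultimately show "via A x y ?L" unfolding via_def by blast
qed

lemma via_shortest:
  assumes "via A x y L0"
  obtains L where "via A x y L" "\<And>L'. via A x y L' \<Longrightarrow> length L \<le> length L'"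
    "\<And>i j. i + 2 \<le> j \<Longrightarrow> j < length L \<Longrightarrow> G (L ! i) (L ! j) \<Longrightarrow> i = 0 \<and> Suc j = length L"
proof -
  obtain L where L: "via A x y L" "\<And>L'. via A x y L' \<Longrightarrow> length L \<le> length L'"
    using ex_has_least_nat[of "via A x y" L0 length] assms by blast
  have "i = 0 \<and> Suc j = length L" if "i + 2 \<le> j" "j < length L" "G (L ! i) (L ! j)" for i j
  proof (rule ccontr)
    assume "\<not> ?thesis"
    from via_shortcut[OF L(1) that(1,2) this that(3)] L(2) show False by force
  qed
  with L that show thesis by blast
qed

text \<open>Shortest paths through \<open>A\<close> and \<open>B\<close> close up to a cycle over
  distinct vertices. Its chord cannot shorten either path nor run from \<open>A\<close> to
  \<open>B\<close>, so it must join \<open>x\<close> and \<open>y\<close>.\<close>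

lemma via_via_adjacent:
  assumes "via A x y L0" "via B x y L0'"
    and disj: "A \<inter> B = {}" "fst x \<notin> A \<union> B" "fst y \<notin> A \<union> B"
    and noP: "\<And>a b. a \<in> A \<Longrightarrow> b \<in> B \<Longrightarrow> \<not> P a b"
  shows "G x y"
proof (rule ccontr)
  assume nG: "\<not> G x y"
  obtain L where L: "via A x y L"
    and minL: "\<And>i j. i + 2 \<le> j \<Longrightarrow> j < length L \<Longrightarrow> G (L ! i) (L ! j) \<Longrightarrow> i = 0 \<and> Suc j = length L"
    using via_shortest[OF assms(1)] by metis
  obtain K where K: "via B x y K"
    and minK: "\<And>i j. i + 2 \<le> j \<Longrightarrow> j < length K \<Longrightarrow> G (K ! i) (K ! j) \<Longrightarrow> i = 0 \<and> Suc j = length K"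
    using via_shortest[OF assms(2)] by metis
  obtain M where M: "L = x # M @ [y]" "M \<noteq> []" "fst ` set M \<subseteq> A" using L by (rule viaE)
  obtain M' where M': "K = x # M' @ [y]" "M' \<noteq> []" "fst ` set M' \<subseteq> B" using K by (rule viaE)
  define vs where "vs = L @ rev M'"
  let ?m = "length M" and ?m' = "length M'"
  have lenL: "length L = ?m + 2" and lenK: "length K = ?m' + 2" by (simp_all add: M M')
  have n: "length vs = ?m + ?m' + 2" by (simp add: vs_def M)
  have mpos: "?m > 0" "?m' > 0" using M M' by auto
  have vs1: "vs ! k = L ! k" if "k \<le> ?m + 1" for k
    using that by (simp add: vs_def nth_append lenL)
  have vs2: "vs ! k = K ! (length vs - k)" if "?m + 1 \<le> k" "k < length vs" for k
  proof (cases "k = ?m + 1")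
    case True
    then show ?thesis using that L K by (simp add: vs_def nth_append lenL lenK n via_def M)
  next
    case False
    then have "vs ! k = rev M' ! (k - ?m - 2)" using that by (simp add: vs_def nth_append lenL)
    also have "\<dots> = M' ! (length vs - k - 1)"
      using that False by (subst rev_nth) (auto simp: n intro!: arg_cong[of _ _ "(!) M'"])
    also have "\<dots> = K ! (length vs - k)" using that False by (auto simp: M' nth_append n nth_Cons')
    finally show ?thesis .
  qed
  have "fst ` set L \<inter> fst ` set M' = {}"
    using M M' disj by auto
  moreover have "distinct (map fst L)" "distinct (map fst M')" using L K by (auto simp: via_def M')
  ultimately have "distinct (map fst vs)" by (auto simp: vs_def rev_map[symmetric])
  moreover have "successively G (rev K)" using via_rev[OF K] by (simp add: via_def)
  then have "successively G (y # rev M' @ [x])" by (simp add: M')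
  then have rM: "successively G (rev M')" "G y (hd (rev M'))" "G (last (rev M')) x"
    using M'(2) by (auto simp: successively_append_iff successively_Cons)
  have "successively G vs"
    using L rM M M'(2) by (auto simp: vs_def successively_append_iff via_def successively_Cons)
  moreover have "G (last vs) (hd vs)" using rM(3) M'(2) by (simp add: vs_def M)
  moreover have "4 \<le> length vs" using mpos unfolding n by linarith
  ultimately obtain i j where ij: "i + 2 \<le> j" "j < length vs" "\<not> (i = 0 \<and> Suc j = length vs)" "G (vs ! i) (vs ! j)"
    using chord by blast
  consider "j \<le> ?m + 1" | "?m + 1 \<le> i" | "i = 0" "?m + 1 < j" | "0 < i" "i < ?m + 1" "?m + 1 < j"
    by linarith
  then show False
  proof cases
    case 1
    then have "G (L ! i) (L ! j)" using ij vs1[of i] vs1[of j] by simp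
    from minL[OF ij(1) _ this] 1 have "i = 0" "j = ?m + 1" by (auto simp: lenL)
    with \<open>G (L ! i) (L ! j)\<close> nG show False by (simp add: M nth_append)
  next
    case 2
    then have "G (K ! (length vs - j)) (K ! (length vs - i))" using ij vs2[of i] vs2[of j] by (simp add: G_sym)
    moreover have "length vs - j + 2 \<le> length vs - i" "length vs - i < length K" "length vs - j \<noteq> 0"
      using 2 ij(1,2) n lenK by linarith+
    ultimately show False using minK[of "length vs - j" "length vs - i"] by simp
  next
    case 3
    then have "vs ! i = K ! 0" using L K vs1[of 0] by (simp add: via_def)
    then have "G (K ! 0) (K ! (length vs - j))" using ij 3 vs2[of j] by simp
    moreover have "0 + 2 \<le> length vs - j" "length vs - j < length K" "Suc (length vs - j) \<noteq> length K"
      using 3 ij(1,2,3) n lenK by linarith+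
    ultimately show False using minK[of 0 "length vs - j"] by blast
  next
    case 4
    then have "fst (vs ! i) \<in> A" using vs1[of i] L lenL by (simp add: via_def)
    moreover have "fst (vs ! j) \<in> B" using vs2[of j] K lenK 4 ij n by (simp add: via_def)
    ultimately show False using noP G_P[OF ij(4)] by blast
  qed
qed

lemma via_single:
  assumes "G x (b, c)" "G (b, c) y" "fst x \<noteq> fst y"
  shows "via {b} x y [x, (b, c), y]"
proof -
  have "fst x \<noteq> b" "b \<noteq> fst y" using P_neq[OF G_P[OF assms(1)]] P_neq[OF G_P[OF assms(2)]] by simp_all
  then show ?thesis using viaI[of "[(b, c)]" "{b}" x y] assms by auto
qed

lemma via_double:
  assumes "G x y" "G y z" "G z w" "fst x \<noteq> fst w" "fst x \<noteq> fst z" "fst y \<noteq> fst w"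
  shows "via {fst y, fst z} x w [x, y, z, w]"
proof -
  have "fst x \<noteq> fst y" "fst y \<noteq> fst z" "fst z \<noteq> fst w" using assms(1-3) G_P P_neq by blast+
  then show ?thesis using viaI[of "[y, z]" "{fst y, fst z}" x w] assms by auto
qed

text \<open>The sheets are chosen so that both diagonals change sheets, hence would be negative
  edges.\<close>

lemma four_cycle:
  assumes "N b d" "N e w" "P d e" "P w b" "\<not> N b e" "\<not> N d w" "b \<noteq> e" "d \<noteq> w"
  shows False
proof -
  let ?vs = "[(b, False), (d, True), (e, True), (w, False)]"
  have "b \<noteq> d" "e \<noteq> w" "d \<noteq> e" "w \<noteq> b" using assms N_P P_neq by blast+
  then have "distinct (map fst ?vs)" using assms by auto
  moreover have "successively G ?vs" "G (last ?vs) (hd ?vs)" using assms by auto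
  ultimately obtain i j where "i + 2 \<le> j" "j < length ?vs" "\<not> (i = 0 \<and> Suc j = length ?vs)" "G (?vs ! i) (?vs ! j)"
    using chord[of ?vs] by auto
  then have "(i = 0 \<and> j = 2 \<or> i = 1 \<and> j = 3) \<and> G (?vs ! i) (?vs ! j)" by auto
  then show False using assms by auto
qed

text \<open>Otherwise a shortest odd path and \<open>p, d, b, q\<close> would form a chordless balanced cycle, as a chord at
  \<open>d\<close> produces an odd path from \<open>q\<close> to \<open>d\<close>, to be compared with the path through \<open>b\<close>.\<close>

lemma five_clique:
  assumes clique: "P p d" "P q b" "N b d" "P q d" "P p b"
    and odd: "odd_via A p q" and nN: "\<not> N p q" "\<not> N d q" "\<not> N b p"
    and notA: "p \<notin> A" "q \<notin> A" "d \<notin> A" "b \<notin> A" and noP: "\<And>a. a \<in> A \<Longrightarrow> \<not> P a b"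
  shows False
proof -
  obtain L0 where "via A (q, False) (p, True) L0" using odd_via_sym[OF odd] by (auto simp: odd_via_def)
  then obtain L where L: "via A (q, False) (p, True) L"
    and minL: "\<And>i j. i + 2 \<le> j \<Longrightarrow> j < length L \<Longrightarrow> G (L ! i) (L ! j) \<Longrightarrow> i = 0 \<and> Suc j = length L"
    by (rule via_shortest) blast
  obtain M where M: "L = (q, False) # M @ [(p, True)]" "M \<noteq> []" "fst ` set M \<subseteq> A" using L by (rule viaE)
  let ?m = "length M"
  define vs where "vs = L @ [(d, True), (b, False)]"
  have n: "length vs = ?m + 4" and lenL: "length L = ?m + 2" by (simp_all add: vs_def M)
  have P: "P b d" "P d b" "P b q" using assms N_P P_sym by blast+
  have neq: "p \<noteq> d" "q \<noteq> b" "b \<noteq> d" "q \<noteq> d" "p \<noteq> b" using clique P P_neq by blast+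
  have "d \<notin> fst ` set M" "b \<notin> fst ` set M" using M(3) notA by auto
  then have "distinct (map fst vs)" using L neq by (simp add: vs_def via_def M)
  moreover have "successively G vs" "G (last vs) (hd vs)"
  proof -
    have "last L = (p, True)" "hd L = (q, False)" "L \<noteq> []" by (simp_all add: M)
    then show "successively G vs" "G (last vs) (hd vs)"
      using L clique P N_sym by (auto simp: vs_def via_def successively_append_iff)
  qed
  ultimately obtain i j where ij: "i + 2 \<le> j" "j < length vs" "\<not> (i = 0 \<and> Suc j = length vs)" "G (vs ! i) (vs ! j)"
    using chord[of vs] n by auto
  have vs1: "vs ! k = L ! k" if "k \<le> ?m + 1" for k
    using that by (simp add: vs_def nth_append lenL)
  have vsd: "vs ! (?m + 2) = (d, True)" "vs ! (?m + 3) = (b, False)"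
    by (simp_all add: vs_def nth_append lenL)
  have inA: "fst (vs ! k) \<in> A" if "0 < k" "k \<le> ?m" for k
    using that vs1[of k] L lenL by (simp add: via_def)
  have ends: "vs ! 0 = (q, False)" "vs ! (?m + 1) = (p, True)" using vs1 L lenL by (simp_all add: via_def)
  consider "j \<le> ?m + 1" | "j = ?m + 2" "i = 0" | "j = ?m + 2" "0 < i" | "j = ?m + 3" "i \<le> ?m" | "j = ?m + 3" "i = ?m + 1"
    using ij n by linarith
  then show False
  proof cases
    case 1
    then have "G (L ! i) (L ! j)" using ij vs1[of i] vs1[of j] by simp
    from minL[OF ij(1) _ this] 1 have "i = 0" "j = ?m + 1" by (auto simp: lenL)
    with ij(4) ends nN N_sym show False by auto
  next
    case 2
    with ij(4) ends vsd nN N_sym show False by auto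
  next
    case 3
    have i: "i \<le> ?m" using 3 ij by simp
    have "via A (q, False) (d, True) ((q, False) # take i M @ [(d, True)])"
    proof (rule viaI)
      show "take i M \<noteq> []" using 3 M by simp
      show tA: "fst ` set (take i M) \<subseteq> A" using M(3) set_take_subset[of i M] by blast
      show "distinct (map fst ((q, False) # take i M @ [(d, True)]))"
      proof -
        have "distinct (map fst (take i M))"
          using L by (simp add: via_def M(1) distinct_take flip: take_map)
        moreover have "q \<notin> fst ` set (take i M)" "d \<notin> fst ` set (take i M)" using tA notA by auto
        ultimately show ?thesis using neq by simp
      qed
      have "last (take i M) = vs ! i"
        using 3 i vs1[of i] M by (auto simp: last_conv_nth nth_append nth_Cons')
      moreover have "successively G ((q, False) # take i M)"
      proof -
        have "(q, False) # take i M = take (Suc i) L" using i by (simp add: M)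
        then show ?thesis using L by (auto simp: via_def successively_conv_nth)
      qed
      ultimately show "successively G ((q, False) # take i M @ [(d, True)])"
        using ij(4) 3 vsd M(2) by (simp add: successively_append_iff flip: append_Cons)
    qed
    moreover have "via {b} (q, False) (d, True) [(q, False), (b, False), (d, True)]"
      by (rule via_single) (use clique neq in auto)
    ultimately have "G (q, False) (d, True)"
      by (rule via_via_adjacent) (use notA neq noP in auto)
    then show False using nN N_sym by auto
  next
    case 4
    then have "0 < i" using ij n by auto
    then show False using inA[of i] 4 G_P[OF ij(4)] vsd noP by auto
  next
    case 5
    with ij(4) ends vsd nN N_sym show False by auto
  qed
qed

text \<open>A shortest odd path may be taken with a single negative edge. If this is not the first edge, then
  closing up at \<open>d\<close> as early as possible after it gives a chordless balanced cycle.\<close>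

lemma star_apex_core:
  assumes N: "N d p" "N d q" "\<not> N p q" and dA: "d \<notin> A" "\<And>a. a \<in> A \<Longrightarrow> \<not> N d a"
    and us: "3 \<le> length us" "distinct us" "successively P us" "us ! 0 = p" "us ! (length us - 1) = q"
      "\<And>i. 0 < i \<Longrightarrow> Suc i < length us \<Longrightarrow> us ! i \<in> A"
    and j: "0 < j" "Suc j < length us" "N (us ! j) (us ! Suc j)"
    and shortest: "\<And>L. via A (p, False) (q, True) L \<Longrightarrow> length us \<le> length L"
  shows False
proof -
  \<comment> \<open>Consecutive vertices of \<open>us\<close> are all joined by positive edges, so
    the path can be lifted anew with a single change of sheet, at step \<open>j\<close>.\<close>
  define L where "L = map (\<lambda>i. (us ! i, j < i)) [0..<length us]"
  have nthL: "L ! i = (us ! i, j < i)" if "i < length us" for i using that by (simp add: L_def)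
  have lenL: "length L = length us" by (simp add: L_def)
  have mapL: "map fst L = us" by (simp add: L_def comp_def map_nth)
  have sucL: "successively G L"
    unfolding successively_conv_nth
  proof (intro allI impI)
    fix i assume "Suc i < length L"
    then have i: "Suc i < length us" by (simp add: lenL)
    then have "P (us ! i) (us ! Suc i)" using us(3) by (simp add: successively_conv_nth)
    then show "G (L ! i) (L ! Suc i)" using i j(3) nthL[of i] nthL[of "Suc i"]
      by (cases "i = j") (auto simp: G_def)
  qed
  have L: "via A (p, False) (q, True) L"
    unfolding via_def mapL
  proof (intro conjI allI impI)
    show "L ! 0 = (p, False)" using nthL[of 0] us(1,4) j by (cases us) auto
    show "L ! (length L - 1) = (q, True)" using nthL[of "length us - 1"] us(1,5) j(2) lenL by simp
    fix i assume "0 < i" "Suc i < length L"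
    then show "fst (L ! i) \<in> A" using nthL[of i] us(6)[of i] lenL by simp
  qed (use us(1,2) sucL lenL in simp_all)
  have Pd: "P d (us ! (length us - 1))" using N(2) us(5) N_P by simp
  define i where "i = (LEAST i. j < i \<and> P d (us ! i))"
  have ex: "j < length us - 1 \<and> P d (us ! (length us - 1))" using j Pd by simp
  have i: "j < i" "P d (us ! i)" using LeastI[of "\<lambda>i. j < i \<and> P d (us ! i)", OF ex] by (auto simp: i_def)
  have i_le: "i \<le> length us - 1" unfolding i_def by (rule Least_le) (rule ex)
  have i_min: "\<not> P d (us ! k)" if "j < k" "k < i" for k
    using that not_less_Least[of k "\<lambda>i. j < i \<and> P d (us ! i)"] by (auto simp: i_def)
  have ilt: "i < length us" using i_le us(1) by linarith
  define vs where "vs = take (Suc i) L @ [(d, True)]"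
  have n: "length vs = i + 2" using ilt by (simp add: vs_def lenL)
  have vs1: "vs ! k = L ! k" if "k \<le> i" for k using that ilt by (simp add: vs_def nth_append lenL)
  have vsd: "vs ! Suc i = (d, True)" using ilt by (simp add: vs_def nth_append lenL)
  have dus: "d \<notin> set us"
  proof
    assume "d \<in> set us"
    then obtain k where k: "k < length us" "us ! k = d" by (auto simp: in_set_conv_nth)
    then consider "k = 0" | "k = length us - 1" | "0 < k" "Suc k < length us" by linarith
    then show False using k us N N_P P_irrefl dA by cases auto
  qed
  have "distinct (map fst vs)"
    using us(2) dus set_take_subset[of "Suc i" us] by (auto simp: vs_def mapL distinct_take simp flip: take_map)
  moreover have "successively G vs"
  proof -
    have "successively G (take (Suc i) L)" using sucL by (auto simp: successively_conv_nth)
    moreover have "last (take (Suc i) L) = (us ! i, True)"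
      using ilt i nthL[of i] by (simp add: take_Suc_conv_app_nth lenL)
    ultimately show ?thesis using i P_sym by (auto simp: vs_def successively_append_iff)
  qed
  moreover have "G (last vs) (hd vs)"
  proof -
    have "0 < length us" using us(1) by linarith
    moreover have "vs \<noteq> []" using n by auto
    ultimately have "hd vs = (p, False)" using vs1[of 0] nthL[of 0] us(4) by (simp add: hd_conv_nth)
    then show ?thesis using N(1) by (simp add: vs_def)
  qed
  moreover have "4 \<le> length vs" using n i j by simp
  ultimately obtain a b where ab: "a + 2 \<le> b" "b < length vs" "\<not> (a = 0 \<and> Suc b = length vs)" "G (vs ! a) (vs ! b)"
    using chord by blast
  show False
  proof (cases "b \<le> i")
    case True
    then have G: "G (L ! a) (L ! b)" using ab vs1 by simp
    show False
    proof (cases "a = 0 \<and> Suc b = length L")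
      case True
      then have "a = 0" "b = length L - 1" by auto
      then have "G (p, False) (q, True)" using G L by (simp add: via_def)
      then show False using N(3) by simp
    next
      case False
      have "b < length L" using True ilt lenL by simp
      from via_shortcut[OF L ab(1) this False G] shortest lenL show False by fastforce
    qed
  next
    case False
    then have b: "b = Suc i" using ab n by simp
    then have a: "0 < a" "a < i" using ab n by auto
    have G: "G (us ! a, j < a) (d, True)" using ab(4) vsd vs1[of a] nthL[of a] a ilt b by simp
    show False
    \<comment> \<open>A chord at \<open>d\<close> is either a positive edge to an earlier vertex
      beyond \<open>j\<close>, against the choice of \<open>i\<close>, or a negative edge from
      \<open>d\<close> into \<open>A\<close>.\<close>
    proof (cases "j < a")
      case True
      then show False using G i_min[of a] a P_sym by auto
    next
      case False
      then show False using G dA(2)[of "us ! a"] us(6)[of a] a ilt N_sym by auto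
    qed
  qed
qed

text \<open>Supplies the negative edge from a separator vertex \<open>d\<close> into the side
  \<open>A\<close> with which odd paths starting at \<open>d\<close> can be built.\<close>

lemma star_apex:
  assumes odd: "odd_via A p q" and N: "N d p" "N d q" "\<not> N p q" and dA: "d \<notin> A"
  shows "\<exists>a\<in>A. N d a"
proof (rule ccontr)
  assume no: "\<not> ?thesis"
  obtain L0 where "via A (p, False) (q, True) L0" using odd by (auto simp: odd_via_def)
  then obtain L where L: "via A (p, False) (q, True) L"
    and shortest: "\<And>L'. via A (p, False) (q, True) L' \<Longrightarrow> length L \<le> length L'"
    by (rule via_shortest) blast
  have len: "3 \<le> length L" using L by (simp add: via_def)
  have "\<exists>k<length L - 1. \<not> snd (L ! k) \<and> snd (L ! Suc k)"
  proof (rule ccontr)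
    assume *: "\<not> ?thesis"
    have "k < length L \<Longrightarrow> \<not> snd (L ! k)" for k
    proof (induction k)
      case 0
      then show ?case using L by (simp add: via_def)
    next
      case (Suc k)
      then have "k < length L - 1" by simp
      with * Suc show ?case by auto
    qed
    moreover have "length L - 1 < length L" using len by linarith
    ultimately show False using L unfolding via_def by fastforce
  qed
  then obtain k where k: "k < length L - 1" "\<not> snd (L ! k)" "snd (L ! Suc k)" by blast
  let ?us = "map fst L"
  have G: "G (L ! k) (L ! Suc k)" using L k(1) by (auto simp: via_def successively_conv_nth)
  then have Nk: "N (?us ! k) (?us ! Suc k)" using k by (auto simp: G_def)
  have suc: "successively P ?us" using L G_P by (auto simp: via_def successively_conv_nth)
  have us: "3 \<le> length ?us" "distinct ?us" "?us ! 0 = p" "?us ! (length ?us - 1) = q"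
    "\<And>i. 0 < i \<Longrightarrow> Suc i < length ?us \<Longrightarrow> ?us ! i \<in> A"
  proof -
    have "0 < length L" "length L - 1 < length L" using len by linarith+
    then show "?us ! 0 = p" "?us ! (length ?us - 1) = q" using L by (simp_all add: via_def)
  qed (use L in \<open>auto simp: via_def\<close>)
  show False
  proof (cases "k = 0")
    case False
    show False
      by (rule star_apex_core[OF N dA _ us(1,2) suc us(3,4,5), of k]) (use no False k Nk shortest in auto)
  next
    case True
    \<comment> \<open>If the negative edge comes first, reading the path from \<open>q\<close> makes
      it the last one, at position \<open>length L - 2\<close>, which is positive as the path has at
      least three vertices.\<close>
    let ?vs = "rev ?us"
    have n: "length ?vs = length L" by simp
    have nth: "?vs ! i = ?us ! (length L - Suc i)" if "i < length L" for i
      using that by (simp add: rev_nth)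
    show False
    proof (rule star_apex_core[OF N(2,1) _ dA, of "?vs" "length L - 2"])
      show "\<not> N q p" using N(3) N_sym by blast
      show "successively P ?vs" unfolding successively_rev using suc P_sym
        by (auto simp: successively_conv_nth)
      show "?vs ! 0 = q" "?vs ! (length ?vs - 1) = p" 
      proof -
        have "0 < length L" using len by linarith
        then show "?vs ! 0 = q" "?vs ! (length ?vs - 1) = p"
          using us(3,4) nth[of 0] nth[of "length L - 1"] by simp_all
      qed
      show "?vs ! i \<in> A" if "0 < i" "Suc i < length ?vs" for i
        using that us(5)[of "length L - Suc i"] nth[of i] by (simp add: n)
      have "?vs ! (length L - 2) = ?us ! 1" "?vs ! Suc (length L - 2) = ?us ! 0"
        using len nth[of "length L - 2"] nth[of "Suc (length L - 2)"] by (simp_all add: Suc_diff_Suc numeral_2_eq_2)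
      then show "N (?vs ! (length L - 2)) (?vs ! Suc (length L - 2))" using Nk True N_sym by simp
      show "length ?vs \<le> length L'" if "via A (q, False) (p, True) L'" for L'
        using shortest[OF via_flip[OF via_rev[OF that], simplified]] by simp
    qed (use no us len in auto)
  qed
qed

end

section \<open>Connected sets and separators\<close>

context signed_graph
begin

definition rel :: "'v set \<Rightarrow> 'v \<Rightarrow> 'v \<Rightarrow> bool" where
  "rel A x y \<longleftrightarrow> P x y \<and> x \<in> A \<and> y \<in> A"

definition conn :: "'v set \<Rightarrow> bool" where
  "conn A \<longleftrightarrow> (\<forall>u\<in>A. \<forall>v\<in>A. (rel A)\<^sup>*\<^sup>* u v)"

definition component :: "'v set \<Rightarrow> 'v \<Rightarrow> 'v set" where
  "component X v = {u. (rel X)\<^sup>*\<^sup>* v u}"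

definition Pclique :: "'v set \<Rightarrow> bool" where
  "Pclique X \<longleftrightarrow> (\<forall>x\<in>X. \<forall>y\<in>X. x \<noteq> y \<longrightarrow> P x y)"

lemma rel_path:
  assumes "(rel A)\<^sup>*\<^sup>* u v" "u \<in> A"
  obtains us where "us \<noteq> []" "distinct us" "successively P us" "hd us = u" "last us = v" "set us \<subseteq> A"
  using assms
proof (induction arbitrary: thesis rule: rtranclp_induct)
  case base
  show ?case by (rule base(1)[of "[u]"]) (use base in auto)
next
  case (step v w)
  obtain us where us: "us \<noteq> []" "distinct us" "successively P us" "hd us = u" "last us = v" "set us \<subseteq> A"
    using step.IH step.prems by blast
  show ?case
  proof (cases "w \<in> set us")
    case False
    show ?thesis
      by (rule step.prems(1)[of "us @ [w]"])
         (use us False step.hyps in \<open>auto simp: rel_def successively_append_iff\<close>)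
  next
    case True
    then obtain as bs where "us = as @ w # bs" by (auto simp: in_set_conv_decomp)
    then show ?thesis
      using us by (intro step.prems(1)[of "as @ [w]"])
        (auto simp: successively_append_iff successively_Cons hd_append split: if_splits)
  qed
qed

lemma component_subset: "v \<in> X \<Longrightarrow> component X v \<subseteq> X"
  unfolding component_def by (auto elim: rtranclp.cases simp: rel_def)

lemma component_refl: "v \<in> component X v"
  by (simp add: component_def)

lemma component_step: "a \<in> component X v \<Longrightarrow> P a b \<Longrightarrow> a \<in> X \<Longrightarrow> b \<in> X \<Longrightarrow> b \<in> component X v"
  unfolding component_def by (auto intro: rtranclp.rtrancl_into_rtrancl simp: rel_def)

lemma conn_component: "conn (component X v)"
proof -
  have *: "(rel (component X v))\<^sup>*\<^sup>* v u" if "(rel X)\<^sup>*\<^sup>* v u" for u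
    using that
  proof induction
    case (step y z)
    then have "rel (component X v) y z"
      unfolding rel_def component_def using rtranclp.rtrancl_into_rtrancl[OF step.hyps] by (auto simp: rel_def)
    then show ?case using step.IH by simp
  qed simp
  have sym: "symp (rel A)\<^sup>*\<^sup>*" for A
    by (rule symp_rtranclp) (auto simp: symp_def rel_def P_sym)
  show ?thesis
    unfolding conn_def
  proof (intro ballI)
    fix a b assume "a \<in> component X v" "b \<in> component X v"
    then have "(rel (component X v))\<^sup>*\<^sup>* v a" "(rel (component X v))\<^sup>*\<^sup>* v b" using * by (auto simp: component_def)
    then show "(rel (component X v))\<^sup>*\<^sup>* a b" using sympD[OF sym] rtranclp_trans by metis
  qed
qed

lemma conn_subset_closed:
  assumes "conn A" "a \<in> A" "a \<in> D" "\<And>x y. x \<in> A \<Longrightarrow> y \<in> A \<Longrightarrow> x \<in> D \<Longrightarrow> P x y \<Longrightarrow> y \<in> D"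
  shows "A \<subseteq> D"
proof
  fix b assume "b \<in> A"
  then have "(rel A)\<^sup>*\<^sup>* a b" using assms(1,2) by (simp add: conn_def)
  then show "b \<in> D"
    by induction (use assms in \<open>auto simp: rel_def\<close>)
qed

lemma component_subset_closed:
  assumes "v \<in> X" "v \<in> D" "\<And>x y. x \<in> D \<Longrightarrow> x \<in> X \<Longrightarrow> y \<in> X \<Longrightarrow> P x y \<Longrightarrow> y \<in> D"
  shows "component X v \<subseteq> D"
  by (rule conn_subset_closed[OF conn_component component_refl assms(2)])
     (use assms(3) component_subset[OF assms(1)] in blast)

lemma nbr_component: "y \<in> W - K \<Longrightarrow> nbr W (component (W - K) y) \<subseteq> K"
  using component_step component_subset[of y "W - K"] by (fastforce simp: nbr_def)

lemma conn_subset_component: "conn A \<Longrightarrow> A \<subseteq> X \<Longrightarrow> a \<in> A \<Longrightarrow> a \<in> component X v \<Longrightarrow> A \<subseteq> component X v"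
  using conn_subset_closed[of A a "component X v"] component_step by blast

text \<open>\<open>A\<close> and \<open>C\<close> are two full components of the minimal separator
  \<open>nbr W A\<close>.\<close>

definition sep :: "'v set \<Rightarrow> 'v set \<Rightarrow> 'v set \<Rightarrow> bool" where
  "sep W A C \<longleftrightarrow> A \<subseteq> W \<and> C \<subseteq> W \<and> A \<noteq> {} \<and> C \<noteq> {} \<and> conn A \<and> conn C \<and> A \<inter> C = {} \<and> nbr W A = nbr W C"

lemma sep_sym: "sep W A C \<Longrightarrow> sep W C A"
  by (auto simp: sep_def)

lemma sep_component:
  assumes C: "conn C" "C \<noteq> {}" "C \<subseteq> W" and u: "u \<in> W" "u \<notin> C" "u \<notin> nbr W C" "\<And>s. s \<in> nbr W C \<Longrightarrow> P u s"
  shows "sep W (component (W - nbr W C) u) C"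
proof -
  let ?S = "nbr W C" let ?A = "component (W - ?S) u"
  have uX: "u \<in> W - ?S" using u by simp
  have "?A \<subseteq> W - C"
    by (rule component_subset_closed[OF uX]) (use u in \<open>auto simp: nbr_def P_sym\<close>)
  moreover have "nbr W ?A = ?S"
  proof
    show "?S \<subseteq> nbr W ?A"
      using u(4) component_subset[OF uX] component_refl[of u] by (auto simp: nbr_def)
    show "nbr W ?A \<subseteq> ?S" using nbr_component[OF uX] .
  qed
  ultimately show ?thesis
    using C conn_component component_refl[of u "W - ?S"] unfolding sep_def by blast
qed

text \<open>Apart from \<open>b\<close> and \<open>w\<close> themselves, the negative neighbours of
  \<open>w\<close> are negative neighbours of \<open>b\<close>, and \<open>d\<close> is missing. If
  \<open>N w b\<close>, one element is removed from either set before comparing.\<close>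

lemma card_N_less:
  assumes "finite W" "d \<in> W" "N b d" "\<not> N w d" "d \<noteq> w" "b \<in> W" "w \<in> W"
    and *: "\<And>e. e \<in> W \<Longrightarrow> N w e \<Longrightarrow> \<not> N b e \<Longrightarrow> e = b"
  shows "card {x \<in> W. N w x} < card {x \<in> W. N b x}"
proof -
  let ?w = "{x \<in> W. N w x}" and ?b = "{x \<in> W. N b x}"
  have irr: "\<not> N x x" for x using N_P P_irrefl by blast
  show ?thesis
  proof (cases "N w b")
    case False
    then have "?w \<subset> ?b" using assms irr by auto
    then show ?thesis by (rule psubset_card_mono[rotated]) simp
  next
    case True
    then have wb: "b \<in> ?w" "w \<in> ?b" using assms N_sym by auto
    have "?w - {b} \<subset> ?b - {w}" using assms irr by auto
    then have "card (?w - {b}) < card (?b - {w})" by (rule psubset_card_mono[rotated]) simp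
    then show ?thesis using wb by (simp add: card_Diff_singleton)
  qed
qed

lemma min_by_card:
  assumes "T \<noteq> {}"
  obtains b where "b \<in> T" "\<And>w. w \<in> T \<Longrightarrow> (f b :: nat) \<le> f w"
proof -
  obtain t where "t \<in> T" using assms by blast
  from ex_has_least_nat[of "\<lambda>b. b \<in> T", OF this, of f] show thesis using that by blast
qed

lemma max_by_card:
  assumes "T \<noteq> {}" "finite T"
  obtains b where "b \<in> T" "\<And>w. w \<in> T \<Longrightarrow> (f w :: nat) \<le> f b"
proof -
  have "Max (f ` T) \<in> f ` T" using assms by (intro Max_in) auto
  then obtain b where b: "b \<in> T" "Max (f ` T) = f b" by auto
  have "f w \<le> f b" if "w \<in> T" for w
    using assms that unfolding b(2)[symmetric] by (intro Max_ge) auto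
  with b(1) show thesis by (rule that)
qed

end

section \<open>Minimal separators and simplicial vertices in the chordal case\<close>

context chordal_signed_graph
begin

text \<open>Only the first edge may change the sheet; the rest of the path runs through
  \<open>A\<close> along positive edges on the sheet \<open>c\<close>.\<close>

lemma conn_via:
  assumes A: "conn A" "a \<in> A" "a' \<in> A" and G: "G (s, c0) (a, c)" "P a' s'" and s: "s \<noteq> s'" "s \<notin> A" "s' \<notin> A"
  shows "\<exists>L. via A (s, c0) (s', c) L"
proof -
  have "(rel A)\<^sup>*\<^sup>* a a'" using A by (simp add: conn_def)
  then obtain us where us: "us \<noteq> []" "distinct us" "successively P us" "hd us = a" "last us = a'" "set us \<subseteq> A"
    using rel_path A(2) by metis
  let ?M = "map (\<lambda>u. (u, c)) us"
  have "successively G ?M" using us(3) by (simp add: successively_map)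
  moreover have "hd ?M = (a, c)" "last ?M = (a', c)" using us by (simp_all add: hd_map last_map)
  ultimately have "via A (s, c0) (s', c) ((s, c0) # ?M @ [(s', c)])"
    using us G s by (intro viaI) (auto simp: successively_append_iff successively_Cons comp_def)
  then show ?thesis by blast
qed

lemma odd_viaI: "via A (p, False) (q, True) L \<Longrightarrow> A \<subseteq> B \<Longrightarrow> odd_via B p q"
  unfolding odd_via_def by (blast intro: via_mono)

lemma odd_via_mono: "odd_via A p q \<Longrightarrow> A \<subseteq> B \<Longrightarrow> odd_via B p q"
  unfolding odd_via_def by (blast intro: via_mono)

lemma not_odd_both:
  assumes "odd_via A p q" "via B (p, False) (q, True) L" "\<not> N p q" "A \<inter> B = {}" "p \<notin> A \<union> B" "q \<notin> A \<union> B"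
    "\<And>a b. a \<in> A \<Longrightarrow> b \<in> B \<Longrightarrow> \<not> P a b"
  shows False
  using assms via_via_adjacent[of A "(p, False)" "(q, True)" _ B L] by (auto simp: odd_via_def)

text \<open>Dirac's argument on a single sheet: two vertices of the separator are joined by positive
  paths through either side, so \<open>via_via_adjacent\<close> applies.\<close>

lemma sep_clique:
  assumes "sep W A C"
  shows "Pclique (nbr W A)"
  unfolding Pclique_def
proof (intro ballI impI)
  fix s s' assume s: "s \<in> nbr W A" "s' \<in> nbr W A" "s \<noteq> s'"
  then have sC: "s \<in> nbr W C" "s' \<in> nbr W C" using assms by (auto simp: sep_def)
  have noP: "\<not> P a b" if "a \<in> A" "b \<in> C" for a b
  proof
    assume "P a b"
    then have "b \<in> nbr W A" using assms that by (auto simp: sep_def nbr_def)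
    then have "b \<in> nbr W C" using assms by (simp add: sep_def)
    then show False using that by (simp add: nbr_def)
  qed
  obtain a a' where a: "a \<in> A" "P a s" "a' \<in> A" "P a' s'" using s by (auto simp: nbr_def)
  obtain c c' where c: "c \<in> C" "P c s" "c' \<in> C" "P c' s'" using sC by (auto simp: nbr_def)
  have notin: "s \<notin> A" "s' \<notin> A" "s \<notin> C" "s' \<notin> C" using s sC by (auto simp: nbr_def)
  obtain L where L: "via A (s, False) (s', False) L"
    using conn_via[of A a a' s False False s'] a notin s assms by (auto simp: sep_def P_sym)
  obtain L' where L': "via C (s, False) (s', False) L'"
    using conn_via[of C c c' s False False s'] c notin s assms by (auto simp: sep_def P_sym)
  have "G (s, False) (s', False)"
    by (rule via_via_adjacent[OF L L']) (use notin noP assms in \<open>auto simp: sep_def\<close>)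
  then show "P s s'" by simp
qed

text \<open>Let \<open>x\<close> see as much of \<open>S\<close> as possible and miss
  \<open>s\<close>, and let \<open>z\<close> be the first vertex adjacent to \<open>s\<close> on a
  path leaving \<open>x\<close>. Each \<open>t\<close> seen by \<open>x\<close> is joined to
  \<open>z\<close> both along this path and through \<open>s\<close>, hence is seen by
  \<open>z\<close>, which also sees \<open>s\<close>.\<close>

lemma dominating_vertex:
  assumes C: "conn C" "C \<noteq> {}" and S: "Pclique S" "S \<inter> C = {}" "\<And>s. s \<in> S \<Longrightarrow> \<exists>c\<in>C. P c s"
  shows "\<exists>x\<in>C. \<forall>s\<in>S. P x s"
proof -
  obtain x where x: "x \<in> C" "\<And>y. y \<in> C \<Longrightarrow> card {s \<in> S. P y s} \<le> card {s \<in> S. P x s}"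
    by (rule max_by_card[OF C(2), of "\<lambda>x. card {s \<in> S. P x s}"]) auto
  have "P x s" if s: "s \<in> S" for s
  proof (rule ccontr)
    assume nP: "\<not> P x s"
    obtain y where y: "y \<in> C" "P y s" using S(3) s by blast
    have "(rel C)\<^sup>*\<^sup>* x y" using C x y by (simp add: conn_def)
    then obtain us where us: "us \<noteq> []" "distinct us" "successively P us" "hd us = x" "last us = y" "set us \<subseteq> C"
      using rel_path x(1) by metis
    have "\<exists>z\<in>set us. P z s" using us y by (metis last_in_set)
    from split_list_first_prop[OF this]
    obtain xs z ys where zs: "us = xs @ z # ys" "P z s" "\<forall>u\<in>set xs. \<not> P u s" by blast
    have xs: "xs \<noteq> []" "hd xs = x" using zs us nP by (auto simp: hd_append split: if_splits)
    have zC: "z \<in> C" and xsC: "set xs \<subseteq> C" using zs us by auto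
    have "P z t" if t: "t \<in> S" "P x t" for t
    proof -
      have ts: "t \<noteq> s" using t nP by auto
      have tC: "t \<notin> C" "s \<notin> C" using t s S(2) by auto
      let ?M = "map (\<lambda>u. (u, False)) xs"
      have "via (set xs) (t, False) (z, False) ((t, False) # ?M @ [(z, False)])"
      proof (rule viaI)
        have "hd ?M = (x, False)" "last ?M = (last xs, False)" using xs by (simp_all add: hd_map last_map)
        moreover have "successively P xs" "P (last xs) z" using us xs zs by (auto simp: successively_append_iff)
        ultimately show "successively G ((t, False) # ?M @ [(z, False)])"
          using xs t P_sym by (auto simp: successively_append_iff successively_Cons successively_map)
        show "distinct (map fst ((t, False) # ?M @ [(z, False)]))"
          using us zs tC zC xsC by (auto simp: comp_def)
      qed (use xs in auto)
      moreover have "via {s} (t, False) (z, False) [(t, False), (s, False), (z, False)]"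
        by (rule via_single) (use S(1) t s ts zs P_sym zC tC in \<open>auto simp: Pclique_def\<close>)
      ultimately have "G (t, False) (z, False)"
        by (rule via_via_adjacent) (use zs us tC zC xsC ts in auto)
      then show ?thesis using P_sym by simp
    qed
    then have "{s \<in> S. P x s} \<subset> {s \<in> S. P z s}" using s nP zs by auto
    then have "card {s \<in> S. P x s} < card {s \<in> S. P z s}" by (rule psubset_card_mono[rotated]) simp
    then show False using x(2)[OF zC] by simp
  qed
  then show ?thesis using x by blast
qed

text \<open>The descent: \<open>d\<close> and \<open>w\<close> form a flaw at \<open>b\<close>. A
  negative neighbour of \<open>w\<close> other than \<open>b\<close> that \<open>b\<close> does not
  share would complete the configuration excluded by \<open>four_cycle\<close>.\<close>

lemma simplicial_card_less:
  assumes b: "b \<in> W" "simplicial W b" and w: "w \<in> W" "simplicial W w"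
    and d: "d \<in> W" "N b d" "P b w" "d \<noteq> w" "\<not> N d w"
  shows "card {x \<in> W. N w x} < card {x \<in> W. N b x}"
proof (rule card_N_less[of _ d])
  fix e assume e: "e \<in> W" "N w e" "\<not> N b e"
  show "e = b"
  proof (rule ccontr)
    assume "e \<noteq> b"
    moreover have "P w b" "P w e" using d e N_P P_sym by auto
    ultimately have "P b e" using w b e unfolding simplicial_def by metis
    moreover have "d \<noteq> e" using d e by auto
    ultimately have "P d e" using b d e N_P unfolding simplicial_def by metis
    then show False using four_cycle[of b d e w] d e \<open>P w b\<close> \<open>e \<noteq> b\<close> N_sym by auto
  qed
qed (use assms N_sym in auto)

lemma not_flawlessE:
  assumes "\<not> flawless W b" "b \<in> W" "simplicial W b"
  obtains d w where "d \<in> W" "w \<in> W" "d \<noteq> w" "N b d" "P b w" "\<not> N d w"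
  using assms unfolding flawless_def by blast

end

section \<open>Flawless vertices when no side carries a forbidden odd path\<close>

locale undecomposable = chordal_signed_graph P N for P N :: "'v::finite \<Rightarrow> 'v \<Rightarrow> bool" +
  fixes W :: "'v set"
  assumes nds: "C \<subseteq> W \<Longrightarrow> C \<noteq> {} \<Longrightarrow> W - (C \<union> nbr W C) \<noteq> {} \<Longrightarrow> \<not> Nclique (nbr W C)"
begin

lemma sep_pair:
  assumes "sep W A C"
  obtains s s' where "s \<in> nbr W A" "s' \<in> nbr W A" "s \<noteq> s'" "\<not> N s s'"
proof -
  have "A \<inter> nbr W A = {}" by (auto simp: nbr_def)
  then have "W - (C \<union> nbr W C) \<noteq> {}" using assms unfolding sep_def by blast
  then have "\<not> Nclique (nbr W A)" using nds[of C] assms by (auto simp: sep_def)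
  then show thesis using that by (auto simp: Nclique_def)
qed

text \<open>A smallest side \<open>Y\<close> turns out to form a clique with its separator. For
  \<open>b\<close> in \<open>Y\<close> with fewest negative edges, a flaw would yield an odd path
  through \<open>Y\<close> between separator vertices not negatively joined.\<close>

lemma flawless_if_no_odd:
  assumes sep0: "sep W A0 C0"
    and even: "\<And>A C p q. sep W A C \<Longrightarrow> p \<in> nbr W A \<Longrightarrow> q \<in> nbr W A \<Longrightarrow> p \<noteq> q \<Longrightarrow> \<not> N p q \<Longrightarrow> \<not> odd_via A p q"
  shows "\<exists>v. flawless W v"
proof -
  obtain Y where Y: "\<exists>C. sep W Y C" and minY: "\<And>A C. sep W A C \<Longrightarrow> card Y \<le> card A"
  proof -
    have ne: "{Y. \<exists>C. sep W Y C} \<noteq> {}" using sep0 by blast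
    show thesis by (rule min_by_card[OF ne, of card]) (use that in auto)
  qed
  obtain C where C: "sep W Y C" using Y by blast
  let ?S = "nbr W Y"
  have SY: "?S \<inter> Y = {}" "?S \<subseteq> W" "Y \<subseteq> W" "Y \<noteq> {}" using C by (auto simp: nbr_def sep_def)
  have Scl: "Pclique ?S" by (rule sep_clique[OF C])
  obtain K where K: "Pclique K" "?S \<subseteq> K" "K \<subseteq> ?S \<union> Y"
    and maxK: "\<And>K'. Pclique K' \<Longrightarrow> ?S \<subseteq> K' \<Longrightarrow> K' \<subseteq> ?S \<union> Y \<Longrightarrow> card K' \<le> card K"
  proof -
    let ?Q = "\<lambda>K. Pclique K \<and> ?S \<subseteq> K \<and> K \<subseteq> ?S \<union> Y"
    have "?S \<in> Collect ?Q" using Scl by simp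
    then have ne: "Collect ?Q \<noteq> {}" by blast
    obtain K where "K \<in> Collect ?Q" "\<And>K'. K' \<in> Collect ?Q \<Longrightarrow> card K' \<le> card K"
      by (rule max_by_card[OF ne, of card]) auto
    then show thesis using that by blast
  qed
  \<comment> \<open>Otherwise a component beyond \<open>K\<close> lies in \<open>Y\<close>: either a
    vertex of it dominates \<open>K\<close> and enlarges the clique, or it is a strictly smaller
    side of a separator.\<close>
  have YK: "Y \<subseteq> K"
  proof (rule ccontr)
    assume "\<not> Y \<subseteq> K"
    then obtain y where y: "y \<in> Y" "y \<notin> K" by auto
    let ?C = "component (W - K) y"
    have yW: "y \<in> W - K" using y SY by auto
    have CY: "?C \<subseteq> Y"
      by (rule component_subset_closed[OF yW y(1)]) (use K(2) in \<open>auto simp: nbr_def\<close>)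
    have CK: "?C \<inter> K = {}" "?C \<subseteq> W" using component_subset[OF yW] by auto
    have nK: "nbr W ?C \<subseteq> K" by (rule nbr_component[OF yW])
    have Cne: "?C \<noteq> {}" using component_refl[of y] by auto
    show False
    proof (cases "nbr W ?C = K")
      case True
      have "\<exists>x\<in>?C. \<forall>s\<in>K. P x s"
        by (rule dominating_vertex[OF conn_component Cne K(1)]) (use CK True in \<open>auto simp: nbr_def\<close>)
      then obtain x where x: "x \<in> ?C" "\<forall>s\<in>K. P x s" by blast
      then have "Pclique (insert x K)" using K(1) P_sym by (auto simp: Pclique_def)
      moreover have "insert x K \<subseteq> ?S \<union> Y" using x CY K by auto
      ultimately have "card (insert x K) \<le> card K" using K(2) by (intro maxK) auto
      then show False using x CK by (simp add: card_insert_if disjoint_iff)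
    next
      case False
      then obtain k where k: "k \<in> K" "k \<notin> nbr W ?C" using nK by auto
      have "k \<in> W" using k K SY by auto
      have kP: "P k s" if "s \<in> nbr W ?C" for s
      proof -
        have "s \<in> K" "s \<noteq> k" using that nK k by auto
        then show ?thesis using K(1) k(1) by (auto simp: Pclique_def)
      qed
      have "sep W (component (W - nbr W ?C) k) ?C"
        by (rule sep_component[OF conn_component Cne CK(2) \<open>k \<in> W\<close>])
           (use k kP CK in auto)
      from minY[OF sep_sym[OF this]] have "?C = Y" using CY by (simp add: card_seteq)
      then have "K \<subseteq> ?S" using K(3) CK by auto
      then show False using k \<open>?C = Y\<close> by auto
    qed
  qed
  have KSY: "K = ?S \<union> Y" using K YK by auto
  obtain s s' where s: "s \<in> ?S" "s' \<in> ?S" "s \<noteq> s'" "\<not> N s s'" using sep_pair[OF C] .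
  have simp: "simplicial W y" if "y \<in> Y" for y
  proof -
    have "x \<in> K" if "x \<in> W" "P y x" for x using that \<open>y \<in> Y\<close> KSY by (auto simp: nbr_def)
    then show ?thesis using K(1) by (auto simp: simplicial_def Pclique_def)
  qed
  obtain b where b: "b \<in> Y" and minb: "\<And>w. w \<in> Y \<Longrightarrow> card {x \<in> W. N b x} \<le> card {x \<in> W. N w x}"
    using min_by_card[OF SY(4), of "\<lambda>b. card {x \<in> W. N b x}"] by blast
  have bW: "b \<in> W" using b SY by auto
  have PK: "P x y" if "x \<in> K" "y \<in> K" "x \<noteq> y" for x y using K(1) that by (auto simp: Pclique_def)
  have "flawless W b"
  proof (rule ccontr)
    assume "\<not> flawless W b"
    then obtain d w where dw: "d \<in> W" "w \<in> W" "d \<noteq> w" "N b d" "P b w" "\<not> N d w"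
      using not_flawlessE[OF _ bW simp[OF b]] by metis
    have bd: "b \<noteq> d" "b \<noteq> w" using dw N_P P_neq by blast+
    have "w \<notin> Y" using simplicial_card_less[OF bW simp[OF b] dw(2) simp dw(1,4,5,3,6)] minb[of w] by fastforce
    then have wS: "w \<in> ?S" using dw b by (auto simp: nbr_def)
    have dK: "d \<in> Y \<or> d \<in> ?S" using dw b N_P by (auto simp: nbr_def)
    then show False
    proof
      assume dS: "d \<in> ?S"
      have "via {b} (d, False) (w, True) [(d, False), (b, True), (w, True)]"
        by (rule via_single) (use dw N_sym in auto)
      then have "odd_via Y d w" by (rule odd_viaI) (use b in simp)
      then show False using even[OF C dS wS dw(3,6)] by simp
    next
      assume dY: "d \<in> Y"
      have neq: "s \<noteq> d" "s \<noteq> b" "s' \<noteq> d" "s' \<noteq> b" using s SY dY b by auto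
      \<comment> \<open>As \<open>Y\<close> and its separator form a clique, the negative edge
        between \<open>d\<close> and \<open>b\<close> can be inserted between any two separator
        vertices, in particular \<open>s\<close> and \<open>s'\<close>.\<close>
      have "via {fst (d, False), fst (b, True)} (s, False) (s', True) [(s, False), (d, False), (b, True), (s', True)]"
        by (rule via_double) (use s dY b KSY PK neq dw N_sym in auto)
      then have "odd_via Y s s'" by (rule odd_viaI) (use b dY in simp)
      then show False using even[OF C s] by simp
    qed
  qed
  then show ?thesis by blast
qed

end

section \<open>Existence of a flawless vertex\<close>

context chordal_signed_graph
begin

lemma via_snoc:
  assumes "via A x y L" "G y t" "fst t \<notin> A" "fst t \<noteq> fst x"
  shows "via (insert (fst y) A) x t (L @ [t])"
proof -
  obtain M where M: "L = x # M @ [y]" "M \<noteq> []" "fst ` set M \<subseteq> A" using assms(1) by (rule viaE)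
  have "fst t \<noteq> fst y" using P_neq[OF G_P[OF assms(2)]] by simp
  moreover have "fst t \<notin> fst ` set M" using M assms(3) by auto
  moreover have "distinct (map fst (x # M @ [y]))" "successively G (x # M @ [y])"
    using assms(1) M by (simp_all add: via_def)
  ultimately have "via (insert (fst y) A) x t (x # (M @ [y]) @ [t])"
    using M assms by (intro viaI) (auto simp: successively_append_iff successively_Cons split: if_splits)
  then show ?thesis by (simp add: M)
qed

lemma odd_via_snoc:
  assumes "odd_via A p q" "P q t" "t \<notin> A" "t \<noteq> p"
  shows "odd_via (insert q A) p t"
  using assms via_snoc[of A "(p, False)" "(q, True)" _ "(t, True)"] by (auto simp: odd_via_def)

lemma odd_via_extend:
  assumes odd: "odd_via A p q" and P: "P r p" "P q t"
    and neq: "r \<notin> A" "t \<notin> A" "r \<noteq> t" "r \<noteq> q" "t \<noteq> p"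
  shows "odd_via (insert p (insert q A)) r t"
proof -
  have "odd_via (insert q A) t p" using odd_via_snoc[OF odd P(2) neq(2,5)] by (rule odd_via_sym)
  then have "odd_via (insert p (insert q A)) t r" by (rule odd_via_snoc) (use assms P_sym in auto)
  then show ?thesis by (rule odd_via_sym)
qed

end

section \<open>A largest side carrying a forbidden odd path\<close>

locale odd_separation = undecomposable P N W for P N :: "'v::finite \<Rightarrow> 'v \<Rightarrow> bool" and W :: "'v set" +
  fixes A0 C0 :: "'v set" and p q :: 'v
  assumes sep0: "sep W A0 C0" and pq: "p \<in> nbr W A0" "q \<in> nbr W A0" "p \<noteq> q" "\<not> N p q"
    and odd: "odd_via A0 p q"
    and max: "sep W A C \<Longrightarrow> r \<in> nbr W A \<Longrightarrow> t \<in> nbr W A \<Longrightarrow> r \<noteq> t \<Longrightarrow> \<not> N r t \<Longrightarrow> odd_via A r t \<Longrightarrow>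
      card A \<le> card A0"
begin

abbreviation S0 where "S0 \<equiv> nbr W A0"

lemma A0: "A0 \<subseteq> W" "A0 \<noteq> {}" "conn A0" "S0 \<subseteq> W" "A0 \<inter> S0 = {}"
  using sep0 by (auto simp: sep_def nbr_def)

lemma S0_clique: "x \<in> S0 \<Longrightarrow> y \<in> S0 \<Longrightarrow> x \<noteq> y \<Longrightarrow> P x y"
  using sep_clique[OF sep0] by (auto simp: Pclique_def)

lemma outside: "a \<in> A0 \<Longrightarrow> v \<in> W \<Longrightarrow> v \<notin> A0 \<Longrightarrow> v \<notin> S0 \<Longrightarrow> \<not> P a v"
  by (auto simp: nbr_def)

text \<open>Such an edge would give an odd path \<open>p, b, q\<close> outside \<open>A0\<close>,
  which together with the one through \<open>A0\<close> would force \<open>N p q\<close>.\<close>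

lemma no_negative_edge_to_pair:
  assumes "b \<in> W" "b \<notin> A0" "b \<notin> S0" "P b p" "P b q"
  shows "\<not> N b p" "\<not> N b q"
proof -
  have neq: "b \<noteq> p" "b \<noteq> q" using assms pq by auto
  have False if "via {b} (p, False) (q, True) L" for L
    by (rule not_odd_both[OF odd that pq(4)]) (use assms pq A0 neq outside in auto)
  moreover have "via {b} (p, False) (q, True) [(p, False), (b, True), (q, True)]" if "N b p"
    by (rule via_single) (use that assms pq N_sym in auto)
  moreover have "via {b} (p, False) (q, True) [(p, False), (b, False), (q, True)]" if "N b q"
    by (rule via_single) (use that assms pq P_sym in auto)
  ultimately show "\<not> N b p" "\<not> N b q" by blast+
qed

lemma no_negative_edge_outside:
  assumes "b \<in> W" "b \<notin> A0" "b \<notin> S0" "z \<in> W" "z \<notin> A0" "z \<notin> S0" "P b p" "P z q" "N b z"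
  shows False
proof -
  have neq: "b \<noteq> p" "b \<noteq> q" "z \<noteq> p" "z \<noteq> q" using assms pq by auto
  have "via {fst (b, False), fst (z, True)} (p, False) (q, True) [(p, False), (b, False), (z, True), (q, True)]"
    by (rule via_double) (use assms pq neq P_sym in auto)
  then show False
    by (rule not_odd_both[OF odd _ pq(4)]) (use assms pq A0 neq outside in auto)
qed

text \<open>By maximality of \<open>A0\<close>, the component \<open>A\<close> beyond \<open>C\<close> admits no odd path; since \<open>A0 \<subseteq> A\<close>, the odd path
  through \<open>A0\<close> extends to a forbidden one unless \<open>z\<close> has a negative edge to \<open>p\<close> or \<open>q\<close>, which would then
  be closed to an odd path outside \<open>A0\<close>.\<close>

lemma no_branch:
  assumes K: "Pclique K" "K \<subseteq> W" "S0 \<subseteq> K" "K \<inter> A0 = {}"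
    and C: "conn C" "C \<noteq> {}" "C \<subseteq> W" "C \<inter> K = {}" "C \<inter> A0 = {}" "nbr W C \<subseteq> K"
    and z: "z \<in> nbr W C" "z \<notin> S0" and u: "\<not> S0 \<subseteq> nbr W C"
  shows False
proof -
  let ?S = "nbr W C"
  obtain u where u: "u \<in> S0" "u \<notin> ?S" using u by auto
  have PK: "P x y" if "x \<in> K" "y \<in> K" "x \<noteq> y" for x y using K(1) that by (auto simp: Pclique_def)
  define A where "A = component (W - ?S) u"
  have uX: "u \<in> W - ?S" using u A0 by auto
  have uS: "P u s" if "s \<in> ?S" for s
  proof -
    have "s \<in> K" "u \<in> K" "u \<noteq> s" using that u K(3) C(6) by auto
    then show ?thesis by (intro PK)
  qed
  have sepA: "sep W A C"
    unfolding A_def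
    by (rule sep_component[OF C(1,2,3) _ _ u(2) uS]) (use u K C in auto)
  have SA: "nbr W A = ?S" using sepA by (simp add: sep_def)
  have uA: "u \<in> A" by (simp add: A_def component_refl)
  have KA: "x \<in> A" if "x \<in> K" "x \<notin> ?S" for x
    using component_step[of u "W - ?S" u x] component_refl[of u "W - ?S"] uX that K PK[of u x] u
    unfolding A_def by (cases "x = u") auto
  obtain a where a: "a \<in> A0" "P a u" using u by (auto simp: nbr_def)
  have "a \<in> A"
    using component_step[OF component_refl[of u "W - ?S"] P_sym[OF a(2)] uX] a C(6) K(4) A0 by (auto simp: A_def)
  moreover have "A0 \<subseteq> W - ?S" using A0(1) C(6) K(4) by blast
  ultimately have A0A: "A0 \<subseteq> A"
    using conn_subset_component[OF A0(3) _ a(1), of "W - ?S" u] unfolding A_def by blast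
  have "u \<notin> A0" using u A0 by auto
  then have "card A0 < card A" using A0A uA by (intro psubset_card_mono) auto
  then have even: "\<not> odd_via A r t" if "r \<in> ?S" "t \<in> ?S" "r \<noteq> t" "\<not> N r t" for r t
    using max[OF sepA] that unfolding SA by fastforce
  have SA0: "x \<notin> A0" if "x \<in> ?S" for x using that C(6) K(4) by auto
  have half: False if x: "x \<in> ?S" "y \<notin> ?S" and xy: "x \<in> S0" "y \<in> S0" "x \<noteq> y" "\<not> N x y" "odd_via A0 x y" for x y
  proof (cases "N x z")
    case False
    have "z \<noteq> x" "z \<noteq> y" using z xy by auto
    moreover have "odd_via (insert y A0) x z"
      by (rule odd_via_snoc[OF xy(5)]) (use PK[of y z] xy z K C(6) SA0 \<open>z \<noteq> x\<close> \<open>z \<noteq> y\<close> in auto)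
    moreover have "insert y A0 \<subseteq> A" using A0A KA x xy K by auto
    ultimately show False using even[OF x(1) z(1)] False odd_via_mono by metis
  next
    case True
    have neq: "z \<noteq> x" "z \<noteq> y" "z \<in> W" "z \<notin> A0" using z xy SA0 by (auto simp: nbr_def)
    have "P z y" using PK[of z y] z C(6) xy K neq by auto
    then have "via {z} (x, False) (y, True) [(x, False), (z, True), (y, True)]"
      by (intro via_single) (use True xy in auto)
    then show False
      by (rule not_odd_both[OF xy(5) _ xy(4)]) (use neq z xy A0 outside in auto)
  qed
  obtain r t where rt: "r \<in> ?S" "t \<in> ?S" "r \<noteq> t" "\<not> N r t" using sep_pair[OF sepA] unfolding SA .
  consider "p \<in> ?S" "q \<in> ?S" | "p \<in> ?S" "q \<notin> ?S" | "q \<in> ?S" "p \<notin> ?S" | "p \<notin> ?S" "q \<notin> ?S" by blast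
  then show False
  proof cases
    case 1
    then show False using even[OF 1 pq(3,4)] odd_via_mono[OF odd A0A] by blast
  next
    case 2
    then show False by (rule half) (use pq odd in auto)
  next
    case 3
    then show False by (rule half) (use pq odd_via_sym[OF odd] N_sym in auto)
  next
    case 4
    \<comment> \<open>Here \<open>p\<close> and \<open>q\<close> both lie in \<open>A\<close>, so
      the odd path between them is prolonged at both ends by positive clique edges to
      \<open>r\<close> and \<open>t\<close>.\<close>
    have rtK: "r \<in> K" "t \<in> K" "p \<in> K" "q \<in> K" using rt C(6) pq K by auto
    have neq: "r \<noteq> p" "r \<noteq> q" "t \<noteq> p" "t \<noteq> q" using 4 rt by auto
    have "odd_via (insert p (insert q A0)) r t"
      by (rule odd_via_extend[OF odd]) (use PK rtK neq rt SA0 in auto)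
    moreover have "insert p (insert q A0) \<subseteq> A" using A0A KA 4 rtK by auto
    ultimately show False using even[OF rt] odd_via_mono by blast
  qed
qed

definition Theta where
  "Theta = {b \<in> W. b \<notin> A0 \<and> b \<notin> S0 \<and> simplicial W b \<and> (\<forall>s\<in>S0. P b s)}"

text \<open>A vertex dominating the separator is simplicial unless a neighbour escapes the clique it
  spans with the separator. The component of that neighbour is smaller, and \<open>no_branch\<close>
  keeps all of \<open>S0\<close> adjacent to it, so the induction goes on there.\<close>

lemma Theta_meets:
  assumes "conn C" "C \<noteq> {}" "C \<subseteq> W" "C \<inter> A0 = {}" "C \<inter> S0 = {}" "S0 \<subseteq> nbr W C" "Pclique (nbr W C)"
  shows "\<exists>b\<in>C. b \<in> Theta"
  using assms
proof (induction "card C" arbitrary: C rule: less_induct)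
  case less
  let ?S = "nbr W C"
  note C = less.prems
  have "\<exists>x\<in>C. \<forall>s\<in>?S. P x s"
    by (rule dominating_vertex[OF C(1,2,7)]) (auto simp: nbr_def)
  then obtain x where x: "x \<in> C" "\<And>s. s \<in> ?S \<Longrightarrow> P x s" by blast
  let ?K = "insert x ?S"
  have K: "Pclique ?K" using C(7) x(2) P_sym by (auto simp: Pclique_def)
  have SW: "?S \<subseteq> W" "C \<inter> ?S = {}" by (auto simp: nbr_def)
  show ?case
  proof (cases "\<forall>y\<in>W. P x y \<longrightarrow> y \<in> ?K")
    case True
    then have "simplicial W x" using K by (auto simp: simplicial_def Pclique_def)
    then have "x \<in> Theta" using x C by (auto simp: Theta_def)
    then show ?thesis using x by blast
  next
    case False
    then obtain y where y: "y \<in> W" "P x y" "y \<notin> ?K" by blast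
    then have yC: "y \<in> C" using x by (auto simp: nbr_def)
    define D where "D = component (W - ?K) y"
    have yX: "y \<in> W - ?K" using y by auto
    have DC: "D \<subseteq> C" unfolding D_def
      by (rule component_subset_closed[OF yX yC]) (auto simp: nbr_def)
    have DK: "D \<inter> ?K = {}" "D \<subseteq> W" using component_subset[OF yX] by (auto simp: D_def)
    have D: "conn D" "D \<noteq> {}" "nbr W D \<subseteq> ?K"
      unfolding D_def using conn_component component_refl[of y "W - ?K"] nbr_component[OF yX] by blast+
    have "card D < card C" using DC DK x by (intro psubset_card_mono) auto
    moreover have AS: "D \<inter> A0 = {}" "D \<inter> S0 = {}" using DC C by auto
    moreover have "Pclique (nbr W D)" using K D(3) by (auto simp: Pclique_def)
    ultimately have IH: "\<exists>b\<in>D. b \<in> Theta" if "S0 \<subseteq> nbr W D"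
      using less.hyps[of D] D DK that by blast
    have "y \<in> D" by (simp add: D_def component_refl)
    moreover have "x \<in> W" "x \<notin> D" using x(1) C(3) DK(1) by auto
    ultimately have xD: "x \<in> nbr W D" unfolding nbr_def using P_sym[OF y(2)] by blast
    have xS: "x \<notin> S0" using x C by auto
    have KA: "?K \<inter> A0 = {}"
    proof -
      have "s \<notin> A0" if s: "s \<in> ?S" for s
      proof
        assume "s \<in> A0"
        moreover obtain c where "c \<in> C" "P c s" using s by (auto simp: nbr_def)
        ultimately show False using outside[of s c] C(3,4,5) P_sym by blast
      qed
      then show ?thesis using x C by auto
    qed
    have KW: "?K \<subseteq> W" "S0 \<subseteq> ?K" using x(1) C(3,6) SW(1) by auto
    have "S0 \<subseteq> nbr W D"
      using no_branch[OF K KW KA D(1,2) DK(2,1) AS(1) D(3) xD xS] by blast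
    then show ?thesis using IH DC by blast
  qed
qed

lemma flawless_if_odd: "\<exists>v. flawless W v"
proof -
  have C0: "conn C0" "C0 \<noteq> {}" "C0 \<subseteq> W" "nbr W C0 = S0" "A0 \<inter> C0 = {}" using sep0 by (auto simp: sep_def)
  have "\<exists>b\<in>C0. b \<in> Theta"
  proof (rule Theta_meets[OF C0(1,2,3)])
    show "C0 \<inter> S0 = {}" unfolding C0(4)[symmetric] by (auto simp: nbr_def)
    show "Pclique (nbr W C0)" unfolding C0(4) by (rule sep_clique[OF sep0])
  qed (use C0 in auto)
  then have "Theta \<noteq> {}" by blast
  then obtain b where b: "b \<in> Theta"
    and minb: "\<And>w. w \<in> Theta \<Longrightarrow> card {x \<in> W. N b x} \<le> card {x \<in> W. N w x}"
    using min_by_card[of Theta "\<lambda>b. card {x \<in> W. N b x}"] by metis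
  have Theta: "v \<in> W" "v \<notin> A0" "v \<notin> S0" "simplicial W v" "\<And>s. s \<in> S0 \<Longrightarrow> P v s" if "v \<in> Theta" for v
    using that by (auto simp: Theta_def)
  \<comment> \<open>Any other end of a negative edge at \<open>v\<close> would complete an odd path
    from \<open>p\<close> to \<open>q\<close> outside \<open>A0\<close>.\<close>
  have NTheta: "z \<in> S0 \<and> z \<noteq> p \<and> z \<noteq> q" if v: "v \<in> Theta" and z: "z \<in> W" "N v z" for v z
  proof -
    have Pz: "P v z" using z N_P by blast
    have "z \<noteq> p" "z \<noteq> q" using no_negative_edge_to_pair[of v] Theta[OF v] z pq by auto
    moreover have "z \<in> S0"
    proof (rule ccontr)
      assume zS: "z \<notin> S0"
      have zA: "z \<notin> A0" using outside[of z v] Theta[OF v] Pz P_sym by blast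
      have "P z q" using Theta[OF v] z(1) Pz pq(2) A0(4) \<open>z \<noteq> q\<close> unfolding simplicial_def by blast
      then show False using no_negative_edge_outside[of v z] Theta[OF v] z zA zS pq by blast
    qed
    ultimately show ?thesis by blast
  qed
  note bT = Theta[OF b]
  have PN: "P x y" if "x \<in> W" "y \<in> W" "x \<noteq> y" "P b x" "P b y" for x y
    using bT(4) that unfolding simplicial_def by blast
  have "flawless W b"
  proof (rule ccontr)
    assume "\<not> flawless W b"
    then obtain d w where dw: "d \<in> W" "w \<in> W" "d \<noteq> w" "N b d" "P b w" "\<not> N d w"
      using not_flawlessE[OF _ bT(1,4)] by metis
    have d: "d \<in> S0" "d \<noteq> p" "d \<noteq> q" using NTheta[OF b dw(1,4)] by auto
    have Pbd: "P b d" using dw N_P by blast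
    have dA: "d \<notin> A0" using d A0 by auto
    have Pw: "P d w" using PN[of d w] dw Pbd by blast
    have via_dw: "via {b} (d, False) (w, True) [(d, False), (b, True), (w, True)]"
      by (rule via_single) (use dw N_sym in auto)
    show False
    proof (cases "w \<in> S0")
      case wS: True
      \<comment> \<open>Applied to \<open>p, q\<close> in both orders this forces
        \<open>N d q\<close> and \<open>N d p\<close>. Then \<open>star_apex\<close> leads from
        \<open>d\<close> into \<open>A0\<close> by a negative edge, and the resulting odd path to
        \<open>w\<close> competes with \<open>d, b, w\<close>.\<close>
      have five: False if "x \<in> S0" "y \<in> S0" "odd_via A0 x y" "x \<noteq> y" "\<not> N x y" "\<not> N d y" "\<not> N b x" "d \<noteq> x" "d \<noteq> y" for x y
        by (rule five_clique[of x d y b A0])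
           (use that S0_clique d bT dw A0 outside P_sym in \<open>auto simp del: disjoint_iff\<close>)
      have nb: "\<not> N b p" "\<not> N b q" using no_negative_edge_to_pair[of b] bT pq by auto
      have "N d q" using five[of p q] pq odd d nb by blast
      moreover have "N d p" using five[of q p] pq odd_via_sym[OF odd] d nb N_sym by blast
      ultimately obtain a where a: "a \<in> A0" "N d a" using star_apex[OF odd _ _ pq(4) dA] by blast
      obtain a' where a': "a' \<in> A0" "P a' w" using wS by (auto simp: nbr_def)
      have "w \<notin> A0" using wS A0 by auto
      then obtain L where "via A0 (d, False) (w, True) L"
        using conn_via[OF A0(3) a(1) a'(1), of d False True w] a a' dw dA by auto
      then have "odd_via A0 d w" by (auto simp: odd_via_def)
      then show False
        by (rule not_odd_both[OF _ via_dw dw(6)]) (use bT dA \<open>w \<notin> A0\<close> Pbd dw P_irrefl outside in auto)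
    next
      case wS: False
      have wA: "w \<notin> A0" using outside[of w b] bT dw P_sym by blast
      have wd: "P w s" if "s \<in> S0" for s
        using PN[of w s] that dw bT A0 wS by auto
      \<comment> \<open>By the choice of \<open>b\<close>, \<open>w\<close> is not simplicial and so
        has a neighbour outside the closed neighbourhood \<open>K\<close> of \<open>b\<close>. The
        component there contains a further vertex \<open>b3\<close> of \<open>Theta\<close>, to be
        compared with \<open>b\<close>.\<close>
      have "w \<notin> Theta"
        using simplicial_card_less[OF bT(1,4) dw(2) _ dw(1,4,5,3,6)] minb[of w] Theta[of w] by fastforce
      then have nsw: "\<not> simplicial W w" using dw wA wS wd by (auto simp: Theta_def)
      define K where "K = insert b {x \<in> W. P b x}"
      have K: "Pclique K" "K \<subseteq> W" "S0 \<subseteq> K" "w \<in> K"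
      proof -
        have "P x y" if "x \<in> K" "y \<in> K" "x \<noteq> y" for x y
          using that PN[of x y] P_sym[of b x] by (auto simp: K_def)
        then show "Pclique K" by (simp add: Pclique_def)
        show "S0 \<subseteq> K" using bT(5) A0(4) by (auto simp: K_def)
      qed (use bT(1) dw in \<open>simp_all add: K_def\<close>)
      have KA: "K \<inter> A0 = {}"
      proof -
        have "x \<notin> A0" if "P b x" for x using outside[OF _ bT(1,2,3)] P_sym[OF that] by blast
        then show ?thesis using bT(2) by (auto simp: K_def)
      qed
      have "\<exists>y\<in>W. P w y \<and> y \<notin> K"
      proof (rule ccontr)
        assume "\<not> ?thesis"
        then have "simplicial W w" using K(1) by (auto simp: simplicial_def Pclique_def)
        then show False using nsw by simp
      qed
      then obtain y where y: "y \<in> W" "P w y" "y \<notin> K" by blast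
      define C where "C = component (W - K) y"
      have yX: "y \<in> W - K" using y by auto
      have yC: "y \<in> C" by (simp add: C_def component_refl)
      have CK: "C \<inter> K = {}" "C \<subseteq> W" using component_subset[OF yX] by (auto simp: C_def)
      have C: "conn C" "C \<noteq> {}" "nbr W C \<subseteq> K" using conn_component yC nbr_component[OF yX] by (auto simp: C_def)
      have wC: "w \<in> nbr W C" using yC P_sym[OF y(2)] K(4) CK(1) dw(2) by (auto simp: nbr_def)
      have yA: "y \<notin> A0" using outside[of y w] y dw wA wS P_sym by blast
      have CA: "C \<inter> A0 = {}"
      proof -
        have "C \<subseteq> W - A0" unfolding C_def
        proof (rule component_subset_closed[OF yX])
          fix x z assume xz: "x \<in> W - A0" "x \<in> W - K" "z \<in> W - K" "P x z"
          then have "x \<notin> S0" using K(3) by auto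
          then show "z \<in> W - A0" using outside[of z x] P_sym[OF xz(4)] xz by blast
        qed (use yA y in simp)
        then show ?thesis by auto
      qed
      have CS: "C \<inter> S0 = {}" using CK K by auto
      have S0C: "S0 \<subseteq> nbr W C"
        using no_branch[OF K(1,2,3) KA C(1,2) CK(2,1) CA C(3) wC wS] by blast
      have "Pclique (nbr W C)" using K(1) C(3) by (auto simp: Pclique_def)
      then obtain b3 where b3: "b3 \<in> C" "b3 \<in> Theta"
        using Theta_meets[OF C(1,2) CK(2) CA CS S0C] by blast
      note b3T = Theta[OF b3(2)]
      have bC: "b \<notin> C" using CK by (auto simp: K_def)
      have Cb: "\<not> P c b" if "c \<in> C" for c
      proof
        assume "P c b"
        then have "c \<in> K" using that CK P_sym by (auto simp: K_def)
        then show False using that CK by auto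
      qed
      have inC: "d \<notin> C" "w \<notin> C" using d wC S0C by (auto simp: nbr_def)
      obtain c where c: "c \<in> C" "P c w" using wC by (auto simp: nbr_def)
      have oddC: "odd_via C e w" if "N b3 e" "e \<noteq> w" "e \<notin> C" for e
        using conn_via[OF C(1) b3(1) c(1), of e False True w] c inC that N_sym by (auto simp: odd_via_def)
      have "\<not> N b3 d"
      proof
        assume "N b3 d"
        then have "odd_via C d w" using oddC dw inC by blast
        then show False
          by (rule not_odd_both[OF _ via_dw dw(6)]) (use bC inC Cb Pbd dw P_irrefl in auto)
      qed
      \<comment> \<open>\<open>b\<close> has the negative neighbour \<open>d\<close>, which
        \<open>b3\<close> lacks, and not more negative neighbours than \<open>b3\<close>.\<close>
      have "\<exists>e. e \<in> W \<and> N b3 e \<and> \<not> N b e"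
      proof (rule ccontr)
        assume "\<not> ?thesis"
        then have "{x \<in> W. N b3 x} \<subseteq> {x \<in> W. N b x} - {d}" using \<open>\<not> N b3 d\<close> by auto
        then have "{x \<in> W. N b3 x} \<subset> {x \<in> W. N b x}" using dw by auto
        then have "card {x \<in> W. N b3 x} < card {x \<in> W. N b x}" by (rule psubset_card_mono[rotated]) simp
        then show False using minb[OF b3(2)] by simp
      qed
      then obtain e where e: "e \<in> W" "N b3 e" "\<not> N b e" by blast
      have eS: "e \<in> S0" using NTheta[OF b3(2) e(1,2)] by blast
      have eneq: "e \<noteq> d" "e \<noteq> w" "e \<noteq> b" "e \<notin> C" using e \<open>\<not> N b3 d\<close> eS wS bT CS by auto
      have Pe: "P d e" "P b e" "P w e" using S0_clique[OF d(1) eS] bT(5)[OF eS] wd[OF eS] eneq by auto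
      have nbw: "\<not> N b w" using NTheta[OF b dw(2)] wS by blast
      \<comment> \<open>The vertices \<open>b, d, e, w\<close> form a clique, and an odd path
        through \<open>C\<close> joins \<open>e\<close> to \<open>w\<close>. Without
        \<open>N e w\<close> this contradicts \<open>five_clique\<close>; with it,
        \<open>four_cycle\<close>.\<close>
      have "N e w"
      proof (rule ccontr)
        assume "\<not> N e w"
        show False
          by (rule five_clique[of e d w b C])
             (use Pe P_sym dw Pw oddC[OF e(2) eneq(2,4)] \<open>\<not> N e w\<close> e eneq inC bC Cb in auto)
      qed
      then show False
        by (rule four_cycle[OF dw(4) _ Pe(1) P_sym[OF dw(5)] e(3) dw(6)]) (use eneq dw in auto)
    qed
  qed
  then show ?thesis by blast
qed

end

section \<open>Combining the two cases\<close>

context undecomposable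
begin

lemma flawless_exists:
  assumes "W \<noteq> {}"
  shows "\<exists>v. flawless W v"
proof (cases "Pclique W")
  case True
  have simp: "simplicial W v" for v using True by (auto simp: simplicial_def Pclique_def)
  obtain b where b: "b \<in> W" and minb: "\<And>w. w \<in> W \<Longrightarrow> card {x \<in> W. N b x} \<le> card {x \<in> W. N w x}"
    using min_by_card[OF assms, of "\<lambda>b. card {x \<in> W. N b x}"] by blast
  have "flawless W b"
  proof (rule ccontr)
    assume "\<not> flawless W b"
    then obtain d w where dw: "d \<in> W" "w \<in> W" "d \<noteq> w" "N b d" "P b w" "\<not> N d w"
      using not_flawlessE[OF _ b simp] by metis
    then show False using simplicial_card_less[OF b simp dw(2) simp dw(1,4,5,3,6)] minb[of w] by fastforce
  qed
  then show ?thesis by blast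
next
  case False
  then obtain u v where uv: "u \<in> W" "v \<in> W" "u \<noteq> v" "\<not> P u v" by (auto simp: Pclique_def)
  \<comment> \<open>Off the closed neighbourhood of \<open>u\<close>, the component of
    \<open>v\<close> has only neighbours of \<open>u\<close> around it, so its neighbourhood is a
    minimal separator with \<open>u\<close> on a second full side.\<close>
  let ?X = "W - insert u (nbr W {u})"
  have vX: "v \<in> ?X" using uv by (auto simp: nbr_def)
  define C where "C = component ?X v"
  have C: "conn C" "C \<noteq> {}" "C \<subseteq> ?X"
    unfolding C_def using conn_component component_refl[of v ?X] component_subset[OF vX] by blast+
  have nC: "nbr W C \<subseteq> insert u (nbr W {u})" using nbr_component[OF vX] by (simp add: C_def)
  have uC: "u \<notin> nbr W C" using C(3) P_sym by (auto simp: nbr_def)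
  have sep0: "sep W (component (W - nbr W C) u) C"
    by (rule sep_component[OF C(1,2)]) (use C(3) uv uC nC in \<open>auto simp: nbr_def\<close>)
  let ?odd = "{A. \<exists>C p q. sep W A C \<and> p \<in> nbr W A \<and> q \<in> nbr W A \<and> p \<noteq> q \<and> \<not> N p q \<and> odd_via A p q}"
  show ?thesis
  proof (cases "?odd = {}")
    case True
    then show ?thesis using flawless_if_no_odd[OF sep0] by blast
  next
    case False
    obtain A0 where "A0 \<in> ?odd" and maxA: "\<And>A. A \<in> ?odd \<Longrightarrow> card A \<le> card A0"
      by (rule max_by_card[OF False, of card]) auto
    then obtain C p q where "sep W A0 C" "p \<in> nbr W A0" "q \<in> nbr W A0" "p \<noteq> q" "\<not> N p q" "odd_via A0 p q"
      by blast
    then interpret odd_separation P N W A0 C p q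
      by unfold_locales (use maxA in blast)+
    show ?thesis by (rule flawless_if_odd)
  qed
qed

end

theorem (in chordal_signed_graph) flawless_or_decomposition:
  assumes "W \<noteq> {}"
  shows "(\<exists>v. flawless W v) \<or> (\<exists>C\<subseteq>W. C \<noteq> {} \<and> Nclique (nbr W C) \<and> W - (C \<union> nbr W C) \<noteq> {})"
proof (rule disjCI)
  assume "\<not> (\<exists>C\<subseteq>W. C \<noteq> {} \<and> Nclique (nbr W C) \<and> W - (C \<union> nbr W C) \<noteq> {})"
  then interpret undecomposable P N W by unfold_locales blast
  show "\<exists>v. flawless W v" by (rule flawless_exists[OF assms])
qed

theorem theorem1p4:
  fixes Gp Gn :: "'v::finite set set"
  assumes "simple_edges Gp" and "simple_edges Gn"
    and "Gn \<subseteq> Gp"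
  shows "(balanced_chordal Gp Gn \<longleftrightarrow>
            free_arrangement (signed_arrangement Gp Gn UNIV :: ('k::field_char_0 ^ 'v) set set)) \<and>
         (free_arrangement (signed_arrangement Gp Gn UNIV :: ('k ^ 'v) set set) \<longleftrightarrow>
            (\<exists>L. free_arrangement (signed_arrangement Gp Gn L :: ('k ^ 'v) set set)))"
proof -
  define P where "P u v \<longleftrightarrow> {u, v} \<in> Gp" for u v
  define N where "N u v \<longleftrightarrow> {u, v} \<in> Gn" for u v
  have graph: "signed_graph P N"
    by unfold_locales (use assms in \<open>auto simp: P_def N_def insert_commute simple_edges_def\<close>)
  interpret signed_graph P N by (rule graph)
  have "free_arrangement (signed_arrangement Gp Gn UNIV :: ('k ^ 'v) set set)"
    if "balanced_chordal Gp Gn"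
  proof -
    interpret chordal_signed_graph P N
      by unfold_locales (rule chord_of_balanced_chordal[OF P_def N_def that])
    have "Nclique {}" by (simp add: Nclique_def)
    then have "vm.is_free (splines UNIV {} :: ('v \<Rightarrow> ('v, 'k) polynomials) set)"
      by (intro free_splines[OF flawless_or_decomposition]) simp_all
    then show ?thesis by (rule free_arrangement_if_free_splines[OF assms(1,2) P_def N_def])
  qed
  \<comment> \<open>Proved for every loop set at once, so that it covers (2) as well as (3).\<close>
  moreover have "balanced_chordal Gp Gn"
    if free: "free_arrangement (signed_arrangement Gp Gn L :: ('k ^ 'v) set set)" for L
  proof (rule ccontr)
    assume not_chordal: "\<not> balanced_chordal Gp Gn"
    obtain vs where "chordless_cycle P N vs (length vs)"
    proof (rule chordless_cycle_of_not_balanced_chordal[OF P_def N_def not_chordal])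
      fix vs
      assume vs: "4 \<le> length vs" "distinct (map fst vs)"
        "\<And>i. i < length vs \<Longrightarrow> G (vs ! i) (vs ! (Suc i mod length vs))"
        "\<And>i j. i + 2 \<le> j \<Longrightarrow> j < length vs \<Longrightarrow> G (vs ! i) (vs ! j) \<Longrightarrow> i = 0 \<and> Suc j = length vs"
      show thesis
        by (rule that[OF chordless_cycle.intro[OF graph chordless_cycle_axioms.intro[OF refl vs]]])
    qed
    then interpret chordless_cycle P N vs "length vs" .
    show False by (rule notE[OF not_free[OF assms(1,2) P_def N_def] free])
  qed
  ultimately show ?thesis by blast
qed

end
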